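(* Let $r \ge 1$. There is a complete set of primitive orthogonal idempotents for $\operatorname{Dist}(G_r)$ contained in $\operatorname{Dist}(G_r)^T$. That is, there exist pairwise orthogonal idempotents $e_1,\dots,e_n \in \operatorname{Dist}(G_r)^T$ with $e_1+\cdots+e_n = 1$ such that each $e_i$ is primitive as an idempotent of $\operatorname{Dist}(G_r)$.
   Context: $\Bbbk$ is an algebraically closed field of characteristic $p>0$, $G$ is a simple and simply connected algebraic group over $\Bbbk$, and $T \le G$ is a maximal torus. $G_r$ is the $r$-th Frobenius kernel of $G$ (the kernel of the $r$-th iterate of the Frobenius morphism). $\operatorname{Dist}(G_r)$ is the (finite-dimensional) algebra of distributions of $G_r$. The conjugation action of $T$ on $G_r$ induces an adjoint action of $T$ on $\operatorname{Dist}(G_r)$ by algebra automorphisms, and $\operatorname{Dist}(G_r)^T$ denotes the subalgebra of $T$-fixed elements. *)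

theory Defs
  imports
    "HOL-Analysis.Abstract_Topology"
    "HOL-Computational_Algebra.Polynomial"
    "HOL-Algebra.Ideal_Product"
    "HOL-Algebra.Module"
    "HOL-Algebra.Coset"
begin

section \<open>Affine algebraic groups over an algebraically closed field\<close>

text \<open>
  Over an algebraically closed field \<open>k\<close>, a (reduced) affine algebraic group is given by its group
  of \<open>k\<close>-points together with its coordinate algebra, a finitely generated \<open>k\<close>-algebra of functions
  on the points such that the points are exactly the \<open>k\<close>-algebra homomorphisms to \<open>k\<close>.
  Functions on a set are taken to be extensional (\<open>undefined\<close> outside the set).
\<close>

record ('g, 'k) alg_group = "'g monoid" +
  regular :: "('g \<Rightarrow> 'k) set"

definition coord_ring :: "('g, 'k::field) alg_group \<Rightarrow> ('k, 'g \<Rightarrow> 'k) module" where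
  "coord_ring G = \<lparr>
     carrier = regular G,
     monoid.mult = (\<lambda>f g. \<lambda>x\<in>carrier G. f x * g x),
     one = (\<lambda>x\<in>carrier G. 1),
     ring.zero = (\<lambda>x\<in>carrier G. 0),
     add = (\<lambda>f g. \<lambda>x\<in>carrier G. f x + g x),
     module.smult = (\<lambda>c f. \<lambda>x\<in>carrier G. c * f x) \<rparr>"

inductive_set generated_functions :: "'a set \<Rightarrow> ('a \<Rightarrow> 'k::field) set \<Rightarrow> ('a \<Rightarrow> 'k) set"
  for X :: "'a set" and S :: "('a \<Rightarrow> 'k) set" where
  const: "(\<lambda>x\<in>X. c) \<in> generated_functions X S"
| gen: "f \<in> S \<Longrightarrow> f \<in> generated_functions X S"
| add: "f \<in> generated_functions X S \<Longrightarrow> g \<in> generated_functions X S \<Longrightarrow>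
    (\<lambda>x\<in>X. f x + g x) \<in> generated_functions X S"
| mult: "f \<in> generated_functions X S \<Longrightarrow> g \<in> generated_functions X S \<Longrightarrow>
    (\<lambda>x\<in>X. f x * g x) \<in> generated_functions X S"

definition linear_functional :: "('g, 'k::field) alg_group \<Rightarrow> (('g \<Rightarrow> 'k) \<Rightarrow> 'k) \<Rightarrow> bool" where
  "linear_functional G \<mu> \<longleftrightarrow>
     (\<forall>f\<in>regular G. \<forall>g\<in>regular G. \<mu> (f \<oplus>\<^bsub>coord_ring G\<^esub> g) = \<mu> f + \<mu> g) \<and>
     (\<forall>c. \<forall>f\<in>regular G. \<mu> (c \<odot>\<^bsub>coord_ring G\<^esub> f) = c * \<mu> f)"

definition algebra_character :: "('g, 'k::field) alg_group \<Rightarrow> (('g \<Rightarrow> 'k) \<Rightarrow> 'k) \<Rightarrow> bool" where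
  "algebra_character G \<chi> \<longleftrightarrow> linear_functional G \<chi> \<and> \<chi> \<one>\<^bsub>coord_ring G\<^esub> = 1 \<and>
     (\<forall>f\<in>regular G. \<forall>g\<in>regular G. \<chi> (f \<otimes>\<^bsub>coord_ring G\<^esub> g) = \<chi> f * \<chi> g)"

text \<open>
  The axiom \<open>comult\<close> says that \<open>(x, y) \<mapsto> f (x y)\<close> lies in \<open>k[G] \<otimes> k[G]\<close>, i.e. that multiplication is
  a morphism of varieties. Uniqueness in \<open>points\<close> says that regular functions separate points.
\<close>

locale affine_alg_group = group G
  for G :: "('g, 'k::alg_closed_field) alg_group" (structure) +
  assumes finitely_generated:
    "\<exists>S. finite S \<and> S \<subseteq> extensional (carrier G) \<and> regular G = generated_functions (carrier G) S"
  and points: "algebra_character G \<chi> \<Longrightarrow> \<exists>!x. x \<in> carrier G \<and> (\<forall>f\<in>regular G. \<chi> f = f x)"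
  and comult: "f \<in> regular G \<Longrightarrow>
    \<exists>(n::nat) a b. (\<forall>i<n. a i \<in> regular G \<and> b i \<in> regular G) \<and>
      (\<forall>x\<in>carrier G. \<forall>y\<in>carrier G. f (x \<otimes> y) = (\<Sum>i<n. a i x * b i y))"
  and antipode: "f \<in> regular G \<Longrightarrow> (\<lambda>x\<in>carrier G. f (inv x)) \<in> regular G"

definition zariski :: "('g, 'k::field) alg_group \<Rightarrow> 'g topology" where
  "zariski G = topology_generated_by {{x \<in> carrier G. f x \<noteq> 0} | f. f \<in> regular G}"

definition closed_subgroup :: "'g set \<Rightarrow> ('g, 'k::field) alg_group \<Rightarrow> bool" where
  "closed_subgroup H G \<longleftrightarrow> subgroup H G \<and> closedin (zariski G) H"

definition restrict_group :: "('g, 'k::field) alg_group \<Rightarrow> 'g set \<Rightarrow> ('g, 'k) alg_group" where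
  "restrict_group G H = G\<lparr>carrier := H, regular := (\<lambda>f. restrict f H) ` regular G\<rparr>"

definition alg_group_hom ::
    "('g, 'k::field) alg_group \<Rightarrow> ('h, 'k) alg_group \<Rightarrow> ('g \<Rightarrow> 'h) \<Rightarrow> bool" where
  "alg_group_hom G H \<phi> \<longleftrightarrow>
     \<phi> \<in> hom G H \<and> (\<forall>f\<in>regular H. compose (carrier G) f \<phi> \<in> regular G)"

definition alg_group_iso ::
    "('g, 'k::field) alg_group \<Rightarrow> ('h, 'k) alg_group \<Rightarrow> ('g \<Rightarrow> 'h) \<Rightarrow> bool" where
  "alg_group_iso G H \<phi> \<longleftrightarrow> alg_group_hom G H \<phi> \<and> bij_betw \<phi> (carrier G) (carrier H) \<and>
     alg_group_hom H G (inv_into (carrier G) \<phi>)"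


section \<open>Scheme-theoretic kernels and Frobenius kernels\<close>

text \<open>
  Closed subgroup schemes of \<open>G\<close>, which need not be reduced, are represented by their ideals in
  \<open>k[G]\<close>. The scheme-theoretic kernel of \<open>\<phi> : G \<rightarrow> H\<close> is the fibre over the identity, cut out by the
  pull-backs of the functions on \<open>H\<close> vanishing at the identity.
\<close>

definition augmentation_ideal :: "('g, 'k::field) alg_group \<Rightarrow> ('g \<Rightarrow> 'k) set" where
  "augmentation_ideal G = {f \<in> regular G. f \<one>\<^bsub>G\<^esub> = 0}"

definition kernel_ideal ::
    "('g, 'k::field) alg_group \<Rightarrow> ('h, 'k) alg_group \<Rightarrow> ('g \<Rightarrow> 'h) \<Rightarrow> ('g \<Rightarrow> 'k) set" where
  "kernel_ideal G H \<phi> =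
     Idl\<^bsub>coord_ring G\<^esub> ((\<lambda>f. compose (carrier G) f \<phi>) ` augmentation_ideal H)"

text \<open>
  The Frobenius morphism \<open>G \<rightarrow> G\<^sup>(\<^sup>1\<^sup>)\<close> is bijective on points, with comorphism
  \<open>k \<otimes> k[G] \<rightarrow> k[G], a \<otimes> f \<mapsto> a f\<^sup>p\<close> (the tensor product along the Frobenius of \<open>k\<close>). As \<open>k\<close> is
  perfect and \<open>k[G]\<close> is reduced, this comorphism identifies the coordinate algebra of the twist with
  the algebra of \<open>p\<close>-th powers in \<open>k[G]\<close>. We thus realise \<open>G\<^sup>(\<^sup>1\<^sup>)\<close> on the same points as \<open>G\<close>, so that
  the Frobenius morphism is the identity on points; its \<open>r\<close>-th iterate is the identity
  \<open>G \<rightarrow> G\<^sup>(\<^sup>r\<^sup>)\<close>.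
\<close>

definition frobenius_twist :: "('g, 'k::field) alg_group \<Rightarrow> ('g, 'k) alg_group" where
  "frobenius_twist G =
     G\<lparr>regular := (\<lambda>f. \<lambda>x\<in>carrier G. f x ^ CHAR('k)) ` regular G\<rparr>"

definition frobenius_kernel :: "('g, 'k::field) alg_group \<Rightarrow> nat \<Rightarrow> ('g \<Rightarrow> 'k) set" where
  "frobenius_kernel G r = kernel_ideal G ((frobenius_twist ^^ r) G) (\<lambda>x. x)"


section \<open>Simple and simply connected groups, maximal tori\<close>

definition simple_alg_group :: "('g, 'k::field) alg_group \<Rightarrow> bool" where
  "simple_alg_group G \<longleftrightarrow> connected_space (zariski G) \<and> \<not> comm_group G \<and>
     (\<forall>N. N \<lhd> G \<and> closedin (zariski G) N \<and> connectedin (zariski G) N \<longrightarrow>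
        N = {\<one>\<^bsub>G\<^esub>} \<or> N = carrier G)"

text \<open>
  A surjective homomorphism with finite kernel whose scheme-theoretic kernel is central, i.e. every
  element of \<open>H\<close> acts trivially by conjugation on the coordinate algebra of the kernel. It suffices
  to test \<open>k\<close>-points because \<open>H\<close> is reduced. Looking only at the kernel on points
  would not do: the Frobenius morphism has trivial kernel on points but is not a central isogeny.
\<close>

definition central_isogeny ::
    "('h, 'k::field) alg_group \<Rightarrow> ('g, 'k) alg_group \<Rightarrow> ('h \<Rightarrow> 'g) \<Rightarrow> bool" where
  "central_isogeny H G \<phi> \<longleftrightarrow> alg_group_hom H G \<phi> \<and> \<phi> ` carrier H = carrier G \<and>
     finite (kernel H G \<phi>) \<and>
     (\<forall>h\<in>carrier H. \<forall>f\<in>regular H.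
        (\<lambda>x\<in>carrier H. f (h \<otimes>\<^bsub>H\<^esub> x \<otimes>\<^bsub>H\<^esub> inv\<^bsub>H\<^esub> h) - f x) \<in> kernel_ideal H G \<phi>)"

text \<open>
  A connected semisimple group is simply connected if every central isogeny onto it from a
  connected group is an isomorphism. Letting \<open>H\<close> range over groups on the type of \<open>G\<close> is no
  restriction when \<open>G\<close> is infinite: \<open>\<phi>\<close> has finite fibres, so \<open>H\<close> is equipotent to \<open>G\<close>.
\<close>

definition simply_connected_group :: "('g, 'k::alg_closed_field) alg_group \<Rightarrow> bool" where
  "simply_connected_group G \<longleftrightarrow>
     (\<forall>(H :: ('g, 'k) alg_group) \<phi>.
        affine_alg_group H \<and> connected_space (zariski H) \<and> central_isogeny H G \<phi> \<longrightarrow>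
        alg_group_iso H G \<phi>)"

definition standard_torus :: "nat \<Rightarrow> (nat \<Rightarrow> 'k::field, 'k) alg_group" where
  "standard_torus n = (let X = {..<n} \<rightarrow>\<^sub>E (- {0}) in \<lparr>
     carrier = X,
     monoid.mult = (\<lambda>x y. \<lambda>i\<in>{..<n}. x i * y i),
     one = (\<lambda>i\<in>{..<n}. 1),
     regular = generated_functions X
       ((\<lambda>i. \<lambda>x\<in>X. x i) ` {..<n} \<union> (\<lambda>i. \<lambda>x\<in>X. inverse (x i)) ` {..<n}) \<rparr>)"

definition torus_in :: "'g set \<Rightarrow> ('g, 'k::field) alg_group \<Rightarrow> bool" where
  "torus_in T G \<longleftrightarrow> closed_subgroup T G \<and>
     (\<exists>n \<phi>. alg_group_iso (restrict_group G T) (standard_torus n) \<phi>)"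

definition maximal_torus :: "'g set \<Rightarrow> ('g, 'k::field) alg_group \<Rightarrow> bool" where
  "maximal_torus T G \<longleftrightarrow> torus_in T G \<and> (\<forall>T'. torus_in T' G \<and> T \<subseteq> T' \<longrightarrow> T' = T)"


section \<open>Distribution algebras\<close>

text \<open>
  Let \<open>J\<close> be the ideal of a closed subgroup scheme \<open>N\<close> of \<open>G\<close>. A distribution on \<open>N\<close> (with support
  at the identity) is a linear functional on \<open>k[N] = k[G]/J\<close>, here viewed as a functional on \<open>k[G]\<close>
  vanishing on \<open>J\<close>, that vanishes on some power of the augmentation ideal.

  The convolution product is \<open>(\<mu> \<nu>)(f) = (\<mu> \<otimes> \<nu>)(\<Delta> f)\<close>. If \<open>f (x y) = (\<Sum>i. a\<^sub>i x * b\<^sub>i y)\<close>, then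
  \<open>y \<mapsto> f (x y)\<close> is \<open>\<Sum>i. a\<^sub>i x * b\<^sub>i\<close>, so applying \<open>\<nu>\<close> in \<open>y\<close> and then \<open>\<mu>\<close> in \<open>x\<close> gives
  \<open>\<Sum>i. \<mu> a\<^sub>i * \<nu> b\<^sub>i\<close>.
\<close>

definition distributions ::
    "('g, 'k::field) alg_group \<Rightarrow> ('g \<Rightarrow> 'k) set \<Rightarrow> (('g \<Rightarrow> 'k) \<Rightarrow> 'k) set" where
  "distributions G J = {\<mu> \<in> extensional (regular G). linear_functional G \<mu> \<and>
     (\<forall>f\<in>J. \<mu> f = 0) \<and>
     (\<exists>n::nat. \<forall>f \<in> augmentation_ideal G [^]\<^bsub>ideals_set (coord_ring G)\<^esub> n. \<mu> f = 0)}"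

definition Dist ::
    "('g, 'k::field) alg_group \<Rightarrow> ('g \<Rightarrow> 'k) set \<Rightarrow> ('k, ('g \<Rightarrow> 'k) \<Rightarrow> 'k) module" where
  "Dist G J = \<lparr>
     carrier = distributions G J,
     monoid.mult = (\<lambda>\<mu> \<nu>. \<lambda>f\<in>regular G.
       \<mu> (\<lambda>x\<in>carrier G. \<nu> (\<lambda>y\<in>carrier G. f (x \<otimes>\<^bsub>G\<^esub> y)))),
     one = (\<lambda>f\<in>regular G. f \<one>\<^bsub>G\<^esub>),
     ring.zero = (\<lambda>f\<in>regular G. 0),
     add = (\<lambda>\<mu> \<nu>. \<lambda>f\<in>regular G. \<mu> f + \<nu> f),
     module.smult = (\<lambda>c \<mu>. \<lambda>f\<in>regular G. c * \<mu> f) \<rparr>"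

text \<open>
  The adjoint action is the push-forward of distributions along \<open>x \<mapsto> t x t\<^sup>-\<^sup>1\<close>. As \<open>T\<close> is reduced,
  the fixed elements are those fixed by all \<open>k\<close>-points of \<open>T\<close>.
\<close>

definition Ad :: "('g, 'k::field) alg_group \<Rightarrow> 'g \<Rightarrow> (('g \<Rightarrow> 'k) \<Rightarrow> 'k) \<Rightarrow> ('g \<Rightarrow> 'k) \<Rightarrow> 'k" where
  "Ad G t \<mu> = (\<lambda>f\<in>regular G. \<mu> (\<lambda>x\<in>carrier G. f (t \<otimes>\<^bsub>G\<^esub> x \<otimes>\<^bsub>G\<^esub> inv\<^bsub>G\<^esub> t)))"

definition Dist_fixed ::
    "('g, 'k::field) alg_group \<Rightarrow> ('g \<Rightarrow> 'k) set \<Rightarrow> 'g set \<Rightarrow> (('g \<Rightarrow> 'k) \<Rightarrow> 'k) set" where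
  "Dist_fixed G J T = {\<mu> \<in> carrier (Dist G J). \<forall>t\<in>T. Ad G t \<mu> = \<mu>}"


section \<open>Idempotents\<close>

definition idempotent_elt :: "('a, 'm) ring_scheme \<Rightarrow> 'a \<Rightarrow> bool" where
  "idempotent_elt R e \<longleftrightarrow> e \<in> carrier R \<and> e \<otimes>\<^bsub>R\<^esub> e = e"

definition orthogonal_elts :: "('a, 'm) ring_scheme \<Rightarrow> 'a \<Rightarrow> 'a \<Rightarrow> bool" where
  "orthogonal_elts R e f \<longleftrightarrow> e \<otimes>\<^bsub>R\<^esub> f = \<zero>\<^bsub>R\<^esub> \<and> f \<otimes>\<^bsub>R\<^esub> e = \<zero>\<^bsub>R\<^esub>"

definition primitive_idempotent :: "('a, 'm) ring_scheme \<Rightarrow> 'a \<Rightarrow> bool" where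
  "primitive_idempotent R e \<longleftrightarrow> idempotent_elt R e \<and> e \<noteq> \<zero>\<^bsub>R\<^esub> \<and>
     \<not> (\<exists>f g. idempotent_elt R f \<and> idempotent_elt R g \<and> f \<noteq> \<zero>\<^bsub>R\<^esub> \<and> g \<noteq> \<zero>\<^bsub>R\<^esub> \<and>
            orthogonal_elts R f g \<and> e = f \<oplus>\<^bsub>R\<^esub> g)"

end

theory Submission
  imports Defs "HOL-Library.Function_Algebras"
begin

text \<open>
  Write \<open>A\<close> for \<open>Dist(G\<^sub>r)\<close>. As an abstract group, a torus \<open>T\<close> is commutative and divisible, because it is
  a power of \<open>k\<^sup>*\<close> and \<open>k\<close> is algebraically closed; it acts on the finite-dimensional algebra \<open>A\<close> by
  algebra automorphisms. These facts already force every idempotent that is primitive in the fixed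
  algebra \<open>A\<^sup>T\<close> to be primitive in \<open>A\<close>, and \<open>1\<close> is a sum of orthogonal primitive idempotents of \<open>A\<^sup>T\<close>,
  because splitting idempotents in \<open>A\<^sup>T\<close> must stop for reasons of dimension
  (\<open>primitive_decomposition\<close>).

  \<^emph>\<open>Weights.\<close> Let \<open>q\<close> be a power of the characteristic that is at least \<open>dim A\<close>. Every \<open>t\<close> is some \<open>s\<^sup>q\<close>, and
  raising an operator to the power \<open>q\<close> kills the nilpotent part of its Jordan decomposition, so every
  \<open>t\<close> acts diagonalisably (\<open>eigenvectors_span_char_power\<close>). Since the operators commute, \<open>A\<close> is spanned
  by weight vectors (\<open>homogeneous_spans\<close>). Divisibility also makes the group of weights torsion-free: if
  \<open>\<chi>\<^sup>n = 1\<close>, then \<open>\<chi>(s\<^sup>n) = \<chi>(s)\<^sup>n = 1\<close> for all \<open>s\<close>, hence \<open>\<chi> = 1\<close>. As \<open>A\<close> has only finitely many weights, a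
  weight vector of non-trivial weight is nilpotent (\<open>nontrivial_weight_nilpotent\<close>).

  \<^emph>\<open>Locality.\<close> Let \<open>e\<close> be primitive in \<open>A\<^sup>T\<close>. The corner \<open>e A e\<close> inherits the action, and its fixed algebra
  has only the idempotents \<open>0\<close> and \<open>e\<close>; so, writing \<open>A\<close> for the corner, every element of \<open>A\<^sup>T\<close> is nilpotent or
  a unit. Let \<open>I\<close> be the span of the nilpotent weight vectors. If \<open>x\<close> is one of them and \<open>b\<close> has the
  inverse weight, then \<open>b x\<close> is not a unit of \<open>A\<^sup>T\<close>, so it is nilpotent. It follows that the left ideals
  \<open>A x\<^sub>n\<close>, \<open>A x\<^sub>n\<^sub>-\<^sub>1 x\<^sub>n\<close>, ... shrink strictly until they vanish, so that products of more than
  \<open>dim A\<close> nilpotent weight vectors are zero and \<open>I\<close> is nil (\<open>span_nilpotents_nilpotent\<close>). Finally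
  \<open>A = A\<^sup>T + I\<close>, so an idempotent of \<open>A\<close> is either in \<open>I\<close>, and then \<open>0\<close>, or congruent modulo \<open>I\<close> to a unit
  of \<open>A\<^sup>T\<close>, and then \<open>1\<close> (\<open>trivial_idempotents\<close>).

  \<^emph>\<open>The algebra of distributions.\<close> Let \<open>M\<close> be the augmentation ideal and \<open>q\<close> the \<open>r\<close>-th power of the
  characteristic. The ideal of \<open>G\<^sub>r\<close> is generated by the \<open>q\<close>-th powers of elements of \<open>M\<close>. For \<open>g \<in> M\<close> the
  comultiplication can be written \<open>\<Delta>g = \<Sum>a\<^sub>i \<otimes> b\<^sub>i\<close> with \<open>a\<^sub>i \<in> M\<close> or \<open>b\<^sub>i \<in> M\<close> for each \<open>i\<close>
  (\<open>comult_augmentation\<close>), and then \<open>(\<mu>\<nu>)\<cdot>g = \<Sum>(\<mu>\<cdot>a\<^sub>i)(\<nu>\<cdot>b\<^sub>i)\<close> for convolution (\<open>dot_conv\<close>). This formula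
  shows that convolution preserves both conditions that define a distribution on \<open>G\<^sub>r\<close>. Modulo the ideal
  of \<open>G\<^sub>r\<close>, every \<open>s\<^sup>q\<close> is a constant, so finitely many monomials in generators of \<open>k[G]\<close> determine a
  distribution and \<open>A\<close> is finite-dimensional (\<open>finite_dim_dist_space\<close>).
\<close>

section \<open>Chains of subspaces and powers of operators\<close>

context vector_space
begin

lemma dim_less_of_psubset:
  assumes U: "subspace U" and UW: "U \<subset> W" and W: "W \<subseteq> span F" and F: "finite F"
  shows "dim U < dim W"
proof -
  obtain B where B: "B \<subseteq> U" "independent B" "U \<subseteq> span B" "card B = dim U"
    using basis_exists by blast
  obtain w where w: "w \<in> W" "w \<notin> U" using UW by blast
  have "span B \<subseteq> U" using B(1) U span_minimal by blast
  then have "w \<notin> span B" using w by blast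
  then have ind: "independent (insert w B)" using B(2) by (simp add: independent_insertI)
  obtain B' where B': "insert w B \<subseteq> B'" "B' \<subseteq> W" "independent B'" "W \<subseteq> span B'"
    using maximal_independent_subset_extend[of "insert w B" W] ind B(1) UW w by blast
  have "finite B'" using independent_span_bound[OF F B'(3)] B'(2) W by blast
  then have "card (insert w B) \<le> card B'" "finite B"
    using B'(1) by (auto intro: card_mono finite_subset)
  moreover have "w \<notin> B" using \<open>w \<notin> span B\<close> span_base by blast
  moreover have "card B' = dim W" using B' basis_card_eq_dim by blast
  ultimately show ?thesis using B(4) by simp
qed

lemma dim_le_of_subset:
  assumes "subspace U" "U \<subseteq> W" "W \<subseteq> span F" "finite F"
  shows "dim U \<le> dim W"
  using dim_less_of_psubset[OF assms(1) _ assms(3,4)] assms(2)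
  by (metis less_imp_le order_refl psubsetI)

lemma descending_chain_stabilises:
  fixes U :: "nat \<Rightarrow> 'b set"
  assumes sub: "\<And>n. subspace (U n)" and dec: "\<And>n. U (Suc n) \<subseteq> U n"
    and fin: "U 0 \<subseteq> span F" "finite F"
  obtains n where "U (Suc n) = U n"
proof -
  have "U n \<subseteq> U 0" for n using dec by (induction n) auto
  then have span: "U n \<subseteq> span F" for n using fin(1) by blast
  have "\<exists>n. U (Suc n) = U n"
  proof (rule ccontr)
    assume "\<nexists>n. U (Suc n) = U n"
    then have "U (Suc n) \<subset> U n" for n using dec by blast
    then have lt: "dim (U (Suc n)) < dim (U n)" for n
      using dim_less_of_psubset[OF sub _ span fin(2)] by blast
    have "dim (U n) + n \<le> dim (U 0)" for n
    proof (induction n)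
      case (Suc n)
      then show ?case using lt[of n] by simp
    qed simp
    from this[of "Suc (dim (U 0))"] show False by simp
  qed
  then show thesis using that by blast
qed

lemma ascending_chain_stabilises:
  fixes U :: "nat \<Rightarrow> 'b set"
  assumes sub: "\<And>n. subspace (U n)" and inc: "\<And>n. U n \<subseteq> U (Suc n)"
    and le: "\<And>n. U n \<subseteq> W" and fin: "W \<subseteq> span F" "finite F"
  obtains n where "n \<le> dim W" "U (Suc n) = U n"
proof -
  have "\<exists>n\<le>dim W. U (Suc n) = U n"
  proof (rule ccontr)
    assume neg: "\<not> (\<exists>n\<le>dim W. U (Suc n) = U n)"
    have "n \<le> dim (U n)" if "n \<le> Suc (dim W)" for n
      using that
    proof (induction n)
      case (Suc n)
      have "U n \<noteq> U (Suc n)" using neg Suc.prems by (metis Suc_le_mono)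
      then have "U n \<subset> U (Suc n)" using inc by blast
      moreover have "U (Suc n) \<subseteq> span F" using le fin(1) by blast
      ultimately have "dim (U n) < dim (U (Suc n))"
        using dim_less_of_psubset[OF sub _ _ fin(2)] by blast
      then show ?case using Suc by simp
    qed simp
    from this[of "Suc (dim W)"] have "Suc (dim W) \<le> dim (U (Suc (dim W)))" by simp
    also have "\<dots> \<le> dim W" using dim_le_of_subset[OF sub le fin] .
    finally show False by simp
  qed
  then show thesis using that by blast
qed

end

locale linear_endo_on = vector_space scale
  for scale :: "'a::field \<Rightarrow> 'b::ab_group_add \<Rightarrow> 'b" (infixr \<open>*s\<close> 75) +
  fixes V :: "'b set" and f :: "'b \<Rightarrow> 'b"
  assumes subspace_V: "subspace V"
    and closed: "v \<in> V \<Longrightarrow> f v \<in> V"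
    and add: "v \<in> V \<Longrightarrow> w \<in> V \<Longrightarrow> f (v + w) = f v + f w"
    and scale: "v \<in> V \<Longrightarrow> f (c *s v) = c *s f v"
begin

text \<open>Horner's scheme for \<open>p(f) v\<close>. Applying \<open>f\<close> to the argument first makes the recursion equation hold
  without any assumption on \<open>f\<close>.\<close>

definition op_poly :: "'a poly \<Rightarrow> 'b \<Rightarrow> 'b" where
  "op_poly p = fold_coeffs (\<lambda>a g v. a *s v + g (f v)) p (\<lambda>v. 0)"

lemma op_poly_0 [simp]: "op_poly 0 v = 0"
  by (simp add: op_poly_def)

lemma op_poly_pCons [simp]: "op_poly (pCons a p) v = a *s v + op_poly p (f v)"
proof -
  have *: "(\<lambda>g v. 0 *s v + g (f v)) (\<lambda>v. 0) = (\<lambda>v. 0::'b)" by simp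
  show ?thesis
    unfolding op_poly_def by (cases "p = 0 \<and> a = 0") auto
qed

lemma op_poly_add: "op_poly (p + q) v = op_poly p v + op_poly q v"
  by (induction p q arbitrary: v rule: poly_induct2) (auto simp: algebra_simps scale_left_distrib)

lemma op_poly_smult: "op_poly (Polynomial.smult c p) v = c *s op_poly p v"
  by (induction p arbitrary: v) (auto simp: scale_right_distrib)

lemma op_poly_monom: "op_poly (monom 1 n) v = (f ^^ n) v"
  by (induction n arbitrary: v) (auto simp: monom_Suc monom_0 funpow_swap1)

lemma map_0: "f 0 = 0"
  using scale[of 0 0] subspace_0[OF subspace_V] by simp

lemma linear_endo_on_funpow: "linear_endo_on (*s) V (f ^^ n)"
proof (induction n)
  case 0
  show ?case using subspace_V by unfold_locales auto
next
  case (Suc n)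
  interpret n: linear_endo_on "(*s)" V "f ^^ n" by (rule Suc)
  show ?case using subspace_V by unfold_locales (auto simp: closed add scale n.closed n.add n.scale)
qed

lemma op_poly_closed: "v \<in> V \<Longrightarrow> op_poly p v \<in> V"
  by (induction p arbitrary: v)
    (auto simp: closed subspace_V subspace_0 intro!: subspace_add subspace_scale)

lemma op_poly_vec_add: "v \<in> V \<Longrightarrow> w \<in> V \<Longrightarrow> op_poly p (v + w) = op_poly p v + op_poly p w"
  by (induction p arbitrary: v w) (auto simp: closed add scale_right_distrib)

lemma op_poly_vec_scale: "v \<in> V \<Longrightarrow> op_poly p (c *s v) = c *s op_poly p v"
  by (induction p arbitrary: v) (auto simp: closed scale scale_right_distrib mult.commute)

lemma op_poly_vec_0 [simp]: "op_poly p 0 = 0"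
  by (induction p) (auto simp: map_0)

lemma op_poly_map: "v \<in> V \<Longrightarrow> op_poly p (f v) = f (op_poly p v)"
  by (induction p arbitrary: v)
    (auto simp: map_0 closed op_poly_closed add scale subspace_scale[OF subspace_V])

lemma op_poly_mult: "v \<in> V \<Longrightarrow> op_poly (p * q) v = op_poly p (op_poly q v)"
  by (induction p arbitrary: v)
    (auto simp: op_poly_add op_poly_smult op_poly_map closed op_poly_closed)

lemma op_poly_eigenvector:
  "v \<in> V \<Longrightarrow> f v = c *s v \<Longrightarrow> op_poly p v = poly p c *s v"
  by (induction p) (auto simp: op_poly_vec_scale scale_left_distrib)

text \<open>If \<open>w = (\<Prod>a\<in>C. (f - a)) v\<close> is killed by \<open>f - c\<close>, it is an eigenvector, and subtracting a suitable
  multiple of \<open>w\<close> from \<open>v\<close> gives a vector that is already killed by \<open>\<Prod>a\<in>C. (f - a)\<close>.\<close>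

lemma in_span_eigenvectors_of_squarefree:
  assumes "finite C" "v \<in> V" "op_poly (\<Prod>a\<in>C. [:- a, 1:]) v = 0"
  shows "v \<in> span {w \<in> V. \<exists>c. f w = c *s w}"
  using assms
proof (induction C arbitrary: v rule: finite_induct)
  case empty
  then show ?case by (simp add: span_zero one_pCons)
next
  case (insert c C)
  let ?P = "\<Prod>a\<in>C. [:- a, 1:]"
  define w where "w = op_poly ?P v"
  have wV: "w \<in> V" using insert.prems op_poly_closed w_def by simp
  have "op_poly ([:- c, 1:] * ?P) v = 0" using insert by simp
  then have "op_poly [:- c, 1:] w = 0"
    unfolding w_def using insert.prems(1) by (simp only: op_poly_mult)
  then have w: "f w = c *s w" by (simp add: algebra_simps)
  define K where "K = poly ?P c"
  have K: "K \<noteq> 0" using insert.hyps by (auto simp: K_def poly_prod)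
  define v' where "v' = v + (- (1 / K)) *s w"
  have v': "v' \<in> V" unfolding v'_def using insert.prems wV subspace_V
    by (intro subspace_add subspace_scale)
  have "op_poly ?P w = K *s w" unfolding K_def by (rule op_poly_eigenvector[OF wV w])
  moreover have "op_poly ?P v' = w + (- (1 / K)) *s op_poly ?P w"
    unfolding v'_def w_def using insert.prems wV[unfolded w_def] subspace_scale[OF subspace_V]
    by (simp only: op_poly_vec_add op_poly_vec_scale)
  ultimately have "op_poly ?P v' = 0" using K by simp
  then have 1: "v' \<in> span {w \<in> V. \<exists>c. f w = c *s w}" using insert.IH v' by blast
  have 2: "(1 / K) *s w \<in> span {w \<in> V. \<exists>c. f w = c *s w}"
    using wV w by (intro span_scale span_base) blast
  have "v = v' + (1 / K) *s w" by (simp add: v'_def)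
  then show ?case using span_add[OF 1 2] by simp
qed

text \<open>The spans of \<open>v, f v, ..., f\<^sup>n\<^sup>-\<^sup>1 v\<close> form an ascending chain in \<open>V\<close>. Once it stops, \<open>f\<^sup>n v\<close> is a combination
  of the earlier vectors. The bound on the degree does not depend on \<open>f\<close>; this allows \<open>f\<close> to be chosen
  after the exponent in \<open>eigenvectors_span_char_power\<close>.\<close>

lemma annihilating_poly:
  assumes v: "v \<in> V" and fin: "V \<subseteq> span F" "finite F"
  obtains m where "m \<noteq> 0" "degree m \<le> dim V" "op_poly m v = 0"
proof -
  define U where "U n = {op_poly p v | p. \<forall>i\<ge>n. coeff p i = 0}" for n
  have sub: "subspace (U n)" for n
  proof (rule subspaceI)
    show "0 \<in> U n" unfolding U_def by (rule CollectI, rule exI[of _ 0]) simp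
    show "x + y \<in> U n" if "x \<in> U n" "y \<in> U n" for x y
      using that unfolding U_def by (force simp: op_poly_add[symmetric])
    show "c *s x \<in> U n" if "x \<in> U n" for c x
      using that unfolding U_def by (force simp: op_poly_smult[symmetric])
  qed
  have inc: "U n \<subseteq> U (Suc n)" for n unfolding U_def by auto
  have le: "U n \<subseteq> V" for n unfolding U_def using op_poly_closed[OF v] by auto
  obtain n where n: "n \<le> dim V" "U (Suc n) = U n"
    using ascending_chain_stabilises[where U = U and W = V, OF sub inc le fin] by blast
  have "op_poly (monom 1 n) v \<in> U (Suc n)" unfolding U_def by auto
  then have "op_poly (monom 1 n) v \<in> U n" using n(2) by simp
  then obtain p where p: "op_poly (monom 1 n) v = op_poly p v" "\<forall>i\<ge>n. coeff p i = 0"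
    unfolding U_def by auto
  define m where "m = monom 1 n + Polynomial.smult (-1) p"
  have c: "coeff m n = 1" using p(2) by (simp add: m_def)
  have "degree m \<le> n" by (rule degree_le) (use p(2) in \<open>auto simp: m_def\<close>)
  moreover have "m \<noteq> 0" using c by auto
  moreover have "op_poly m v = 0" unfolding m_def op_poly_add op_poly_smult p(1) by simp
  ultimately show thesis using that n(1) by fastforce
qed

end

lemma linear_factor_pow_char:
  fixes a :: "'a::field"
  assumes "CHAR('a) > 0"
  shows "[:- a, 1:] ^ (CHAR('a) ^ N) = monom 1 (CHAR('a) ^ N) + [:- (a ^ (CHAR('a) ^ N)):]"
proof -
  have p: "prime CHAR('a)" using assms by (rule prime_CHAR_semidom)
  let ?q = "CHAR('a) ^ N"
  have "([:- a, 1:] + [:a:]) ^ ?q = [:- a, 1:] ^ ?q + [:a:] ^ ?q"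
    by (rule freshmans_dream'[where n = N]) (simp_all add: p)
  moreover have "[:- a, 1:] + [:a:] = monom 1 (Suc 0)" by (simp add: monom_Suc monom_0)
  moreover have "monom (1::'a) (Suc 0) ^ ?q = monom 1 ?q" by (simp add: monom_power)
  moreover have "[:a:] ^ ?q = [:a ^ ?q:]" by (rule poly_const_pow)
  moreover have "- [:a ^ ?q:] = [:- (a ^ ?q):]" by simp
  ultimately show ?thesis by (metis add_diff_cancel_right' diff_conv_add_uminus)
qed

lemma inj_pow_char:
  fixes a b :: "'a::field"
  assumes "CHAR('a) > 0" "a ^ (CHAR('a) ^ N) = b ^ (CHAR('a) ^ N)"
  shows "a = b"
proof -
  have p: "prime CHAR('a)" using assms(1) by (rule prime_CHAR_semidom)
  have "((a - b) + b) ^ (CHAR('a) ^ N) = (a - b) ^ (CHAR('a) ^ N) + b ^ (CHAR('a) ^ N)"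
    using p by (intro freshmans_dream') auto
  then show ?thesis using assms(2) by simp
qed

context linear_endo_on
begin

lemma op_poly_funpow_char:
  assumes char: "CHAR('a) > 0" and "finite R" "v \<in> V" and q: "q = CHAR('a) ^ N"
  shows "linear_endo_on.op_poly (*s) (f ^^ q) (\<Prod>a\<in>R. [:- (a ^ q), 1:]) v = op_poly (\<Prod>a\<in>R. [:- a, 1:] ^ q) v"
proof -
  interpret F: linear_endo_on "(*s)" V "f ^^ q" by (rule linear_endo_on_funpow)
  show ?thesis
  using assms(2,3)
proof (induction R arbitrary: v rule: finite_induct)
  case (insert a R)
  let ?w = "op_poly (\<Prod>a\<in>R. [:- a, 1:] ^ q) v"
  have "op_poly ([:- a, 1:] ^ q) ?w = (f ^^ q) ?w + (- (a ^ q)) *s ?w"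
    unfolding q linear_factor_pow_char[OF char] op_poly_add op_poly_monom by simp
  moreover have "op_poly (\<Prod>a\<in>insert a R. [:- a, 1:] ^ q) v = op_poly ([:- a, 1:] ^ q) ?w"
    by (simp only: prod.insert[OF insert.hyps] op_poly_mult[OF insert.prems])
  moreover have "F.op_poly (\<Prod>a\<in>insert a R. [:- (a ^ q), 1:]) v = F.op_poly [:- (a ^ q), 1:] ?w"
    by (simp only: prod.insert[OF insert.hyps] F.op_poly_mult[OF insert.prems] insert.IH[OF insert.prems])
  ultimately show ?case by (simp add: add.commute)
qed (simp add: one_pCons)
qed

end

text \<open>For a power \<open>q\<close> of the characteristic, \<open>(x - a)\<^sup>q = x\<^sup>q - a\<^sup>q\<close>. If \<open>m(f) v = 0\<close> and \<open>q\<close> bounds the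
  multiplicities of the roots \<open>a\<close> of \<open>m\<close>, then \<open>\<Prod>(x - a)\<^sup>q\<close> is a multiple of \<open>m\<close>, so \<open>f\<^sup>q\<close> is annihilated
  on \<open>v\<close> by \<open>\<Prod>(x - a\<^sup>q)\<close>, whose roots are simple because \<open>a \<mapsto> a\<^sup>q\<close> is injective. The hypothesis \<open>split\<close> expresses that the field is
  algebraically closed.\<close>

lemma (in linear_endo_on) eigenvectors_span_char_power:
  assumes char: "CHAR('a) > 0" 
    and split: "\<And>m::'a poly. m \<noteq> 0 \<Longrightarrow> \<exists>M. m = Polynomial.smult (lead_coeff m) (\<Prod>x\<in>#M. [:- x, 1:])"
    and fin: "V \<subseteq> span F" "finite F" and q: "q = CHAR('a) ^ N" and dim: "dim V \<le> q"
  shows "V \<subseteq> span {w \<in> V. \<exists>c. (f ^^ q) w = c *s w}"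
proof
  fix v assume v: "v \<in> V"
  interpret F: linear_endo_on "(*s)" V "f ^^ q" by (rule linear_endo_on_funpow)
  obtain m where m: "m \<noteq> 0" "degree m \<le> dim V" "op_poly m v = 0"
    using annihilating_poly[OF v fin] by blast
  obtain M where M: "m = Polynomial.smult (lead_coeff m) (\<Prod>x\<in>#M. [:- x, 1:])"
    using split[OF m(1)] by blast
  let ?P = "\<Prod>a\<in>set_mset M. [:- a, 1:] ^ q"
  have nz: "(\<Prod>x\<in>#M. [:- x, 1:]) \<noteq> 0" for M :: "'a multiset" by auto
  have deg: "degree (\<Prod>x\<in>#M. [:- x, 1:]) = size M" for M :: "'a multiset"
  proof (induction M)
    case (add x M)
    have "degree ([:- x, 1:] * (\<Prod>x\<in>#M. [:- x, 1:])) = Suc (size M)"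
      by (subst degree_mult_eq[OF _ nz]) (use add in auto)
    then show ?case by simp
  qed simp
  have "degree m = degree (\<Prod>x\<in>#M. [:- x, 1:])"
    using m(1) arg_cong[OF M, of degree] by simp
  also have "\<dots> = size M" by (rule deg)
  finally have size: "size M \<le> q" using m(2) dim by simp
  have "(\<Prod>x\<in>#M. [:- x, 1:]) = (\<Prod>a\<in>set_mset M. [:- a, 1:] ^ count M a)"
    by (rule image_prod_mset_multiplicity)
  also have "\<dots> dvd ?P"
    by (intro prod_dvd_prod le_imp_power_dvd le_trans[OF count_le_size size])
  finally have "Polynomial.smult (lead_coeff m) (\<Prod>x\<in>#M. [:- x, 1:]) dvd ?P"
    using m(1) by (intro smult_dvd) auto
  then have "m dvd ?P" using M by simp
  then obtain k where "?P = m * k" by (rule dvdE)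
  then have "?P = k * m" by (simp only: mult.commute)
  then have "op_poly ?P v = 0" by (simp only: op_poly_mult[OF v] m(3) op_poly_vec_0)
  then have "F.op_poly (\<Prod>a\<in>set_mset M. [:- (a ^ q), 1:]) v = 0"
    by (simp only: op_poly_funpow_char[OF char finite_set_mset v q])
  moreover have "(\<Prod>a\<in>set_mset M. [:- (a ^ q), 1:]) = (\<Prod>a\<in>(\<lambda>a. a ^ q) ` set_mset M. [:- a, 1:])"
  proof (subst prod.reindex)
    show "inj_on (\<lambda>a. a ^ q) (set_mset M)"
      by (rule inj_onI) (rule inj_pow_char[OF char], simp only: q)
  qed simp
  ultimately show "v \<in> span {w \<in> V. \<exists>c. (f ^^ q) w = c *s w}"
    by (intro F.in_span_eigenvectors_of_squarefree[OF finite_imageI[OF finite_set_mset] v]) simp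
qed

section \<open>Finite-dimensional algebras\<close>

text \<open>The algebra is a subspace \<open>A\<close> of an ambient vector space, with a multiplication that is only meaningful
  on \<open>A\<close>. In this way a corner \<open>e A e\<close> of the algebra and the algebra of distributions, a set of functions,
  are both instances.\<close>

locale fin_dim_algebra = vector_space scale
  for scale :: "'k::field \<Rightarrow> 'v::ab_group_add \<Rightarrow> 'v" (infixr \<open>*s\<close> 75) +
  fixes A :: "'v set" and mul :: "'v \<Rightarrow> 'v \<Rightarrow> 'v" (infixl \<open>\<star>\<close> 70) and unit :: 'v
  assumes subspace_A: "subspace A"
    and finite_dim: "\<exists>F. finite F \<and> A \<subseteq> span F"
    and mul_closed: "a \<in> A \<Longrightarrow> b \<in> A \<Longrightarrow> a \<star> b \<in> A"
    and mul_assoc: "a \<in> A \<Longrightarrow> b \<in> A \<Longrightarrow> c \<in> A \<Longrightarrow> a \<star> b \<star> c = a \<star> (b \<star> c)"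
    and mul_add_left: "a \<in> A \<Longrightarrow> b \<in> A \<Longrightarrow> c \<in> A \<Longrightarrow> (a + b) \<star> c = a \<star> c + b \<star> c"
    and mul_add_right: "a \<in> A \<Longrightarrow> b \<in> A \<Longrightarrow> c \<in> A \<Longrightarrow> a \<star> (b + c) = a \<star> b + a \<star> c"
    and mul_scale_left: "a \<in> A \<Longrightarrow> b \<in> A \<Longrightarrow> (x *s a) \<star> b = x *s (a \<star> b)"
    and mul_scale_right: "a \<in> A \<Longrightarrow> b \<in> A \<Longrightarrow> a \<star> (x *s b) = x *s (a \<star> b)"
    and unit_closed: "unit \<in> A"
    and unit_left: "a \<in> A \<Longrightarrow> unit \<star> a = a"
    and unit_right: "a \<in> A \<Longrightarrow> a \<star> unit = a"
begin

lemmas zero_closed = subspace_0[OF subspace_A]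
lemmas add_closed = subspace_add[OF subspace_A]
lemmas diff_closed = subspace_diff[OF subspace_A]
lemmas neg_closed = subspace_neg[OF subspace_A]
lemmas scale_closed = subspace_scale[OF subspace_A]

lemmas closed = zero_closed add_closed diff_closed neg_closed scale_closed mul_closed unit_closed

lemma mul_zero_left: "a \<in> A \<Longrightarrow> 0 \<star> a = 0"
  using mul_scale_left[of 0 a 0] zero_closed by simp

lemma mul_zero_right: "a \<in> A \<Longrightarrow> a \<star> 0 = 0"
  using mul_scale_right[of a 0 0] zero_closed by simp

lemma mul_diff_left: "a \<in> A \<Longrightarrow> b \<in> A \<Longrightarrow> c \<in> A \<Longrightarrow> (a - b) \<star> c = a \<star> c - b \<star> c"
  using mul_add_left[of "a - b" b c] by (simp add: closed algebra_simps)

lemma mul_diff_right: "a \<in> A \<Longrightarrow> b \<in> A \<Longrightarrow> c \<in> A \<Longrightarrow> a \<star> (b - c) = a \<star> b - a \<star> c"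
  using mul_add_right[of a "b - c" c] by (simp add: closed algebra_simps)

lemma mul_sum_right:
  "finite E \<Longrightarrow> E \<subseteq> A \<Longrightarrow> a \<in> A \<Longrightarrow> a \<star> (\<Sum>E) = (\<Sum>x\<in>E. a \<star> x)"
proof (induction E rule: finite_induct)
  case (insert x E)
  then have "\<Sum>E \<in> A" using subspace_sum[OF subspace_A, of E "\<lambda>x. x"] by auto
  then show ?case using insert by (simp add: mul_add_right)
qed (simp add: mul_zero_right)

lemma mul_sum_left:
  "finite E \<Longrightarrow> E \<subseteq> A \<Longrightarrow> a \<in> A \<Longrightarrow> (\<Sum>E) \<star> a = (\<Sum>x\<in>E. x \<star> a)"
proof (induction E rule: finite_induct)
  case (insert x E)
  then have "\<Sum>E \<in> A" using subspace_sum[OF subspace_A, of E "\<lambda>x. x"] by auto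
  then show ?case using insert by (simp add: mul_add_left)
qed (simp add: mul_zero_left)

definition pow :: "'v \<Rightarrow> nat \<Rightarrow> 'v" where "pow x n = ((\<star>) x ^^ n) unit"

lemma pow_0 [simp]: "pow x 0 = unit"
  by (simp add: pow_def)

lemma pow_Suc: "pow x (Suc n) = x \<star> pow x n"
  by (simp add: pow_def)

lemma pow_closed: "x \<in> A \<Longrightarrow> pow x n \<in> A"
  by (induction n) (auto simp: pow_Suc closed)

lemma pow_commute:
  "x \<in> A \<Longrightarrow> y \<in> A \<Longrightarrow> x \<star> y = y \<star> x \<Longrightarrow> pow x n \<star> y = y \<star> pow x n"
proof (induction n)
  case (Suc n)
  have "pow x (Suc n) \<star> y = x \<star> (y \<star> pow x n)"
    using Suc by (simp add: pow_Suc mul_assoc pow_closed)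
  also have "\<dots> = y \<star> pow x (Suc n)"
    using Suc by (simp add: pow_Suc pow_closed flip: mul_assoc)
  finally show ?case .
qed (simp add: unit_left unit_right)

lemma pow_Suc_right: "x \<in> A \<Longrightarrow> pow x (Suc n) = pow x n \<star> x"
  by (simp add: pow_Suc pow_commute)

lemma pow_mul:
  assumes x: "x \<in> A" and y: "y \<in> A" and xy: "x \<star> y = y \<star> x"
  shows "pow (x \<star> y) n = pow x n \<star> pow y n"
proof (induction n)
  case (Suc n)
  have "pow (x \<star> y) (Suc n) = x \<star> (y \<star> pow x n \<star> pow y n)"
    using Suc x y by (simp add: pow_Suc mul_assoc closed pow_closed)
  also have "\<dots> = x \<star> (pow x n \<star> y \<star> pow y n)"
    using pow_commute[OF x y xy] by simp
  also have "\<dots> = pow x (Suc n) \<star> pow y (Suc n)"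
    using x y by (simp add: pow_Suc mul_assoc closed pow_closed)
  finally show ?case .
qed (simp add: unit_closed unit_left)

lemma pow_idempotent: "x \<in> A \<Longrightarrow> x \<star> x = x \<Longrightarrow> pow x (Suc n) = x"
  by (induction n) (simp_all add: pow_Suc unit_right)

lemma pow_mul_fixpoint: "a \<in> A \<Longrightarrow> y \<in> A \<Longrightarrow> a \<star> y = y \<Longrightarrow> pow a n \<star> y = y"
  by (induction n) (simp_all add: unit_left pow_Suc mul_assoc pow_closed)

lemma pow_left_inverse:
  assumes c: "c \<in> A" and x: "x \<in> A" and cx: "c \<star> x = unit"
  shows "pow c n \<star> pow x n = unit"
proof (induction n)
  case (Suc n)
  have "pow c (Suc n) \<star> pow x (Suc n) = pow c n \<star> ((c \<star> x) \<star> pow x n)"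
    using c x by (simp add: pow_Suc_right[of c] pow_Suc[of x] mul_assoc closed pow_closed)
  then show ?case using Suc cx x by (simp add: unit_left pow_closed)
qed (simp add: unit_closed unit_left)

definition left_ideal :: "'v \<Rightarrow> 'v set" where "left_ideal y = {b \<star> y | b. b \<in> A}"

lemma left_ideal_subset: "y \<in> A \<Longrightarrow> left_ideal y \<subseteq> A"
  by (auto simp: left_ideal_def closed)

lemma left_ideal_self: "y \<in> A \<Longrightarrow> y \<in> left_ideal y"
  unfolding left_ideal_def using unit_left[of y] unit_closed by force

lemma left_ideal_mono: "x \<in> A \<Longrightarrow> y \<in> A \<Longrightarrow> left_ideal (x \<star> y) \<subseteq> left_ideal y"
proof
  fix z assume xy: "x \<in> A" "y \<in> A" and "z \<in> left_ideal (x \<star> y)"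
  then obtain b where b: "b \<in> A" "z = b \<star> (x \<star> y)" unfolding left_ideal_def by blast
  then have "z = (b \<star> x) \<star> y" "b \<star> x \<in> A" using xy by (simp_all add: mul_assoc mul_closed)
  then show "z \<in> left_ideal y" unfolding left_ideal_def by blast
qed

lemma subspace_mul_image:
  assumes S: "subspace S" "S \<subseteq> A" and y: "y \<in> A"
  shows "subspace {b \<star> y | b. b \<in> S}"
proof (rule subspaceI)
  show "0 \<in> {b \<star> y | b. b \<in> S}" using mul_zero_left[OF y] subspace_0[OF S(1)] by force
  show "u + v \<in> {b \<star> y | b. b \<in> S}" if "u \<in> {b \<star> y | b. b \<in> S}" "v \<in> {b \<star> y | b. b \<in> S}" for u v
  proof -
    from that obtain a b where "u = a \<star> y" "v = b \<star> y" "a \<in> S" "b \<in> S" by blast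
    then have "u + v = (a + b) \<star> y" "a + b \<in> S"
      using S y subspace_add[OF S(1)] by (auto simp: mul_add_left subset_iff)
    then show ?thesis by blast
  qed
  show "c *s u \<in> {b \<star> y | b. b \<in> S}" if "u \<in> {b \<star> y | b. b \<in> S}" for c u
  proof -
    from that obtain a where "u = a \<star> y" "a \<in> S" by blast
    then have "c *s u = (c *s a) \<star> y" "c *s a \<in> S"
      using S y subspace_scale[OF S(1)] by (auto simp: mul_scale_left subset_iff)
    then show ?thesis by blast
  qed
qed

lemma subspace_left_ideal: "y \<in> A \<Longrightarrow> subspace (left_ideal y)"
  unfolding left_ideal_def by (rule subspace_mul_image[OF subspace_A order_refl])

lemma dim_less_in_A: "subspace U \<Longrightarrow> U \<subset> W \<Longrightarrow> W \<subseteq> A \<Longrightarrow> dim U < dim W"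
  using finite_dim dim_less_of_psubset by (meson order_trans)

text \<open>Both summands are required to lie in \<open>S\<close>, so that primitivity in the fixed subalgebra and in the whole
  algebra can be compared.\<close>

definition primitive_in :: "'v set \<Rightarrow> 'v \<Rightarrow> bool" where
  "primitive_in S e \<longleftrightarrow> e \<in> S \<and> e \<star> e = e \<and> e \<noteq> 0 \<and>
     \<not> (\<exists>f\<in>S. \<exists>g\<in>S. f \<star> f = f \<and> g \<star> g = g \<and> f \<noteq> 0 \<and> g \<noteq> 0 \<and> f \<star> g = 0 \<and> g \<star> f = 0 \<and> e = f + g)"

definition orthogonal_family :: "'v set \<Rightarrow> bool" where
  "orthogonal_family E \<longleftrightarrow> (\<forall>x\<in>E. \<forall>y\<in>E. x \<noteq> y \<longrightarrow> x \<star> y = 0)"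

lemma orthogonal_family_sum:
  assumes E: "finite E" "E \<subseteq> A" "orthogonal_family E" and x: "x \<in> E" "x \<star> x = x"
  shows "x \<star> (\<Sum>E) = x" "(\<Sum>E) \<star> x = x"
proof -
  have "x \<star> (\<Sum>E) = (\<Sum>y\<in>E. if y = x then x else 0)"
    using E x unfolding mul_sum_right[OF E(1,2) subsetD[OF E(2) x(1)]]
    by (intro sum.cong) (auto simp: orthogonal_family_def)
  then show "x \<star> (\<Sum>E) = x" using E(1) x(1) by simp
  have "(\<Sum>E) \<star> x = (\<Sum>y\<in>E. if y = x then x else 0)"
    using E x unfolding mul_sum_left[OF E(1,2) subsetD[OF E(2) x(1)]]
    by (intro sum.cong) (auto simp: orthogonal_family_def)
  then show "(\<Sum>E) \<star> x = x" using E(1) x(1) by simp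
qed

text \<open>If \<open>f + g\<close> were in the left ideal of \<open>f\<close>, say \<open>f + g = b f\<close>, multiplying by \<open>g\<close> on the right gives \<open>g = 0\<close>.\<close>

lemma left_ideal_summand:
  assumes "f \<in> A" "g \<in> A" "f \<star> f = f" "g \<star> g = g" "g \<noteq> 0" "f \<star> g = 0" "g \<star> f = 0"
  shows "dim (left_ideal f) < dim (left_ideal (f + g))"
proof (rule dim_less_in_A)
  show "subspace (left_ideal f)" using assms subspace_left_ideal by blast
  show "left_ideal (f + g) \<subseteq> A" using assms left_ideal_subset closed by blast
  have "f \<star> (f + g) = f" using assms by (simp add: mul_add_right)
  then have "left_ideal f \<subseteq> left_ideal (f + g)"
    using left_ideal_mono[of f "f + g"] assms closed by simp
  moreover have "f + g \<notin> left_ideal f"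
  proof
    assume "f + g \<in> left_ideal f"
    then obtain b where b: "b \<in> A" "f + g = b \<star> f" unfolding left_ideal_def by blast
    have "g = (f + g) \<star> g" using assms by (simp add: mul_add_left)
    also have "\<dots> = 0" using assms b by (simp add: mul_assoc mul_zero_right)
    finally show False using assms by simp
  qed
  ultimately show "left_ideal f \<subset> left_ideal (f + g)"
    using left_ideal_self[of "f + g"] assms closed by blast
qed

text \<open>As long as an idempotent \<open>e\<close> is not primitive it splits as \<open>f + g\<close>, and the left ideals of \<open>f\<close> and \<open>g\<close> have
  smaller dimension than that of \<open>e\<close>. Pieces \<open>x\<close> of \<open>f\<close> and \<open>y\<close> of \<open>g\<close> are orthogonal since
  \<open>x y = x f g y = 0\<close>.\<close>

lemma primitive_decomposition:
  assumes S: "S \<subseteq> A"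
  shows "e \<in> S \<Longrightarrow> e \<star> e = e \<Longrightarrow>
    \<exists>E. finite E \<and> (\<forall>x\<in>E. primitive_in S x) \<and> orthogonal_family E \<and> \<Sum>E = e"
proof (induction "dim (left_ideal e)" arbitrary: e rule: less_induct)
  case less
  consider (zero) "e = 0" | (prim) "primitive_in S e" | (split) "e \<noteq> 0" "\<not> primitive_in S e"
    by argo
  then show ?case
  proof cases
    case zero
    then show ?thesis by (intro exI[of _ "{}"]) (simp add: orthogonal_family_def)
  next
    case prim
    then show ?thesis by (intro exI[of _ "{e}"]) (simp add: orthogonal_family_def)
  next
    case split
    then obtain f g where fg: "f \<in> S" "g \<in> S" "f \<star> f = f" "g \<star> g = g" "f \<noteq> 0" "g \<noteq> 0"
      "f \<star> g = 0" "g \<star> f = 0" "e = f + g"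
      unfolding primitive_in_def using less.prems by fast
    have A: "f \<in> A" "g \<in> A" using fg S by auto
    have "dim (left_ideal f) < dim (left_ideal e)" "dim (left_ideal g) < dim (left_ideal e)"
      using left_ideal_summand[of f g] left_ideal_summand[of g f] fg A by (simp_all add: add.commute)
    then obtain E F where
      E: "finite E" "\<forall>x\<in>E. primitive_in S x" "orthogonal_family E" "\<Sum>E = f" and
      F: "finite F" "\<forall>x\<in>F. primitive_in S x" "orthogonal_family F" "\<Sum>F = g"
      using less.hyps[of f] less.hyps[of g] fg by blast
    have EF: "E \<subseteq> A" "F \<subseteq> A" using E(2) F(2) S by (auto simp: primitive_in_def)
    have id: "x \<star> x = x" "x \<noteq> 0" if "x \<in> E \<union> F" for x using that E F by (auto simp: primitive_in_def)
    have xE: "x \<star> f = x" "f \<star> x = x" if "x \<in> E" for x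
      using orthogonal_family_sum[OF E(1) EF(1) E(3) that] id that E(4) by auto
    have xF: "x \<star> g = x" "g \<star> x = x" if "x \<in> F" for x
      using orthogonal_family_sum[OF F(1) EF(2) F(3) that] id that F(4) by auto
    have orth: "x \<star> y = 0 \<and> y \<star> x = 0" if "x \<in> E" "y \<in> F" for x y
    proof
      have xy: "x \<in> A" "y \<in> A" using that EF by auto
      have "x \<star> y = x \<star> f \<star> (g \<star> y)" using xE xF that by simp
      also have "\<dots> = x \<star> (f \<star> g) \<star> y" using xy A by (simp only: mul_assoc mul_closed)
      finally show "x \<star> y = 0" using fg xy by (simp add: mul_zero_left mul_zero_right)
      have "y \<star> x = y \<star> g \<star> (f \<star> x)" using xE xF that by simp
      also have "\<dots> = y \<star> (g \<star> f) \<star> x" using xy A by (simp only: mul_assoc mul_closed)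
      finally show "y \<star> x = 0" using fg xy by (simp add: mul_zero_left mul_zero_right)
    qed
    have "E \<inter> F = {}" using orth id by (metis UnCI disjoint_iff)
    then have "\<Sum>(E \<union> F) = e" using E F fg by (simp add: sum.union_disjoint)
    moreover have "orthogonal_family (E \<union> F)"
      using E(3) F(3) orth unfolding orthogonal_family_def by blast
    moreover have "finite (E \<union> F)" "\<forall>x\<in>E \<union> F. primitive_in S x" using E F by blast+
    ultimately show ?thesis by blast
  qed
qed

end

section \<open>Weights of a divisible group of automorphisms\<close>

text \<open>A commuting family of automorphisms in which every member is an \<open>n\<close>-th power of some member, for every
  \<open>n > 0\<close>. The indices play the role of the elements of a divisible commutative group, and a weight is a
  function of the index. Taking a whole type of indices makes equality of weights equality of
  functions.\<close>

locale divisible_action = fin_dim_algebra scale A mul unit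
  for scale :: "'k::alg_closed_field \<Rightarrow> 'v::ab_group_add \<Rightarrow> 'v" (infixr \<open>*s\<close> 75)
    and A :: "'v set" and mul :: "'v \<Rightarrow> 'v \<Rightarrow> 'v" (infixl \<open>\<star>\<close> 70) and unit :: 'v +
  fixes act :: "'i \<Rightarrow> 'v \<Rightarrow> 'v"
  assumes char: "CHAR('k) > 0"
    and act_closed: "a \<in> A \<Longrightarrow> act t a \<in> A"
    and act_add: "a \<in> A \<Longrightarrow> b \<in> A \<Longrightarrow> act t (a + b) = act t a + act t b"
    and act_scale: "a \<in> A \<Longrightarrow> act t (c *s a) = c *s act t a"
    and act_mul: "a \<in> A \<Longrightarrow> b \<in> A \<Longrightarrow> act t (a \<star> b) = act t a \<star> act t b"
    and act_unit: "act t unit = unit"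
    and act_inj: "a \<in> A \<Longrightarrow> act t a = 0 \<Longrightarrow> a = 0"
    and act_commute: "a \<in> A \<Longrightarrow> act s (act t a) = act t (act s a)"
    and act_divisible: "n > 0 \<Longrightarrow> \<exists>s. \<forall>a\<in>A. act t a = (act s ^^ n) a"
begin

lemma act_zero: "act t 0 = 0"
  using act_scale[of 0 t 0] zero_closed by simp

definition weight_space :: "('i \<Rightarrow> 'k) \<Rightarrow> 'v set" where
  "weight_space \<chi> = {a \<in> A. \<forall>t. act t a = \<chi> t *s a}"

definition fixed :: "'v set" where "fixed = {a \<in> A. \<forall>t. act t a = a}"

definition homogeneous :: "'v set" where "homogeneous = (\<Union>\<chi>. weight_space \<chi>)"

lemma fixed_eq: "fixed = weight_space (\<lambda>t. 1)"
  by (simp add: fixed_def weight_space_def)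

lemma weight_space_subset: "weight_space \<chi> \<subseteq> A"
  by (auto simp: weight_space_def)

lemma fixed_subset: "fixed \<subseteq> A"
  by (auto simp: fixed_def)

lemma homogeneous_subset: "homogeneous \<subseteq> A"
  by (auto simp: homogeneous_def weight_space_def)

lemma subspace_weight_space: "subspace (weight_space \<chi>)"
  by (rule subspaceI)
    (auto simp: weight_space_def closed act_zero act_add act_scale scale_right_distrib mult.commute)

lemma subspace_fixed: "subspace fixed"
  unfolding fixed_eq by (rule subspace_weight_space)

lemma weight_space_mul:
  "a \<in> weight_space \<chi> \<Longrightarrow> b \<in> weight_space \<psi> \<Longrightarrow> a \<star> b \<in> weight_space (\<lambda>t. \<chi> t * \<psi> t)"
  by (auto simp: weight_space_def closed act_mul mul_scale_left mul_scale_right mult.commute)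

lemma unit_in_fixed: "unit \<in> fixed"
  by (simp add: fixed_def unit_closed act_unit)

lemma fixed_mul: "a \<in> fixed \<Longrightarrow> b \<in> fixed \<Longrightarrow> a \<star> b \<in> fixed"
  by (simp add: fixed_def closed act_mul)

lemma fixed_mul_weight_space: "a \<in> fixed \<Longrightarrow> b \<in> weight_space \<chi> \<Longrightarrow> a \<star> b \<in> weight_space \<chi>"
  using weight_space_mul[of a "\<lambda>t. 1" b \<chi>] by (simp add: fixed_eq)

lemma pow_weight_space: "x \<in> weight_space \<chi> \<Longrightarrow> pow x n \<in> weight_space (\<lambda>t. \<chi> t ^ n)"
proof (induction n)
  case 0
  then show ?case using unit_in_fixed by (simp add: fixed_eq)
next
  case (Suc n)
  then show ?case using weight_space_mul by (simp add: pow_Suc)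
qed

lemma weight_nonzero: "a \<in> weight_space \<chi> \<Longrightarrow> a \<noteq> 0 \<Longrightarrow> \<chi> t \<noteq> 0"
  using act_inj by (force simp: weight_space_def)

lemma weight_unique: "a \<in> weight_space \<chi> \<Longrightarrow> a \<in> weight_space \<psi> \<Longrightarrow> a \<noteq> 0 \<Longrightarrow> \<chi> = \<psi>"
  by (force simp: weight_space_def fun_eq_iff)

text \<open>Applying \<open>act t - \<psi>(t)\<close> to a relation removes the term of weight \<open>\<psi>\<close> and multiplies the term of weight \<open>\<chi>\<close>
  by \<open>\<chi>(t) - \<psi>(t)\<close>, which is non-zero for some \<open>t\<close>.\<close>

lemma weight_spaces_independent:
  assumes "finite F" "\<And>\<chi>. \<chi> \<in> F \<Longrightarrow> a \<chi> \<in> weight_space \<chi>" "(\<Sum>\<chi>\<in>F. a \<chi>) = 0" "\<chi> \<in> F"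
  shows "a \<chi> = 0"
  using assms
proof (induction F arbitrary: a \<chi> rule: finite_induct)
  case (insert \<psi> F)
  have A: "a \<chi> \<in> A" if "\<chi> \<in> insert \<psi> F" for \<chi>
    using insert.prems(1)[OF that] weight_space_subset by blast
  have sum: "act t (\<Sum>\<chi>\<in>F. a \<chi>) = (\<Sum>\<chi>\<in>F. \<chi> t *s a \<chi>)" for t
    using insert.hyps(1) insert.prems(1)
  proof (induction F rule: finite_induct)
    case (insert \<phi> F)
    have "\<phi> \<in> insert \<psi> (insert \<phi> F)" "F \<subseteq> insert \<psi> (insert \<phi> F)" by auto
    then have "a \<phi> \<in> weight_space \<phi>" "\<And>\<chi>. \<chi> \<in> F \<Longrightarrow> a \<chi> \<in> weight_space \<chi>"
      using insert.prems by blast+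
    moreover have "(\<Sum>\<chi>\<in>F. a \<chi>) \<in> A"
      using calculation weight_space_subset by (intro subspace_sum[OF subspace_A]) blast
    ultimately show ?case using insert by (auto simp: act_add weight_space_def)
  qed (simp add: act_zero)
  have key: "a \<chi> = 0" if \<chi>: "\<chi> \<in> F" for \<chi>
  proof -
    have "\<chi> \<noteq> \<psi>" using insert.hyps \<chi> by blast
    then obtain t where t: "\<chi> t \<noteq> \<psi> t" by blast
    have s: "(\<Sum>\<chi>\<in>F. a \<chi>) = - a \<psi>"
      using insert.prems(2) insert.hyps by (simp add: add_eq_0_iff)
    have "act t (- a \<psi>) = \<psi> t *s (- a \<psi>)"
      using insert.prems(1)[of \<psi>] subspace_neg[OF subspace_weight_space]
      unfolding weight_space_def by blast
    then have "(\<Sum>\<chi>\<in>F. \<chi> t *s a \<chi>) - \<psi> t *s (\<Sum>\<chi>\<in>F. a \<chi>) = 0"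
      using sum[of t] s by simp
    then have 0: "(\<Sum>\<chi>\<in>F. (\<chi> t - \<psi> t) *s a \<chi>) = 0"
      by (simp add: scale_sum_right scale_left_diff_distrib sum_subtractf)
    have "(\<chi> t - \<psi> t) *s a \<chi> = 0"
      by (rule insert.IH[OF _ 0 \<chi>]) (use insert.prems(1) subspace_weight_space subspace_scale in blast)
    then show ?thesis using t by simp
  qed
  then have "a \<psi> = 0" using insert.prems(2) insert.hyps by simp
  then show ?case using key insert.prems(3) by blast
qed simp

lemma weight_components_of_span:
  assumes Z: "Z \<subseteq> homogeneous" and v: "v \<in> span Z"
  shows "\<exists>F a. finite F \<and> (\<forall>\<chi>. a \<chi> \<in> span (Z \<inter> weight_space \<chi>)) \<and> (\<forall>\<chi>. \<chi> \<notin> F \<longrightarrow> a \<chi> = 0) \<and>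
    v = (\<Sum>\<chi>\<in>F. a \<chi>)"
  using v
proof (induction rule: span_induct_alt)
  case base
  show ?case by (intro exI[of _ "{}"] exI[of _ "\<lambda>_. 0"]) (simp add: span_zero)
next
  case (step c z v)
  then obtain F a where Fa: "finite F" "\<And>\<chi>. a \<chi> \<in> span (Z \<inter> weight_space \<chi>)"
    "\<And>\<chi>. \<chi> \<notin> F \<Longrightarrow> a \<chi> = 0" "v = (\<Sum>\<chi>\<in>F. a \<chi>)" by blast
  obtain \<psi> where \<psi>: "z \<in> weight_space \<psi>" using step.hyps Z by (auto simp: homogeneous_def)
  define b where "b \<chi> = (if \<chi> = \<psi> then c *s z else 0) + a \<chi>" for \<chi>
  have "(\<Sum>\<chi>\<in>insert \<psi> F. a \<chi>) = v"
    using Fa by (cases "\<psi> \<in> F") (auto simp: insert_absorb)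
  then have "(\<Sum>\<chi>\<in>insert \<psi> F. b \<chi>) = c *s z + v"
    using Fa(1) by (simp add: b_def sum.distrib del: sum.insert)
  moreover have "b \<chi> \<in> span (Z \<inter> weight_space \<chi>)" for \<chi>
  proof (cases "\<chi> = \<psi>")
    case True
    then have "c *s z \<in> span (Z \<inter> weight_space \<chi>)"
      using \<psi> step.hyps by (intro span_scale span_base) blast
    then show ?thesis using True Fa(2) span_add by (simp add: b_def)
  qed (simp add: b_def Fa(2))
  moreover have "b \<chi> = 0" if "\<chi> \<notin> insert \<psi> F" for \<chi>
    using that Fa(3) by (simp add: b_def)
  moreover have "finite (insert \<psi> F)" using Fa(1) by simp
  ultimately show ?case by metis
qed

text \<open>The form in which uniqueness of weight components is used: a weight vector that is a combination of
  weight vectors is a combination of those among them that have its own weight.\<close>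

lemma homogeneous_in_span:
  assumes Z: "Z \<subseteq> homogeneous" and y: "y \<in> weight_space \<eta>" "y \<in> span Z"
  shows "y \<in> span (Z \<inter> weight_space \<eta>)"
proof -
  obtain F a where Fa: "finite F" "\<And>\<chi>. a \<chi> \<in> span (Z \<inter> weight_space \<chi>)"
    "\<And>\<chi>. \<chi> \<notin> F \<Longrightarrow> a \<chi> = 0" "y = (\<Sum>\<chi>\<in>F. a \<chi>)"
    using weight_components_of_span[OF Z y(2)] by blast
  have "span (Z \<inter> weight_space \<chi>) \<subseteq> weight_space \<chi>" for \<chi>
    using span_minimal subspace_weight_space by blast
  then have aw: "a \<chi> \<in> weight_space \<chi>" for \<chi> using Fa(2) by blast
  define b where "b \<chi> = (if \<chi> = \<eta> then - y else 0) + a \<chi>" for \<chi>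
  have "(\<Sum>\<chi>\<in>insert \<eta> F. a \<chi>) = y"
    using Fa by (cases "\<eta> \<in> F") (auto simp: insert_absorb)
  then have "(\<Sum>\<chi>\<in>insert \<eta> F. b \<chi>) = 0"
    using Fa(1) by (simp add: b_def sum.distrib del: sum.insert)
  moreover have "b \<chi> \<in> weight_space \<chi>" for \<chi>
    using aw y(1) subspace_diff[OF subspace_weight_space] by (auto simp: b_def)
  ultimately have "b \<eta> = 0"
    using weight_spaces_independent[of "insert \<eta> F" b \<eta>] Fa(1) by blast
  then have "y = a \<eta>" by (simp add: b_def)
  then show ?thesis using Fa(2) by simp
qed

text \<open>\<open>act t\<close> is the \<open>q\<close>-th power of some \<open>act s\<close> for a power \<open>q\<close> of the characteristic that is at least
  \<open>dim V\<close>, and such powers are diagonalisable.\<close>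

lemma eigenvectors_span:
  assumes V: "subspace V" "V \<subseteq> A" "\<And>s v. v \<in> V \<Longrightarrow> act s v \<in> V"
  shows "V \<subseteq> span {w \<in> V. \<exists>c. act t w = c *s w}"
proof -
  have "prime CHAR('k)" using char by (rule prime_CHAR_semidom)
  then have "2 \<le> CHAR('k)" by (rule prime_ge_2_nat)
  define q where "q = CHAR('k) ^ dim V"
  have "dim V < 2 ^ dim V" by (rule less_exp)
  also have "\<dots> \<le> q" unfolding q_def using \<open>2 \<le> CHAR('k)\<close> by (rule power_mono) simp
  finally have dimV: "dim V \<le> q" by simp
  have "q > 0" using char by (simp add: q_def)
  then obtain s where s: "\<forall>a\<in>A. act t a = (act s ^^ q) a" using act_divisible by blast
  interpret V: linear_endo_on "(*s)" V "act s"
    using V by unfold_locales (auto simp: act_add act_scale subset_iff)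
  obtain B where B: "finite B" "V \<subseteq> span B" using finite_dim V(2) by blast
  have split: "\<exists>M. m = Polynomial.smult (lead_coeff m) (\<Prod>x\<in>#M. [:- x, 1:])" if "m \<noteq> 0"
    for m :: "'k poly"
    using alg_closed_imp_factorization[OF that] by blast
  have "V \<subseteq> span {w \<in> V. \<exists>c. (act s ^^ q) w = c *s w}"
    by (rule V.eigenvectors_span_char_power[OF char split B(2,1) q_def dimV])
  also have "{w \<in> V. \<exists>c. (act s ^^ q) w = c *s w} = {w \<in> V. \<exists>c. act t w = c *s w}"
    using s V(2) by auto
  finally show ?thesis .
qed

text \<open>Either every operator is a scalar on \<open>V\<close>, and \<open>V\<close> consists of weight vectors, or some \<open>act t\<close> is not. In the
  latter case the eigenspaces of \<open>act t\<close> span \<open>V\<close>, are proper, and are stable under the commuting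
  operators \<open>act s\<close>.\<close>

lemma stable_subspace_homogeneous_span:
  assumes "subspace V" "V \<subseteq> A" "\<And>t v. v \<in> V \<Longrightarrow> act t v \<in> V"
  shows "V \<subseteq> span homogeneous"
  using assms
proof (induction "dim V" arbitrary: V rule: less_induct)
  case less
  show ?case
  proof (cases "\<forall>t. \<exists>c. \<forall>v\<in>V. act t v = c *s v")
    case True
    then obtain \<chi> where "\<And>t v. v \<in> V \<Longrightarrow> act t v = \<chi> t *s v" by metis
    then have "V \<subseteq> homogeneous" using less.prems(2) by (auto simp: homogeneous_def weight_space_def)
    then show ?thesis using span_superset by blast
  next
    case False
    then obtain t where t: "\<And>c. \<exists>v\<in>V. act t v \<noteq> c *s v" by blast
    have "w \<in> span homogeneous" if w: "w \<in> V" "act t w = c *s w" for w c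
    proof -
      define W where "W = {v \<in> V. act t v = c *s v}"
      have sub: "subspace W"
        using less.prems unfolding W_def
        by (intro subspaceI)
          (auto simp: subspace_0 subspace_add subspace_scale act_zero act_add act_scale
            scale_right_distrib mult.commute subset_iff)
      have "W \<noteq> V" using t[of c] unfolding W_def by blast
      then have "W \<subset> V" unfolding W_def by blast
      then have "dim W < dim V" using sub less.prems(2) dim_less_in_A by blast
      moreover have "act s v \<in> W" if "v \<in> W" for s v
      proof -
        have "v \<in> A" using that less.prems(2) by (auto simp: W_def)
        then show ?thesis using that less.prems(3) act_commute[of v t s] by (simp add: W_def act_scale)
      qed
      moreover have "W \<subseteq> A" using less.prems(2) by (auto simp: W_def)
      ultimately have "W \<subseteq> span homogeneous" using less.hyps sub by blast
      then show ?thesis using w unfolding W_def by blast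
    qed
    then have "{w \<in> V. \<exists>c. act t w = c *s w} \<subseteq> span homogeneous" by blast
    then have "span {w \<in> V. \<exists>c. act t w = c *s w} \<subseteq> span homogeneous"
      using span_minimal subspace_span by blast
    then show ?thesis using eigenvectors_span[OF less.prems(1,2)] less.prems(3) by blast
  qed
qed

lemma homogeneous_spans: "A \<subseteq> span homogeneous"
  using stable_subspace_homogeneous_span[OF subspace_A order_refl act_closed] .

lemma act_funpow_weight:
  "x \<in> weight_space \<chi> \<Longrightarrow> (act s ^^ n) x = \<chi> s ^ n *s x"
  by (induction n) (auto simp: weight_space_def act_scale)

text \<open>The weights \<open>\<chi>\<^sup>n\<close> are pairwise distinct: \<open>\<chi>\<^sup>i = \<chi>\<^sup>j\<close> for \<open>i < j\<close> gives \<open>\<chi>\<^sup>j\<^sup>-\<^sup>i = 1\<close>, and as every \<open>t\<close> acts as the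
  \<open>(j-i)\<close>-th power of some \<open>s\<close>, \<open>\<chi>(t) = \<chi>(s)\<^sup>j\<^sup>-\<^sup>i = 1\<close>. So if no power of \<open>x\<close> vanished, the powers would be
  linearly independent; in a finite-dimensional space some \<open>x\<^sup>n\<close> is a combination of higher powers.\<close>

lemma nontrivial_weight_nilpotent:
  assumes x: "x \<in> weight_space \<chi>" and \<chi>: "\<chi> \<noteq> (\<lambda>t. 1)"
  shows "\<exists>n. pow x n = 0"
proof (rule ccontr)
  assume "\<nexists>n. pow x n = 0"
  then have nz: "pow x n \<noteq> 0" for n by blast
  have xA: "x \<in> A" using x weight_space_subset by blast
  have "x \<noteq> 0" using nz[of 1] xA by (auto simp: pow_Suc unit_right)
  have distinct: "(\<lambda>t. \<chi> t ^ i) \<noteq> (\<lambda>t. \<chi> t ^ j)" if "i < j" for i j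
  proof
    assume eq: "(\<lambda>t. \<chi> t ^ i) = (\<lambda>t. \<chi> t ^ j)"
    have one: "\<chi> t ^ (j - i) = 1" for t
    proof -
      have "\<chi> t ^ i * \<chi> t ^ (j - i) = \<chi> t ^ i * 1"
        using fun_cong[OF eq, of t] power_add[of "\<chi> t" i "j - i"] that by simp
      then show ?thesis using weight_nonzero[OF x \<open>x \<noteq> 0\<close>] by simp
    qed
    have "\<chi> t = 1" for t
    proof -
      obtain s where "\<forall>a\<in>A. act t a = (act s ^^ (j - i)) a"
        using act_divisible[of "j - i" t] \<open>i < j\<close> by auto
      then have "act t x = (act s ^^ (j - i)) x" using xA by blast
      moreover have "act t x = \<chi> t *s x" using x by (simp add: weight_space_def)
      ultimately have "\<chi> t *s x = \<chi> s ^ (j - i) *s x"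
        by (simp only: act_funpow_weight[OF x])
      then show ?thesis using one[of s] \<open>x \<noteq> 0\<close> by (metis scale_cancel_right)
    qed
    then show False using \<chi> by auto
  qed
  define U where "U n = span {pow x i | i. i \<ge> n}" for n
  have "U 0 \<subseteq> A" unfolding U_def
    by (intro span_minimal[OF _ subspace_A]) (auto simp: pow_closed xA)
  moreover obtain B where "finite B" "A \<subseteq> span B" using finite_dim by blast
  moreover have "U (Suc n) \<subseteq> U n" for n unfolding U_def by (rule span_mono) auto
  moreover have "subspace (U n)" for n by (simp add: U_def)
  ultimately obtain n where n: "U (Suc n) = U n"
    using descending_chain_stabilises[of U B] by (metis order_trans)
  let ?Z = "{pow x i | i. i \<ge> Suc n}"
  have "pow x n \<in> U n" unfolding U_def by (rule span_base) blast
  then have "pow x n \<in> span ?Z" using n U_def by blast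
  moreover have "?Z \<subseteq> homogeneous"
    using pow_weight_space[OF x] by (auto simp: homogeneous_def)
  ultimately have "pow x n \<in> span (?Z \<inter> weight_space (\<lambda>t. \<chi> t ^ n))"
    using homogeneous_in_span pow_weight_space[OF x] by blast
  moreover have "?Z \<inter> weight_space (\<lambda>t. \<chi> t ^ n) = {}"
  proof (rule ccontr)
    assume "?Z \<inter> weight_space (\<lambda>t. \<chi> t ^ n) \<noteq> {}"
    then obtain i where "n < i" "pow x i \<in> weight_space (\<lambda>t. \<chi> t ^ n)"
      by (auto simp: Suc_le_eq)
    then show False
      using weight_unique[OF _ pow_weight_space[OF x] nz] distinct by blast
  qed
  ultimately show False using nz by simp
qed

section \<open>Idempotents of the algebra and of the fixed subalgebra\<close>

text \<open>Fitting's lemma inside the commutant \<open>C\<close> of \<open>a\<close> in the fixed algebra: when the chain \<open>C a\<^sup>n\<close> stops,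
  \<open>a\<^sup>n = c a a\<^sup>n\<close> with \<open>c \<in> C\<close>, and \<open>e = (c a)\<^sup>n\<close> is an idempotent with \<open>e a\<^sup>n = a\<^sup>n\<close>. If \<open>e = 0\<close>, then \<open>a\<close> is nilpotent,
  and if \<open>e = 1\<close>, then \<open>a\<close> is a unit. The commutant is used in place of the fixed algebra so that \<open>c\<close>
  commutes with \<open>a\<close>.\<close>

lemma fixed_nilpotent_or_unit:
  assumes triv: "\<And>e. e \<in> fixed \<Longrightarrow> e \<star> e = e \<Longrightarrow> e = 0 \<or> e = unit" and a: "a \<in> fixed"
  shows "(\<exists>n. pow a n = 0) \<or> (\<exists>g\<in>fixed. g \<star> a = unit)"
proof -
  define C where "C = {c \<in> fixed. c \<star> a = a \<star> c}"
  have aA: "a \<in> A" using a fixed_subset by blast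
  have CA: "C \<subseteq> A" using fixed_subset by (auto simp: C_def)
  have C: "subspace C"
    using aA fixed_subset subspace_fixed unfolding C_def
    by (intro subspaceI)
      (auto simp: subspace_0 subspace_add subspace_scale mul_zero_left mul_zero_right
        mul_add_left mul_add_right mul_scale_left mul_scale_right subset_iff)
  have Ca: "c \<star> a \<in> C" if "c \<in> C" for c
    using that a aA CA by (auto simp: C_def fixed_mul mul_assoc subset_iff)
  define U where "U n = {c \<star> pow a n | c. c \<in> C}" for n
  have "U (Suc n) \<subseteq> U n" for n
  proof
    fix z assume "z \<in> U (Suc n)"
    then obtain c where c: "c \<in> C" "z = c \<star> (a \<star> pow a n)" by (auto simp: U_def pow_Suc)
    then have "z = (c \<star> a) \<star> pow a n" using CA aA pow_closed by (auto simp: mul_assoc)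
    then show "z \<in> U n" using Ca[OF c(1)] unfolding U_def by blast
  qed
  moreover have "subspace (U n)" for n
    unfolding U_def by (rule subspace_mul_image[OF C CA pow_closed[OF aA]])
  moreover have "U 0 \<subseteq> A" using CA by (auto simp: U_def closed)
  moreover obtain B where "finite B" "A \<subseteq> span B" using finite_dim by blast
  ultimately obtain n where n: "U (Suc n) = U n"
    using descending_chain_stabilises[of U B] by (metis order_trans)
  define P where "P = pow a n"
  have PA: "P \<in> A" using pow_closed[OF aA] by (simp add: P_def)
  have "unit \<in> C" using unit_in_fixed aA by (simp add: C_def unit_left unit_right)
  then have "P \<in> U n" unfolding U_def P_def using unit_left[OF pow_closed[OF aA], of n, symmetric] by blast
  then obtain c where c: "c \<in> C" "P = c \<star> (a \<star> P)"
    unfolding n[symmetric] by (auto simp: U_def P_def pow_Suc)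
  have cA: "c \<in> A" and ca: "c \<star> a = a \<star> c" and cf: "c \<in> fixed" using c CA by (auto simp: C_def)
  define e where "e = pow (c \<star> a) n"
  have eP: "e \<star> P = P"
    unfolding e_def using c cA aA PA by (intro pow_mul_fixpoint) (simp_all add: closed mul_assoc)
  have e: "e = pow c n \<star> P" unfolding e_def P_def by (rule pow_mul[OF cA aA ca])
  have ef: "e \<in> fixed"
    unfolding e_def using fixed_mul[OF cf a]
    by (induction n) (auto simp: unit_in_fixed pow_Suc fixed_mul)
  then have eA: "e \<in> A" using fixed_subset by blast
  have "(c \<star> a) \<star> c = c \<star> (c \<star> a)" using cA aA by (metis ca mul_assoc)
  then have "e \<star> c = c \<star> e" unfolding e_def by (intro pow_commute closed cA aA)
  then have ce: "pow c n \<star> e = e \<star> pow c n" by (intro pow_commute cA eA) simp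
  have "e \<star> e = e \<star> (pow c n \<star> P)" using arg_cong[OF e, of "(\<star>) e"] .
  also have "\<dots> = e \<star> pow c n \<star> P" using eA pow_closed[OF cA] PA by (simp add: mul_assoc)
  also have "\<dots> = pow c n \<star> (e \<star> P)" using ce eA pow_closed[OF cA] PA by (simp flip: mul_assoc)
  also have "\<dots> = e" using eP e by simp
  finally have "e \<star> e = e" .
  with triv ef consider "e = 0" | "e = unit" by blast
  then show ?thesis
  proof cases
    case 1
    then have "P = 0" using eP mul_zero_left[OF PA] by simp
    then show ?thesis unfolding P_def by blast
  next
    case 2
    show ?thesis
    proof (cases n)
      case 0
      then have "P = unit" by (simp add: P_def)
      then have "c \<star> a = unit" using c aA by (simp add: unit_right)
      then show ?thesis using cf by blast
    next
      case (Suc m)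
      have "e = pow (c \<star> a) m \<star> (c \<star> a)"
        unfolding e_def Suc using cA aA by (intro pow_Suc_right closed)
      then have "(pow (c \<star> a) m \<star> c) \<star> a = unit"
        using 2 cA aA by (simp add: mul_assoc pow_closed closed)
      moreover have "pow (c \<star> a) m \<in> fixed"
        using fixed_mul[OF cf a] by (induction m) (auto simp: unit_in_fixed pow_Suc fixed_mul)
      ultimately show ?thesis using fixed_mul cf by blast
    qed
  qed
qed

definition homogeneous_nilpotents :: "'v set" where
  "homogeneous_nilpotents = {x \<in> homogeneous. \<exists>n. pow x n = 0}"

lemma homogeneous_nilpotents_subset: "homogeneous_nilpotents \<subseteq> A"
  using homogeneous_subset by (auto simp: homogeneous_nilpotents_def)

text \<open>The product \<open>b x\<close> is fixed, so it is nilpotent or a unit. If \<open>g b x = 1\<close>, then \<open>(g b)\<^sup>n x\<^sup>n = 1\<close>, which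
  contradicts \<open>x\<^sup>n = 0\<close> unless the algebra is zero.\<close>

lemma inverse_weight_mul_nilpotent:
  assumes triv: "\<And>e. e \<in> fixed \<Longrightarrow> e \<star> e = e \<Longrightarrow> e = 0 \<or> e = unit"
    and x: "x \<in> weight_space \<chi>" "pow x n = 0" and b: "b \<in> weight_space \<psi>"
    and inv: "\<And>t. \<psi> t * \<chi> t = 1"
  shows "\<exists>m. pow (b \<star> x) m = 0"
proof -
  have A: "x \<in> A" "b \<in> A" using x b weight_space_subset by blast+
  have bx: "b \<star> x \<in> fixed" using weight_space_mul[OF b x(1)] inv by (simp add: fixed_eq)
  show ?thesis
  proof (rule ccontr)
    assume nn: "\<nexists>m. pow (b \<star> x) m = 0"
    then obtain g where g: "g \<in> fixed" "g \<star> (b \<star> x) = unit"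
      using fixed_nilpotent_or_unit[OF triv bx] by blast
    have gA: "g \<in> A" using g fixed_subset by blast
    then have "(g \<star> b) \<star> x = unit" using g A by (simp add: mul_assoc)
    then have "pow (g \<star> b) n \<star> pow x n = unit" using gA A by (intro pow_left_inverse closed)
    then have "unit = 0" using x(2) gA A by (simp add: mul_zero_right pow_closed closed)
    moreover have "pow (b \<star> x) 0 = unit" by simp
    ultimately have "pow (b \<star> x) 0 = 0" by argo
    then show False using nn by blast
  qed
qed

lemma fixed_mul_homogeneous_nilpotent:
  assumes triv: "\<And>e. e \<in> fixed \<Longrightarrow> e \<star> e = e \<Longrightarrow> e = 0 \<or> e = unit"
    and c: "c \<in> fixed" and x: "x \<in> homogeneous_nilpotents"
  shows "c \<star> x \<in> homogeneous_nilpotents"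
proof -
  obtain \<chi> n where \<chi>: "x \<in> weight_space \<chi>" "pow x n = 0"
    using x by (auto simp: homogeneous_nilpotents_def homogeneous_def)
  have cx: "c \<star> x \<in> weight_space \<chi>" using fixed_mul_weight_space[OF c \<chi>(1)] .
  have "\<exists>m. pow (c \<star> x) m = 0"
  proof (cases "\<chi> = (\<lambda>t. 1)")
    case True
    then show ?thesis
      using inverse_weight_mul_nilpotent[OF triv \<chi>, of c "\<lambda>t. 1"] c by (simp add: fixed_eq)
  next
    case False
    then show ?thesis using nontrivial_weight_nilpotent[OF cx] by blast
  qed
  then show ?thesis using cx by (auto simp: homogeneous_nilpotents_def homogeneous_def)
qed

primrec nilpotent_products :: "nat \<Rightarrow> 'v set" where
  "nilpotent_products 0 = {unit}"
| "nilpotent_products (Suc n) = {x \<star> y | x y. x \<in> homogeneous_nilpotents \<and> y \<in> nilpotent_products n}"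

lemma nilpotent_products_homogeneous: "nilpotent_products n \<subseteq> homogeneous"
proof (induction n)
  case 0
  show ?case using unit_in_fixed by (auto simp: fixed_eq homogeneous_def)
next
  case (Suc n)
  have "x \<star> y \<in> homogeneous" if "x \<in> homogeneous" "y \<in> homogeneous" for x y
    using that weight_space_mul unfolding homogeneous_def by blast
  then show ?case using Suc by (auto simp: homogeneous_nilpotents_def)
qed

text \<open>Suppose \<open>y = b x y\<close>. Comparing weights, \<open>b\<close> may be replaced by its component \<open>c\<close> of weight inverse to that
  of \<open>x\<close>. Then \<open>c x\<close> is nilpotent but fixes \<open>y\<close>, so \<open>y = 0\<close>.\<close>

lemma nilpotent_mul_shrinks_left_ideal:
  assumes triv: "\<And>e. e \<in> fixed \<Longrightarrow> e \<star> e = e \<Longrightarrow> e = 0 \<or> e = unit"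
    and x: "x \<in> homogeneous_nilpotents" and y: "y \<in> homogeneous" and xy: "x \<star> y \<noteq> 0"
  shows "y \<notin> left_ideal (x \<star> y)"
proof
  assume "y \<in> left_ideal (x \<star> y)"
  then obtain b where b: "b \<in> A" "y = b \<star> (x \<star> y)" by (auto simp: left_ideal_def)
  obtain \<chi> n where \<chi>: "x \<in> weight_space \<chi>" "pow x n = 0"
    using x by (auto simp: homogeneous_nilpotents_def homogeneous_def)
  obtain \<eta> where \<eta>: "y \<in> weight_space \<eta>" using y by (auto simp: homogeneous_def)
  have A: "x \<in> A" "y \<in> A" using \<chi> \<eta> weight_space_subset by blast+
  have nz: "x \<noteq> 0" "y \<noteq> 0" using xy A by (auto simp: mul_zero_left mul_zero_right)
  \<comment> \<open>The set \<open>W\<close> below consists of the products \<open>c x y\<close> in which \<open>c\<close> has the weight inverse to that of \<open>x\<close>;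
    it contains every element of \<open>Z\<close> that has the same weight as \<open>y\<close>.\<close>
  define Z where "Z = {c \<star> (x \<star> y) | c. c \<in> homogeneous}"
  have Zw: "c \<star> (x \<star> y) \<in> weight_space (\<lambda>t. \<psi> t * (\<chi> t * \<eta> t))" if "c \<in> weight_space \<psi>" for c \<psi>
    using weight_space_mul[OF that weight_space_mul[OF \<chi>(1) \<eta>]] .
  have Z: "Z \<subseteq> homogeneous" unfolding Z_def using Zw by (force simp: homogeneous_def)
  have "c \<star> (x \<star> y) \<in> span Z" if "c \<in> span homogeneous" for c
  proof -
    have "c \<in> A \<and> c \<star> (x \<star> y) \<in> span Z" using that
    proof (induction rule: span_induct_alt)
      case base
      then show ?case using A by (simp add: closed mul_zero_left span_zero)
    next
      case (step k z v)
      then have "z \<in> A" using homogeneous_subset by blast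
      moreover have "z \<star> (x \<star> y) \<in> span Z" using step.hyps by (intro span_base) (auto simp: Z_def)
      ultimately show ?case using step.IH A
        by (auto simp: closed mul_add_left mul_scale_left intro!: span_add span_scale)
    qed
    then show ?thesis by blast
  qed
  then have "b \<star> (x \<star> y) \<in> span Z" using b(1) homogeneous_spans by blast
  then have "y \<in> span Z" by (subst b(2))
  then have "y \<in> span (Z \<inter> weight_space \<eta>)" using homogeneous_in_span[OF Z \<eta>] by blast
  moreover define W where "W = {c \<star> (x \<star> y) | c. c \<in> weight_space (\<lambda>t. inverse (\<chi> t))}"
  have W: "subspace W" unfolding W_def
    by (rule subspace_mul_image[OF subspace_weight_space weight_space_subset]) (simp add: closed A)
  moreover have "Z \<inter> weight_space \<eta> \<subseteq> W"
  proof
    fix z assume z: "z \<in> Z \<inter> weight_space \<eta>"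
    show "z \<in> W"
    proof (cases "z = 0")
      case True
      then show ?thesis using subspace_0[OF W] by simp
    next
      case False
      obtain c \<psi> where c: "z = c \<star> (x \<star> y)" "c \<in> weight_space \<psi>"
        using z by (auto simp: Z_def homogeneous_def)
      then have eq: "(\<lambda>t. \<psi> t * (\<chi> t * \<eta> t)) = \<eta>"
        using Zw[OF c(2)] z False weight_unique[of z] by auto
      have "\<psi> t = inverse (\<chi> t)" for t
        using fun_cong[OF eq, of t] weight_nonzero[OF \<chi>(1) nz(1), of t] weight_nonzero[OF \<eta> nz(2), of t]
        by (simp add: field_simps)
      then have "\<psi> = (\<lambda>t. inverse (\<chi> t))" by blast
      then show ?thesis using c unfolding W_def by blast
    qed
  qed
  ultimately have "y \<in> W" using span_minimal by blast
  then obtain c where c: "c \<in> weight_space (\<lambda>t. inverse (\<chi> t))" "y = c \<star> (x \<star> y)"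
    by (auto simp: W_def)
  have cA: "c \<in> A" using c weight_space_subset by blast
  obtain m where m: "pow (c \<star> x) m = 0"
    using inverse_weight_mul_nilpotent[OF triv \<chi> c(1)] weight_nonzero[OF \<chi>(1) nz(1)] by auto
  have "pow (c \<star> x) m \<star> y = y"
    using c(2) cA A by (intro pow_mul_fixpoint) (simp_all add: closed mul_assoc)
  then show False using m nz A by (simp add: mul_zero_left)
qed

text \<open>Each factor makes the left ideal generated by the product strictly smaller, unless the product is
  zero.\<close>

lemma nilpotent_products_bounded:
  assumes triv: "\<And>e. e \<in> fixed \<Longrightarrow> e \<star> e = e \<Longrightarrow> e = 0 \<or> e = unit"
  shows "y \<in> nilpotent_products n \<Longrightarrow> y \<noteq> 0 \<Longrightarrow> dim (left_ideal y) + n \<le> dim A"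
proof (induction n arbitrary: y)
  case 0
  have "left_ideal unit = A" by (force simp: left_ideal_def unit_right)
  then show ?case using 0 by simp
next
  case (Suc n)
  then obtain x z where xz: "y = x \<star> z" "x \<in> homogeneous_nilpotents" "z \<in> nilpotent_products n" by auto
  have z: "z \<in> homogeneous" using nilpotent_products_homogeneous xz by blast
  have A: "x \<in> A" "z \<in> A" using xz z homogeneous_nilpotents_subset homogeneous_subset by blast+
  have "z \<notin> left_ideal y"
    using nilpotent_mul_shrinks_left_ideal[OF triv xz(2) z] xz(1) Suc.prems by blast
  moreover have "left_ideal y \<subseteq> left_ideal z" using left_ideal_mono A xz by blast
  ultimately have "left_ideal y \<subset> left_ideal z" using left_ideal_self A by blast
  then have "dim (left_ideal y) < dim (left_ideal z)"
    using subspace_left_ideal left_ideal_subset A xz mul_closed by (intro dim_less_in_A) auto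
  moreover have "z \<noteq> 0" using Suc.prems xz A by (auto simp: mul_zero_right)
  ultimately show ?case using Suc.IH[OF xz(3)] by simp
qed

text \<open>Multiplying out, \<open>z\<^sup>n\<close> is a combination of products of \<open>n\<close> homogeneous nilpotents, and these vanish as soon
  as \<open>n > dim A\<close>.\<close>

lemma span_nilpotents_nilpotent:
  assumes triv: "\<And>e. e \<in> fixed \<Longrightarrow> e \<star> e = e \<Longrightarrow> e = 0 \<or> e = unit"
    and z: "z \<in> span homogeneous_nilpotents"
  shows "pow z (Suc (dim A)) = 0"
proof -
  have zA: "z \<in> A" using z span_minimal[OF homogeneous_nilpotents_subset subspace_A] by blast
  have PA: "nilpotent_products n \<subseteq> A" for n
    using nilpotent_products_homogeneous homogeneous_subset by blast
  have 1: "x \<star> y \<in> span (nilpotent_products (Suc n))"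
    if "x \<in> homogeneous_nilpotents" "y \<in> span (nilpotent_products n)" for x y n
  proof -
    have xA: "x \<in> A" using that homogeneous_nilpotents_subset by blast
    have "y \<in> A \<and> x \<star> y \<in> span (nilpotent_products (Suc n))" using that(2)
    proof (induction rule: span_induct_alt)
      case base
      then show ?case using xA by (simp add: closed mul_zero_right span_zero)
    next
      case (step k u v)
      have "x \<star> u \<in> span (nilpotent_products (Suc n))"
        using step.hyps that(1) by (intro span_base) auto
      moreover have "u \<in> A" using step.hyps PA by blast
      ultimately show ?case using step.IH xA
        by (auto simp: closed mul_add_right mul_scale_right simp del: nilpotent_products.simps
            intro!: span_add span_scale)
    qed
    then show ?thesis by blast
  qed
  have 2: "x \<star> y \<in> span (nilpotent_products (Suc n))"
    if "x \<in> span homogeneous_nilpotents" "y \<in> span (nilpotent_products n)" for x y n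
  proof -
    have yA: "y \<in> A" using that span_minimal[OF PA subspace_A] by blast
    have "x \<in> A \<and> x \<star> y \<in> span (nilpotent_products (Suc n))" using that(1)
    proof (induction rule: span_induct_alt)
      case base
      then show ?case using yA by (simp add: closed mul_zero_left span_zero)
    next
      case (step k u v)
      have "u \<star> y \<in> span (nilpotent_products (Suc n))" using 1 step.hyps that(2) by blast
      moreover have "u \<in> A" using step.hyps homogeneous_nilpotents_subset by blast
      ultimately show ?case using step.IH yA
        by (auto simp: closed mul_add_left mul_scale_left simp del: nilpotent_products.simps
            intro!: span_add span_scale)
    qed
    then show ?thesis by blast
  qed
  have "pow z n \<in> span (nilpotent_products n)" for n
  proof (induction n)
    case (Suc n)
    then show ?case using 2[OF z] by (simp only: pow_Suc)
  qed (simp add: span_base)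
  then have "pow z (Suc (dim A)) \<in> span (nilpotent_products (Suc (dim A)))" .
  moreover have "nilpotent_products (Suc (dim A)) \<subseteq> {0}"
    using nilpotent_products_bounded[OF triv, of _ "Suc (dim A)"] by fastforce
  then have "span (nilpotent_products (Suc (dim A))) \<subseteq> {0}"
    by (intro span_minimal) auto
  ultimately show ?thesis by blast
qed

text \<open>Homogeneous vectors are fixed if their weight is trivial and nilpotent otherwise, so \<open>f = d + i\<close> with \<open>d\<close>
  fixed and \<open>i\<close> in the span \<open>I\<close> of the homogeneous nilpotents. If \<open>d\<close> is nilpotent, then \<open>f \<in> I\<close> is nilpotent
  and idempotent, hence \<open>0\<close>. If \<open>g d = 1\<close>, then \<open>w = 1 - g f = - g i\<close> is in \<open>I\<close>, hence nilpotent, and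
  \<open>w (1 - f) = 1 - f\<close>.\<close>

theorem trivial_idempotents:
  assumes triv: "\<And>e. e \<in> fixed \<Longrightarrow> e \<star> e = e \<Longrightarrow> e = 0 \<or> e = unit"
    and f: "f \<in> A" "f \<star> f = f"
  shows "f = 0 \<or> f = unit"
proof -
  let ?I = "span homogeneous_nilpotents"
  have IA: "?I \<subseteq> A" using span_minimal[OF homogeneous_nilpotents_subset subspace_A] .
  have "subspace {x + y |x y. x \<in> fixed \<and> y \<in> ?I}"
    by (rule subspace_sums[OF subspace_fixed subspace_span])
  moreover have "homogeneous \<subseteq> {x + y |x y. x \<in> fixed \<and> y \<in> ?I}"
  proof
    fix z assume "z \<in> homogeneous"
    then obtain \<chi> where \<chi>: "z \<in> weight_space \<chi>" by (auto simp: homogeneous_def)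
    show "z \<in> {x + y |x y. x \<in> fixed \<and> y \<in> ?I}"
    proof (cases "\<chi> = (\<lambda>t. 1)")
      case True
      then have "z \<in> fixed" using \<chi> by (simp add: fixed_eq)
      moreover have "z = z + 0" by simp
      ultimately show ?thesis using span_zero by blast
    next
      case False
      then have "z \<in> homogeneous_nilpotents"
        using nontrivial_weight_nilpotent \<chi> by (auto simp: homogeneous_nilpotents_def homogeneous_def)
      then have "z \<in> ?I" by (rule span_base)
      moreover have "z = 0 + z" by simp
      ultimately show ?thesis using subspace_0[OF subspace_fixed] by blast
    qed
  qed
  ultimately have "A \<subseteq> {x + y |x y. x \<in> fixed \<and> y \<in> ?I}"
    using homogeneous_spans span_minimal by blast
  then obtain d i where di: "f = d + i" "d \<in> fixed" "i \<in> ?I" using f by blast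
  have A: "d \<in> A" "i \<in> A" using di IA fixed_subset by auto
  show ?thesis
    using fixed_nilpotent_or_unit[OF triv di(2)]
  proof
    assume "\<exists>n. pow d n = 0"
    then have "d \<in> homogeneous_nilpotents"
      using di by (auto simp: homogeneous_nilpotents_def homogeneous_def fixed_eq)
    then have "f \<in> ?I" using di span_add span_base by blast
    then have "pow f (Suc (dim A)) = 0" using span_nilpotents_nilpotent[OF triv, of f] by blast
    then show ?thesis using pow_idempotent[OF f] by simp
  next
    assume "\<exists>g\<in>fixed. g \<star> d = unit"
    then obtain g where g: "g \<in> fixed" "g \<star> d = unit" by blast
    have gA: "g \<in> A" using g fixed_subset by blast
    define w where "w = - (g \<star> i)"
    have "i \<in> A \<and> g \<star> i \<in> ?I" using di(3)
    proof (induction rule: span_induct_alt)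
      case base
      then show ?case using gA by (simp add: closed mul_zero_right span_zero)
    next
      case (step k u v)
      have "g \<star> u \<in> ?I"
        using fixed_mul_homogeneous_nilpotent[OF triv g(1) step.hyps] by (rule span_base)
      moreover have "u \<in> A" using step.hyps homogeneous_nilpotents_subset by blast
      ultimately show ?case using step.IH gA
        by (auto simp: closed mul_add_right mul_scale_right intro!: span_add span_scale)
    qed
    then have wI: "w \<in> ?I" unfolding w_def by (intro span_neg) blast
    have wA: "w \<in> A" using wI IA by blast
    have "w = unit - g \<star> f" using g gA A by (simp add: w_def di mul_add_right)
    then have "w \<star> (unit - f) = unit - f"
      using gA f by (simp add: closed mul_diff_left mul_diff_right unit_left unit_right mul_assoc)
    then have "pow w (Suc (dim A)) \<star> (unit - f) = unit - f"
      using wA f by (intro pow_mul_fixpoint) (simp_all add: closed)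
    then have "unit - f = 0"
      using span_nilpotents_nilpotent[OF triv wI] f by (simp add: mul_zero_left closed)
    then show ?thesis by simp
  qed
qed

lemma corner_action:
  assumes e: "e \<in> fixed" "e \<star> e = e"
  shows "divisible_action (*s) {a \<in> A. e \<star> a = a \<and> a \<star> e = a} (\<star>) e act"
proof -
  have eA: "e \<in> A" and act_e: "act t e = e" for t using e by (auto simp: fixed_def)
  let ?B = "{a \<in> A. e \<star> a = a \<and> a \<star> e = a}"
  show ?thesis
  proof unfold_locales
    show "subspace ?B"
      using eA by (intro subspaceI) (auto simp: closed mul_zero_left mul_zero_right
        mul_add_left mul_add_right mul_scale_left mul_scale_right)
    show "\<exists>F. finite F \<and> ?B \<subseteq> span F" using finite_dim by blast
    fix a b c x assume a: "a \<in> ?B" and b: "b \<in> ?B" and c: "c \<in> ?B"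
    show "a \<star> b \<in> ?B"
    proof -
      have "e \<star> (a \<star> b) = a \<star> b" using a b eA by (simp flip: mul_assoc)
      moreover have "(a \<star> b) \<star> e = a \<star> b" using a b eA by (simp add: mul_assoc)
      ultimately show ?thesis using a b by (simp add: closed)
    qed
    show "a \<star> b \<star> c = a \<star> (b \<star> c)" using a b c by (simp add: mul_assoc)
    show "(a + b) \<star> c = a \<star> c + b \<star> c" using a b c by (simp add: mul_add_left)
    show "a \<star> (b + c) = a \<star> b + a \<star> c" using a b c by (simp add: mul_add_right)
    show "(x *s a) \<star> b = x *s (a \<star> b)" using a b by (simp add: mul_scale_left)
    show "a \<star> (x *s b) = x *s (a \<star> b)" using a b by (simp add: mul_scale_right)
    show "e \<star> a = a" "a \<star> e = a" using a by simp_all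
    fix t
    show "act t (a + b) = act t a + act t b" using a b by (simp add: act_add)
    show "act t (x *s a) = x *s act t a" using a by (simp add: act_scale)
    show "act t (a \<star> b) = act t a \<star> act t b" using a b by (simp add: act_mul)
    show "act t a \<in> ?B"
      using a eA act_mul[of e a t] act_mul[of a e t] by (simp add: act_closed act_e)
  next
    show "e \<in> ?B" using eA e by simp
    show "0 < CHAR('k)" by (rule char)
    show "act t e = e" for t by (rule act_e)
    show "a \<in> ?B \<Longrightarrow> act t a = 0 \<Longrightarrow> a = 0" for a t using act_inj by blast
    show "a \<in> ?B \<Longrightarrow> act s (act t a) = act t (act s a)" for a s t using act_commute by blast
    show "0 < n \<Longrightarrow> \<exists>s. \<forall>a\<in>?B. act t a = (act s ^^ n) a" for n t using act_divisible by blast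
  qed
qed

text \<open>In the corner \<open>e A e\<close>, a fixed idempotent \<open>f\<close> would split \<open>e\<close> as \<open>f + (e - f)\<close> in the fixed algebra; so
  \<open>trivial_idempotents\<close> applies to the corner, and the summands of any splitting of \<open>e\<close> in \<open>A\<close> lie in the
  corner.\<close>

theorem primitive_in_fixed_imp_primitive:
  assumes e: "primitive_in fixed e"
  shows "primitive_in A e"
proof -
  have ef: "e \<in> fixed" "e \<star> e = e" "e \<noteq> 0" using e by (auto simp: primitive_in_def)
  have eA: "e \<in> A" using ef fixed_subset by blast
  let ?B = "{a \<in> A. e \<star> a = a \<and> a \<star> e = a}"
  interpret B: divisible_action "(*s)" ?B "(\<star>)" e act
    by (rule corner_action[OF ef(1,2)])
  have triv: "f = 0 \<or> f = e" if f: "f \<in> B.fixed" "f \<star> f = f" for f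
  proof (rule ccontr)
    assume neg: "\<not> (f = 0 \<or> f = e)"
    have fB: "f \<in> A" "e \<star> f = f" "f \<star> e = f" "f \<in> fixed"
      using f by (auto simp: B.fixed_def fixed_def)
    have "e - f \<in> fixed" using subspace_diff[OF subspace_fixed ef(1) fB(4)] .
    moreover have "f \<star> (e - f) = 0" "(e - f) \<star> f = 0" "(e - f) \<star> (e - f) = e - f"
      using fB eA f ef by (simp_all add: closed mul_diff_left mul_diff_right)
    moreover have "e = f + (e - f)" "e - f \<noteq> 0" "f \<noteq> 0" using neg by auto
    ultimately show False using e fB f unfolding primitive_in_def by blast
  qed
  have key: "f = 0 \<or> f = e"
    if "f \<in> A" "g \<in> A" "f \<star> f = f" "f \<star> g = 0" "g \<star> f = 0" "e = f + g" for f g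
  proof (rule B.trivial_idempotents[OF triv])
    have "e \<star> f = f" "f \<star> e = f" using that by (simp_all add: mul_add_left mul_add_right)
    then show "f \<in> ?B" using that by simp
  qed (use that in auto)
  show ?thesis
    unfolding primitive_in_def
  proof (intro conjI notI)
    assume "\<exists>f\<in>A. \<exists>g\<in>A. f \<star> f = f \<and> g \<star> g = g \<and> f \<noteq> 0 \<and> g \<noteq> 0 \<and> f \<star> g = 0 \<and> g \<star> f = 0 \<and> e = f + g"
    then obtain f g where "f \<in> A" "g \<in> A" "f \<star> f = f" "f \<noteq> 0" "g \<noteq> 0" "f \<star> g = 0" "g \<star> f = 0" "e = f + g"
      by blast
    then show False using key[of f g] by auto
  qed (use eA ef in auto)
qed

theorem fixed_primitive_decomposition:
  obtains E where "finite E" "E \<subseteq> fixed" "\<And>x. x \<in> E \<Longrightarrow> primitive_in A x"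
    "orthogonal_family E" "\<Sum>E = unit"
proof -
  obtain E where E: "finite E" "\<forall>x\<in>E. primitive_in fixed x" "orthogonal_family E" "\<Sum>E = unit"
    using primitive_decomposition[OF fixed_subset unit_in_fixed unit_left[OF unit_closed]] by blast
  moreover have "E \<subseteq> fixed" using E by (auto simp: primitive_in_def)
  ultimately show thesis using that primitive_in_fixed_imp_primitive by blast
qed

end

section \<open>Convolution of linear functionals on the coordinate algebra\<close>

definition fscale :: "'k::field \<Rightarrow> ('x \<Rightarrow> 'k) \<Rightarrow> 'x \<Rightarrow> 'k" where
  "fscale c \<mu> = (\<lambda>x. c * \<mu> x)"

lemma fscale_apply [simp]: "fscale c \<mu> x = c * \<mu> x"
  by (simp add: fscale_def)

interpretation fun_space: vector_space fscale
  by unfold_locales (auto simp: fun_eq_iff algebra_simps)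

text \<open>The functions in \<open>A\<close> that vanish at one point form a subspace that is all of \<open>A\<close> or is complemented by a
  single function; removing the separating points one after the other leaves \<open>0\<close>.\<close>

lemma finite_dim_of_finite_separating_set:
  fixes A :: "('x \<Rightarrow> 'k::field) set"
  assumes "finite X" "fun_space.subspace A" "\<And>\<mu>. \<mu> \<in> A \<Longrightarrow> (\<forall>x\<in>X. \<mu> x = 0) \<Longrightarrow> \<mu> = 0"
  shows "\<exists>F. finite F \<and> A \<subseteq> fun_space.span F"
  using assms
proof (induction X arbitrary: A rule: finite_induct)
  case empty
  then have "A \<subseteq> {0}" by blast
  then have "A \<subseteq> fun_space.span {}" by (simp only: fun_space.span_empty)
  then show ?case by blast
next
  case (insert x X)
  define A' where "A' = {\<mu> \<in> A. \<mu> x = 0}"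
  have "fun_space.subspace A'"
    using insert.prems(1) unfolding A'_def fun_space.subspace_def by auto
  moreover have "\<mu> = 0" if "\<mu> \<in> A'" "\<forall>x\<in>X. \<mu> x = 0" for \<mu>
    using that insert.prems(2) unfolding A'_def by blast
  ultimately obtain F where F: "finite F" "A' \<subseteq> fun_space.span F" using insert.IH by blast
  show ?case
  proof (cases "A = A'")
    case True
    then show ?thesis using F by blast
  next
    case False
    then obtain \<nu> where \<nu>: "\<nu> \<in> A" "\<nu> x \<noteq> 0" unfolding A'_def by blast
    have "\<mu> \<in> fun_space.span (insert \<nu> F)" if \<mu>: "\<mu> \<in> A" for \<mu>
    proof -
      define c where "c = \<mu> x / \<nu> x"
      have "\<mu> - fscale c \<nu> \<in> A"
        by (rule fun_space.subspace_diff[OF insert.prems(1) \<mu>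
              fun_space.subspace_scale[OF insert.prems(1) \<nu>(1)]])
      then have "\<mu> - fscale c \<nu> \<in> A'" using \<nu>(2) by (simp add: A'_def c_def)
      then have "\<mu> - fscale c \<nu> \<in> fun_space.span F" using F by blast
      then show ?thesis unfolding fun_space.span_breakdown_eq by blast
    qed
    then have "A \<subseteq> fun_space.span (insert \<nu> F)" by blast
    moreover have "finite (insert \<nu> F)" using F(1) by simp
    ultimately show ?thesis by blast
  qed
qed

context affine_alg_group
begin

lemma regular_extensional: "f \<in> regular G \<Longrightarrow> f \<in> extensional (carrier G)"
proof -
  obtain S where S: "S \<subseteq> extensional (carrier G)" "regular G = generated_functions (carrier G) S"
    using finitely_generated by blast
  assume "f \<in> regular G"
  then have "f \<in> generated_functions (carrier G) S" using S by simp
  then show ?thesis by induction (use S in \<open>blast intro: restrict_extensional\<close>)+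
qed

lemma restrict_regular [simp]: "f \<in> regular G \<Longrightarrow> (\<lambda>x\<in>carrier G. f x) = f"
  using regular_extensional extensional_restrict[of f] by simp

lemma regular_const: "(\<lambda>x\<in>carrier G. c) \<in> regular G"
  using finitely_generated generated_functions.const by metis

lemma regular_add: "f \<in> regular G \<Longrightarrow> g \<in> regular G \<Longrightarrow> (\<lambda>x\<in>carrier G. f x + g x) \<in> regular G"
  using finitely_generated generated_functions.add by metis

lemma regular_mult: "f \<in> regular G \<Longrightarrow> g \<in> regular G \<Longrightarrow> (\<lambda>x\<in>carrier G. f x * g x) \<in> regular G"
  using finitely_generated generated_functions.mult by metis

lemma regular_scale: "f \<in> regular G \<Longrightarrow> (\<lambda>x\<in>carrier G. c * f x) \<in> regular G"
  using regular_mult[OF regular_const[of c]] by (simp cong: restrict_cong)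

lemma regular_diff_const: "f \<in> regular G \<Longrightarrow> (\<lambda>x\<in>carrier G. f x - c) \<in> regular G"
  using regular_add[OF _ regular_const[of "- c"]] by (simp cong: restrict_cong)

lemma regular_power: "f \<in> regular G \<Longrightarrow> (\<lambda>x\<in>carrier G. f x ^ n) \<in> regular G"
proof (induction n)
  case 0
  show "(\<lambda>x\<in>carrier G. f x ^ 0) \<in> regular G" using regular_const[of 1] by simp
next
  case (Suc n)
  show "(\<lambda>x\<in>carrier G. f x ^ Suc n) \<in> regular G"
    using regular_mult[OF Suc.prems Suc.IH[OF Suc.prems]] by (simp cong: restrict_cong)
qed

lemma regular_sum:
  fixes n :: nat
  assumes "\<And>i. i < n \<Longrightarrow> a i \<in> regular G"
  shows "(\<lambda>x\<in>carrier G. \<Sum>i<n. c i * a i x) \<in> regular G"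
  using assms
proof (induction n)
  case 0
  show "(\<lambda>x\<in>carrier G. \<Sum>i<0. c i * a i x) \<in> regular G" using regular_const[of 0] by simp
next
  case (Suc n)
  have "(\<lambda>x\<in>carrier G. \<Sum>i<n. c i * a i x) \<in> regular G"
    by (rule Suc.IH) (rule Suc.prems, simp)
  from regular_add[OF this regular_scale[OF Suc.prems[of n], of "c n"]]
  show "(\<lambda>x\<in>carrier G. \<Sum>i<Suc n. c i * a i x) \<in> regular G"
    by (simp cong: restrict_cong)
qed

text \<open>Functionals are normalised to be \<open>0\<close> outside \<open>k[G]\<close> rather than \<open>undefined\<close>, so that pointwise addition on
  the function type makes them a vector space.\<close>

definition functionals :: "(('g \<Rightarrow> 'k) \<Rightarrow> 'k) set" where
  "functionals = {\<mu>. linear_functional G \<mu> \<and> (\<forall>f. f \<notin> regular G \<longrightarrow> \<mu> f = 0)}"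

lemma functional_add:
  "\<mu> \<in> functionals \<Longrightarrow> f \<in> regular G \<Longrightarrow> g \<in> regular G \<Longrightarrow>
    \<mu> (\<lambda>x\<in>carrier G. f x + g x) = \<mu> f + \<mu> g"
  by (simp add: functionals_def linear_functional_def coord_ring_def)

lemma functional_scale:
  "\<mu> \<in> functionals \<Longrightarrow> f \<in> regular G \<Longrightarrow> \<mu> (\<lambda>x\<in>carrier G. c * f x) = c * \<mu> f"
  by (simp add: functionals_def linear_functional_def coord_ring_def)

lemma functional_outside: "\<mu> \<in> functionals \<Longrightarrow> f \<notin> regular G \<Longrightarrow> \<mu> f = 0"
  by (simp add: functionals_def)

lemma functionalsI:
  assumes "\<And>f g. f \<in> regular G \<Longrightarrow> g \<in> regular G \<Longrightarrow> \<mu> (\<lambda>x\<in>carrier G. f x + g x) = \<mu> f + \<mu> g"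
    and "\<And>c f. f \<in> regular G \<Longrightarrow> \<mu> (\<lambda>x\<in>carrier G. c * f x) = c * \<mu> f"
    and "\<And>f. f \<notin> regular G \<Longrightarrow> \<mu> f = 0"
  shows "\<mu> \<in> functionals"
  using assms by (simp add: functionals_def linear_functional_def coord_ring_def)

lemma functional_zero: "\<mu> \<in> functionals \<Longrightarrow> \<mu> (\<lambda>x\<in>carrier G. 0) = 0"
  using functional_scale[of \<mu> "\<lambda>x\<in>carrier G. 0" 0] regular_const[of 0] by (simp cong: restrict_cong)

lemma functional_sum:
  fixes n :: nat
  assumes \<mu>: "\<mu> \<in> functionals" and a: "\<And>i. i < n \<Longrightarrow> a i \<in> regular G"
  shows "\<mu> (\<lambda>x\<in>carrier G. \<Sum>i<n. c i * a i x) = (\<Sum>i<n. c i * \<mu> (a i))"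
  using a
proof (induction n)
  case 0
  show "\<mu> (\<lambda>x\<in>carrier G. \<Sum>i<0. c i * a i x) = (\<Sum>i<0. c i * \<mu> (a i))"
    using functional_zero[OF \<mu>] by simp
next
  case (Suc n)
  have IH: "\<mu> (\<lambda>x\<in>carrier G. \<Sum>i<n. c i * a i x) = (\<Sum>i<n. c i * \<mu> (a i))"
    by (rule Suc.IH) (rule Suc.prems, simp)
  have an: "a n \<in> regular G" by (rule Suc.prems) simp
  have "(\<lambda>x\<in>carrier G. \<Sum>i<n. c i * a i x) \<in> regular G"
    by (rule regular_sum) (rule Suc.prems, simp)
  from functional_add[OF \<mu> this regular_scale[OF an, of "c n"]]
  show "\<mu> (\<lambda>x\<in>carrier G. \<Sum>i<Suc n. c i * a i x) = (\<Sum>i<Suc n. c i * \<mu> (a i))"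
    by (simp add: IH functional_scale[OF \<mu> an] cong: restrict_cong)
qed

lemma functional_eqI:
  "\<mu> \<in> functionals \<Longrightarrow> \<nu> \<in> functionals \<Longrightarrow> (\<And>f. f \<in> regular G \<Longrightarrow> \<mu> f = \<nu> f) \<Longrightarrow> \<mu> = \<nu>"
  using functional_outside by (metis ext)

lemma subspace_functionals: "fun_space.subspace functionals"
  by (rule fun_space.subspaceI; rule functionalsI)
    (auto simp: functional_add functional_scale functional_outside algebra_simps)

lemma regular_left_translate:
  assumes "f \<in> regular G" "x \<in> carrier G"
  shows "(\<lambda>y\<in>carrier G. f (x \<otimes> y)) \<in> regular G"
proof -
  obtain n :: nat and a b where ab: "\<forall>i<n. a i \<in> regular G \<and> b i \<in> regular G"
    "\<forall>x\<in>carrier G. \<forall>y\<in>carrier G. f (x \<otimes> y) = (\<Sum>i<n. a i x * b i y)"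
    using comult[OF assms(1)] by blast
  have "(\<lambda>y\<in>carrier G. f (x \<otimes> y)) = (\<lambda>y\<in>carrier G. \<Sum>i<n. a i x * b i y)"
    using ab(2) assms(2) by (intro restrict_ext) blast
  then show ?thesis using regular_sum[of n b "\<lambda>i. a i x"] ab(1) by simp
qed

lemma regular_right_translate:
  assumes "f \<in> regular G" "y \<in> carrier G"
  shows "(\<lambda>x\<in>carrier G. f (x \<otimes> y)) \<in> regular G"
proof -
  obtain n :: nat and a b where ab: "\<forall>i<n. a i \<in> regular G \<and> b i \<in> regular G"
    "\<forall>x\<in>carrier G. \<forall>y\<in>carrier G. f (x \<otimes> y) = (\<Sum>i<n. a i x * b i y)"
    using comult[OF assms(1)] by blast
  have "(\<lambda>x\<in>carrier G. f (x \<otimes> y)) = (\<lambda>x\<in>carrier G. \<Sum>i<n. b i y * a i x)"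
    using ab(2) assms(2) by (intro restrict_ext) (simp add: mult.commute)
  then show ?thesis using regular_sum[of n a "\<lambda>i. b i y"] ab(1) by simp
qed

text \<open>The contraction \<open>(id \<otimes> \<nu>)(\<Delta> f)\<close> of the comultiplication.\<close>

definition slice :: "(('g \<Rightarrow> 'k) \<Rightarrow> 'k) \<Rightarrow> ('g \<Rightarrow> 'k) \<Rightarrow> 'g \<Rightarrow> 'k" where
  "slice \<nu> f = (\<lambda>x\<in>carrier G. \<nu> (\<lambda>y\<in>carrier G. f (x \<otimes> y)))"

lemma slice_comult:
  fixes n :: nat
  assumes \<nu>: "\<nu> \<in> functionals" and b: "\<And>i. i < n \<Longrightarrow> b i \<in> regular G"
    and ab: "\<And>x y. x \<in> carrier G \<Longrightarrow> y \<in> carrier G \<Longrightarrow> f (x \<otimes> y) = (\<Sum>i<n. a i x * b i y)"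
  shows "slice \<nu> f = (\<lambda>x\<in>carrier G. \<Sum>i<n. \<nu> (b i) * a i x)"
  unfolding slice_def
proof (rule restrict_ext)
  fix x assume x: "x \<in> carrier G"
  have "(\<lambda>y\<in>carrier G. f (x \<otimes> y)) = (\<lambda>y\<in>carrier G. \<Sum>i<n. a i x * b i y)"
    using ab[OF x] by (intro restrict_ext) blast
  then show "\<nu> (\<lambda>y\<in>carrier G. f (x \<otimes> y)) = (\<Sum>i<n. \<nu> (b i) * a i x)"
    using functional_sum[OF \<nu>, of n b "\<lambda>i. a i x"] b by (simp add: mult.commute)
qed

lemma slice_regular:
  assumes \<nu>: "\<nu> \<in> functionals" and f: "f \<in> regular G"
  shows "slice \<nu> f \<in> regular G"
proof -
  obtain n :: nat and a b where ab: "\<forall>i<n. a i \<in> regular G \<and> b i \<in> regular G"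
    "\<forall>x\<in>carrier G. \<forall>y\<in>carrier G. f (x \<otimes> y) = (\<Sum>i<n. a i x * b i y)"
    using comult[OF f] by blast
  have "slice \<nu> f = (\<lambda>x\<in>carrier G. \<Sum>i<n. \<nu> (b i) * a i x)"
    using ab by (intro slice_comult[OF \<nu>]) auto
  then show ?thesis using regular_sum[of n a] ab(1) by simp
qed

lemma slice_apply: "x \<in> carrier G \<Longrightarrow> slice \<nu> f x = \<nu> (\<lambda>y\<in>carrier G. f (x \<otimes> y))"
  by (simp add: slice_def)

lemma slice_add:
  assumes "\<nu> \<in> functionals" "f \<in> regular G" "g \<in> regular G"
  shows "slice \<nu> (\<lambda>x\<in>carrier G. f x + g x) = (\<lambda>x\<in>carrier G. slice \<nu> f x + slice \<nu> g x)"
proof -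
  have "\<nu> (\<lambda>y\<in>carrier G. (\<lambda>x\<in>carrier G. f x + g x) (x \<otimes> y)) =
      \<nu> (\<lambda>y\<in>carrier G. f (x \<otimes> y)) + \<nu> (\<lambda>y\<in>carrier G. g (x \<otimes> y))" if "x \<in> carrier G" for x
    using functional_add[OF assms(1) regular_left_translate[OF assms(2) that]
        regular_left_translate[OF assms(3) that]] that by (simp cong: restrict_cong)
  then show ?thesis by (simp add: slice_def cong: restrict_cong)
qed

lemma slice_scale:
  assumes "\<nu> \<in> functionals" "f \<in> regular G"
  shows "slice \<nu> (\<lambda>x\<in>carrier G. c * f x) = (\<lambda>x\<in>carrier G. c * slice \<nu> f x)"
proof -
  have "\<nu> (\<lambda>y\<in>carrier G. (\<lambda>x\<in>carrier G. c * f x) (x \<otimes> y)) =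
      c * \<nu> (\<lambda>y\<in>carrier G. f (x \<otimes> y))" if "x \<in> carrier G" for x
    using functional_scale[OF assms(1) regular_left_translate[OF assms(2) that]] that
    by (simp cong: restrict_cong)
  then show ?thesis by (simp add: slice_def cong: restrict_cong)
qed

definition conv :: "(('g \<Rightarrow> 'k) \<Rightarrow> 'k) \<Rightarrow> (('g \<Rightarrow> 'k) \<Rightarrow> 'k) \<Rightarrow> ('g \<Rightarrow> 'k) \<Rightarrow> 'k" where
  "conv \<mu> \<nu> = (\<lambda>f. if f \<in> regular G then \<mu> (slice \<nu> f) else 0)"

lemma conv_functional: "\<mu> \<in> functionals \<Longrightarrow> \<nu> \<in> functionals \<Longrightarrow> conv \<mu> \<nu> \<in> functionals"
  by (rule functionalsI)
    (simp_all add: conv_def regular_add regular_scale slice_add slice_scale functional_add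
      functional_scale slice_regular)

text \<open>Coassociativity, which comes from the associativity of \<open>G\<close>.\<close>

lemma slice_slice:
  assumes \<nu>: "\<nu> \<in> functionals" and \<rho>: "\<rho> \<in> functionals" and f: "f \<in> regular G"
  shows "slice \<nu> (slice \<rho> f) = slice (conv \<nu> \<rho>) f"
  unfolding slice_def[of \<nu>] slice_def[of "conv \<nu> \<rho>"]
proof (rule restrict_ext)
  fix x assume x: "x \<in> carrier G"
  have "(\<lambda>y\<in>carrier G. slice \<rho> f (x \<otimes> y)) = slice \<rho> (\<lambda>y\<in>carrier G. f (x \<otimes> y))"
    unfolding slice_def using x by (intro restrict_ext) (simp add: m_assoc cong: restrict_cong)
  then show "\<nu> (\<lambda>y\<in>carrier G. slice \<rho> f (x \<otimes> y)) = conv \<nu> \<rho> (\<lambda>y\<in>carrier G. f (x \<otimes> y))"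
    using regular_left_translate[OF f x] by (simp add: conv_def)
qed

lemma conv_apply: "f \<in> regular G \<Longrightarrow> conv \<mu> \<nu> f = \<mu> (slice \<nu> f)"
  by (simp add: conv_def)

lemma conv_assoc:
  assumes \<mu>: "\<mu> \<in> functionals" and \<nu>: "\<nu> \<in> functionals" and \<rho>: "\<rho> \<in> functionals"
  shows "conv (conv \<mu> \<nu>) \<rho> = conv \<mu> (conv \<nu> \<rho>)"
proof (rule functional_eqI)
  fix f assume f: "f \<in> regular G"
  show "conv (conv \<mu> \<nu>) \<rho> f = conv \<mu> (conv \<nu> \<rho>) f"
    by (simp only: conv_apply[OF f] conv_apply[OF slice_regular[OF \<rho> f]] slice_slice[OF \<nu> \<rho> f])
qed (intro conv_functional assms)+

definition counit :: "('g \<Rightarrow> 'k) \<Rightarrow> 'k" where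
  "counit f = (if f \<in> regular G then f \<one> else 0)"

lemma counit_functional: "counit \<in> functionals"
  by (rule functionalsI) (simp_all add: counit_def regular_add regular_scale)

lemma conv_counit_left:
  assumes "\<mu> \<in> functionals" shows "conv counit \<mu> = \<mu>"
  using assms by (intro functional_eqI conv_functional counit_functional)
    (simp_all add: conv_def counit_def slice_regular slice_apply cong: restrict_cong)

lemma slice_counit: "f \<in> regular G \<Longrightarrow> slice counit f = f"
  using regular_left_translate by (simp add: slice_def counit_def cong: restrict_cong)

lemma conv_counit_right:
  assumes "\<mu> \<in> functionals" shows "conv \<mu> counit = \<mu>"
  using assms by (intro functional_eqI conv_functional counit_functional)
    (simp_all add: conv_def slice_counit)

lemma conv_add_left: "conv (\<mu> + \<nu>) \<rho> = conv \<mu> \<rho> + conv \<nu> \<rho>"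
  by (auto simp: conv_def fun_eq_iff)

lemma conv_scale_left: "conv (fscale c \<mu>) \<rho> = fscale c (conv \<mu> \<rho>)"
  by (auto simp: conv_def fun_eq_iff)

lemma conv_add_right:
  assumes "\<mu> \<in> functionals" "\<nu> \<in> functionals" "\<rho> \<in> functionals"
  shows "conv \<mu> (\<nu> + \<rho>) = conv \<mu> \<nu> + conv \<mu> \<rho>"
proof
  fix f
  have "slice (\<nu> + \<rho>) f = (\<lambda>x\<in>carrier G. slice \<nu> f x + slice \<rho> f x)"
    by (simp add: slice_def cong: restrict_cong)
  then show "conv \<mu> (\<nu> + \<rho>) f = (conv \<mu> \<nu> + conv \<mu> \<rho>) f"
    using assms by (simp add: conv_def functional_add slice_regular)
qed

lemma conv_scale_right:
  assumes "\<mu> \<in> functionals" "\<nu> \<in> functionals"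
  shows "conv \<mu> (fscale c \<nu>) = fscale c (conv \<mu> \<nu>)"
proof
  fix f
  have "slice (fscale c \<nu>) f = (\<lambda>x\<in>carrier G. c * slice \<nu> f x)"
    by (simp add: slice_def cong: restrict_cong)
  then show "conv \<mu> (fscale c \<nu>) f = fscale c (conv \<mu> \<nu>) f"
    using assms by (simp add: conv_def functional_scale slice_regular)
qed

lemma conv_zero_left: "conv 0 \<nu> = 0"
  by (auto simp: conv_def fun_eq_iff)

lemma conv_zero_right: "\<mu> \<in> functionals \<Longrightarrow> conv \<mu> 0 = 0"
  using functional_zero by (auto simp: conv_def slice_def fun_eq_iff)

text \<open>The action of \<open>k[G]\<close> on functionals that is dual to multiplication. Vanishing on an ideal such as a power
  of the augmentation ideal or the ideal of a Frobenius kernel becomes a condition on \<open>\<mu>\<cdot>g\<close> for generators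
  \<open>g\<close>, which \<open>dot_conv\<close> carries over to convolutions.\<close>

definition dot :: "(('g \<Rightarrow> 'k) \<Rightarrow> 'k) \<Rightarrow> ('g \<Rightarrow> 'k) \<Rightarrow> ('g \<Rightarrow> 'k) \<Rightarrow> 'k" where
  "dot \<mu> g = (\<lambda>h. if h \<in> regular G then \<mu> (\<lambda>x\<in>carrier G. g x * h x) else 0)"

lemma dot_functional:
  assumes "\<mu> \<in> functionals" "g \<in> regular G"
  shows "dot \<mu> g \<in> functionals"
proof (rule functionalsI)
  fix f h assume "f \<in> regular G" "h \<in> regular G"
  then show "dot \<mu> g (\<lambda>x\<in>carrier G. f x + h x) = dot \<mu> g f + dot \<mu> g h"
    using functional_add[OF assms(1) regular_mult[OF assms(2)] regular_mult[OF assms(2)], of f h]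
    by (simp add: dot_def regular_add distrib_left cong: restrict_cong)
next
  fix c f assume "f \<in> regular G"
  then show "dot \<mu> g (\<lambda>x\<in>carrier G. c * f x) = c * dot \<mu> g f"
    using functional_scale[OF assms(1) regular_mult[OF assms(2)], of f c]
    by (simp add: dot_def regular_scale mult.left_commute cong: restrict_cong)
qed (simp add: dot_def)

lemma dot_dot:
  "f \<in> regular G \<Longrightarrow> g \<in> regular G \<Longrightarrow> dot (dot \<mu> f) g = dot (dot \<mu> g) f"
  by (auto simp: dot_def fun_eq_iff regular_mult mult.left_commute cong: restrict_cong)

text \<open>As \<open>\<Delta>\<close> is multiplicative, \<open>\<Delta>(f h) = \<Sum>(a\<^sub>i \<otimes> b\<^sub>i) \<Delta>h\<close> if \<open>\<Delta>f = \<Sum>a\<^sub>i \<otimes> b\<^sub>i\<close>.\<close>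

lemma dot_conv:
  fixes n :: nat
  assumes \<mu>: "\<mu> \<in> functionals" and \<nu>: "\<nu> \<in> functionals" and f: "f \<in> regular G"
    and h: "h \<in> regular G"
    and R: "\<And>i. i < n \<Longrightarrow> a i \<in> regular G" "\<And>i. i < n \<Longrightarrow> b i \<in> regular G"
    and ab: "\<And>x y. x \<in> carrier G \<Longrightarrow> y \<in> carrier G \<Longrightarrow> f (x \<otimes> y) = (\<Sum>i<n. a i x * b i y)"
  shows "dot (conv \<mu> \<nu>) f h = (\<Sum>i<n. conv (dot \<mu> (a i)) (dot \<nu> (b i)) h)"
proof -
  have slice: "slice \<nu> (\<lambda>x\<in>carrier G. f x * h x) =
    (\<lambda>x\<in>carrier G. \<Sum>i<n. 1 * (\<lambda>x\<in>carrier G. a i x * slice (dot \<nu> (b i)) h x) x)"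
    unfolding slice_def[of \<nu>]
  proof (rule restrict_ext)
    fix x assume x: "x \<in> carrier G"
    have hx: "(\<lambda>y\<in>carrier G. h (x \<otimes> y)) \<in> regular G" by (rule regular_left_translate[OF h x])
    have "(\<lambda>y\<in>carrier G. (\<lambda>x\<in>carrier G. f x * h x) (x \<otimes> y)) =
      (\<lambda>y\<in>carrier G. \<Sum>i<n. a i x * (\<lambda>y\<in>carrier G. b i y * (\<lambda>y\<in>carrier G. h (x \<otimes> y)) y) y)"
      using x by (intro restrict_ext) (simp add: ab sum_distrib_right mult.assoc)
    moreover have "(\<lambda>y\<in>carrier G. b i y * (\<lambda>y\<in>carrier G. h (x \<otimes> y)) y) \<in> regular G" if "i < n" for i
      using regular_mult[OF R(2)[OF that] hx] .
    ultimately have "\<nu> (\<lambda>y\<in>carrier G. (\<lambda>x\<in>carrier G. f x * h x) (x \<otimes> y)) =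
      (\<Sum>i<n. a i x * \<nu> (\<lambda>y\<in>carrier G. b i y * (\<lambda>y\<in>carrier G. h (x \<otimes> y)) y))"
      by (simp only: functional_sum[OF \<nu>])
    also have "\<dots> = (\<Sum>i<n. a i x * slice (dot \<nu> (b i)) h x)"
      using x hx by (simp add: slice_apply dot_def)
    finally show "\<nu> (\<lambda>y\<in>carrier G. (\<lambda>x\<in>carrier G. f x * h x) (x \<otimes> y)) =
      (\<Sum>i<n. 1 * (\<lambda>x\<in>carrier G. a i x * slice (dot \<nu> (b i)) h x) x)" using x by simp
  qed
  have "dot (conv \<mu> \<nu>) f h = \<mu> (slice \<nu> (\<lambda>x\<in>carrier G. f x * h x))"
    using f h by (simp add: dot_def conv_def regular_mult)
  also have "\<dots> = (\<Sum>i<n. 1 * \<mu> (\<lambda>x\<in>carrier G. a i x * slice (dot \<nu> (b i)) h x))"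
    unfolding slice using R \<nu> h
    by (intro functional_sum[OF \<mu>] regular_mult slice_regular dot_functional) auto
  also have "\<dots> = (\<Sum>i<n. conv (dot \<mu> (a i)) (dot \<nu> (b i)) h)"
    using R \<nu> h by (intro sum.cong) (simp_all add: conv_def dot_def[of \<mu>] slice_regular dot_functional)
  finally show ?thesis .
qed

section \<open>Powers of the augmentation ideal\<close>

lemma coord_ring_simps [simp]:
  "carrier (coord_ring G) = regular G"
  "f \<otimes>\<^bsub>coord_ring G\<^esub> g = (\<lambda>x\<in>carrier G. f x * g x)"
  "f \<oplus>\<^bsub>coord_ring G\<^esub> g = (\<lambda>x\<in>carrier G. f x + g x)"
  "\<zero>\<^bsub>coord_ring G\<^esub> = (\<lambda>x\<in>carrier G. 0)"
  "\<one>\<^bsub>coord_ring G\<^esub> = (\<lambda>x\<in>carrier G. 1)"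
  by (simp_all add: coord_ring_def)

lemma augmentation_regular: "g \<in> augmentation_ideal G \<Longrightarrow> g \<in> regular G"
  by (simp add: augmentation_ideal_def)

text \<open>If \<open>\<Delta>g = \<Sum>a\<^sub>i \<otimes> b\<^sub>i\<close>, then \<open>\<Sum>a\<^sub>i(1) b\<^sub>i = g\<close>, so that \<open>\<Delta>g = \<Sum>(a\<^sub>i - a\<^sub>i(1)) \<otimes> b\<^sub>i + 1 \<otimes> g\<close>.\<close>

lemma comult_augmentation:
  assumes g: "g \<in> augmentation_ideal G"
  shows "\<exists>(n::nat) a b. (\<forall>i<n. a i \<in> regular G \<and> b i \<in> regular G \<and>
      (a i \<in> augmentation_ideal G \<or> b i \<in> augmentation_ideal G)) \<and>
    (\<forall>x\<in>carrier G. \<forall>y\<in>carrier G. g (x \<otimes> y) = (\<Sum>i<n. a i x * b i y))"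
proof -
  have gR: "g \<in> regular G" and g1: "g \<one> = 0" using g by (auto simp: augmentation_ideal_def)
  obtain n :: nat and a b where ab: "\<forall>i<n. a i \<in> regular G \<and> b i \<in> regular G"
    "\<forall>x\<in>carrier G. \<forall>y\<in>carrier G. g (x \<otimes> y) = (\<Sum>i<n. a i x * b i y)"
    using comult[OF gR] by blast
  define a' where "a' i = (if i < n then (\<lambda>x\<in>carrier G. a i x - a i \<one>) else (\<lambda>x\<in>carrier G. 1))" for i
  define b' where "b' i = (if i < n then b i else g)" for i
  show ?thesis
  proof (intro exI conjI allI ballI impI)
    fix i assume i: "i < Suc n"
    show "a' i \<in> regular G" using i ab(1) regular_diff_const regular_const by (auto simp: a'_def)
    show "b' i \<in> regular G" using i ab(1) gR by (auto simp: b'_def)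
    show "a' i \<in> augmentation_ideal G \<or> b' i \<in> augmentation_ideal G"
      using i ab(1) g regular_diff_const[of "a i" "a i \<one>"]
      by (auto simp: a'_def b'_def augmentation_ideal_def)
  next
    fix x y assume xy: "x \<in> carrier G" "y \<in> carrier G"
    have "g y = (\<Sum>i<n. a i \<one> * b i y)" using ab(2) xy by (metis l_one one_closed)
    moreover have "g (x \<otimes> y) = (\<Sum>i<n. a i x * b i y)" using ab(2) xy by blast
    moreover have "(\<Sum>i<Suc n. a' i x * b' i y) = (\<Sum>i<n. (a i x - a i \<one>) * b i y) + g y"
      using xy by (simp add: a'_def b'_def)
    ultimately show "g (x \<otimes> y) = (\<Sum>i<Suc n. a' i x * b' i y)"
      by (simp add: left_diff_distrib sum_subtractf)
  qed
qed

definition vanishes :: "nat \<Rightarrow> (('g \<Rightarrow> 'k) \<Rightarrow> 'k) \<Rightarrow> bool" where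
  "vanishes n \<mu> \<longleftrightarrow> (\<forall>f \<in> augmentation_ideal G [^]\<^bsub>ideals_set (coord_ring G)\<^esub> n. \<mu> f = 0)"

lemma one_ideals_set [simp]: "\<one>\<^bsub>ideals_set (coord_ring G)\<^esub> = regular G"
  by (simp add: ideals_set_def)

lemma augmentation_pow_0: "augmentation_ideal G [^]\<^bsub>ideals_set (coord_ring G)\<^esub> (0::nat) = regular G"
  by (simp add: nat_pow_def ideals_set_def)

lemma augmentation_pow_Suc:
  "augmentation_ideal G [^]\<^bsub>ideals_set (coord_ring G)\<^esub> (Suc n) =
    ideal_prod (coord_ring G) (augmentation_ideal G [^]\<^bsub>ideals_set (coord_ring G)\<^esub> n)
      (augmentation_ideal G)"
  by (simp add: nat_pow_def ideals_set_def)

lemma augmentation_pow_regular: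
  "augmentation_ideal G [^]\<^bsub>ideals_set (coord_ring G)\<^esub> (n::nat) \<subseteq> regular G"
proof (induction n)
  case 0
  show ?case by (simp add: augmentation_pow_0)
next
  case (Suc n)
  show ?case
  proof
    fix f assume "f \<in> augmentation_ideal G [^]\<^bsub>ideals_set (coord_ring G)\<^esub> (Suc n)"
    then have "f \<in> ideal_prod (coord_ring G) (augmentation_ideal G [^]\<^bsub>ideals_set (coord_ring G)\<^esub> n)
      (augmentation_ideal G)" by (simp only: augmentation_pow_Suc)
    then show "f \<in> regular G"
    proof (induction rule: ideal_prod.induct)
      case (prod i j)
      then have "i \<in> regular G" "j \<in> regular G" using Suc augmentation_regular by blast+
      then show "i \<otimes>\<^bsub>coord_ring G\<^esub> j \<in> regular G" using regular_mult by simp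
    next
      case (sum f g)
      show "f \<oplus>\<^bsub>coord_ring G\<^esub> g \<in> regular G" using regular_add[OF sum.IH] by simp
    qed
  qed
qed

lemma vanishes_0: "vanishes 0 \<mu> \<longleftrightarrow> (\<forall>f\<in>regular G. \<mu> f = 0)"
  by (simp add: vanishes_def augmentation_pow_0)

lemma vanishes_Suc:
  assumes \<mu>: "\<mu> \<in> functionals"
  shows "vanishes (Suc n) \<mu> \<longleftrightarrow> (\<forall>g\<in>augmentation_ideal G. vanishes n (dot \<mu> g))"
proof
  assume v: "vanishes (Suc n) \<mu>"
  show "\<forall>g\<in>augmentation_ideal G. vanishes n (dot \<mu> g)"
    unfolding vanishes_def
  proof (intro ballI)
    fix g f assume g: "g \<in> augmentation_ideal G"
      and f: "f \<in> augmentation_ideal G [^]\<^bsub>ideals_set (coord_ring G)\<^esub> n"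
    have "f \<otimes>\<^bsub>coord_ring G\<^esub> g \<in> augmentation_ideal G [^]\<^bsub>ideals_set (coord_ring G)\<^esub> (Suc n)"
      unfolding augmentation_pow_Suc using f g by (rule ideal_prod.prod)
    then have "\<mu> (\<lambda>x\<in>carrier G. f x * g x) = 0" using v unfolding vanishes_def by force
    then show "dot \<mu> g f = 0" by (simp add: dot_def mult.commute)
  qed
next
  assume v: "\<forall>g\<in>augmentation_ideal G. vanishes n (dot \<mu> g)"
  show "vanishes (Suc n) \<mu>"
    unfolding vanishes_def
  proof
    fix f assume "f \<in> augmentation_ideal G [^]\<^bsub>ideals_set (coord_ring G)\<^esub> (Suc n)"
    then have "f \<in> ideal_prod (coord_ring G) (augmentation_ideal G [^]\<^bsub>ideals_set (coord_ring G)\<^esub> n)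
      (augmentation_ideal G)" by (simp only: augmentation_pow_Suc)
    then have "f \<in> regular G \<and> \<mu> f = 0"
    proof (induction rule: ideal_prod.induct)
      case (prod i j)
      have iR: "i \<in> regular G" using prod augmentation_pow_regular by blast
      have "dot \<mu> j i = 0" using v prod unfolding vanishes_def by blast
      then have "\<mu> (\<lambda>x\<in>carrier G. i x * j x) = 0" using iR by (simp add: dot_def mult.commute)
      then show "i \<otimes>\<^bsub>coord_ring G\<^esub> j \<in> regular G \<and> \<mu> (i \<otimes>\<^bsub>coord_ring G\<^esub> j) = 0"
        using regular_mult[OF iR augmentation_regular[OF prod(2)]] by simp
    next
      case (sum f g)
      then show "f \<oplus>\<^bsub>coord_ring G\<^esub> g \<in> regular G \<and> \<mu> (f \<oplus>\<^bsub>coord_ring G\<^esub> g) = 0"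
        using functional_add[OF \<mu>, of f g] regular_add[of f g] by simp
    qed
    then show "\<mu> f = 0" by blast
  qed
qed

lemma vanishes_dot:
  assumes "\<mu> \<in> functionals" "vanishes n \<mu>" and b: "b \<in> regular G"
  shows "vanishes n (dot \<mu> b)"
  using assms(1,2)
proof (induction n arbitrary: \<mu>)
  case 0
  show "vanishes 0 (dot \<mu> b)" using 0 b regular_mult by (simp add: vanishes_0 dot_def)
next
  case (Suc n)
  have "vanishes n (dot (dot \<mu> b) g)" if g: "g \<in> augmentation_ideal G" for g
  proof -
    have gR: "g \<in> regular G" using g by (rule augmentation_regular)
    have "vanishes n (dot \<mu> g)" using Suc.prems g vanishes_Suc by blast
    then have "vanishes n (dot (dot \<mu> g) b)" using Suc.IH dot_functional[OF Suc.prems(1) gR] by blast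
    then show ?thesis by (simp only: dot_dot[OF b gR])
  qed
  then show "vanishes (Suc n) (dot \<mu> b)"
    using vanishes_Suc[OF dot_functional[OF Suc.prems(1) b]] by blast
qed

lemma vanishes_mono:
  assumes "\<mu> \<in> functionals" "vanishes n \<mu>" "n \<le> m"
  shows "vanishes m \<mu>"
  using assms(3)
proof (induction m rule: dec_induct)
  case base
  show ?case by (rule assms(2))
next
  case (step m)
  then show ?case using vanishes_Suc vanishes_dot augmentation_regular assms(1) by blast
qed

text \<open>For \<open>g\<close> in the augmentation ideal, \<open>(\<mu>\<nu>)\<cdot>g\<close> is a sum of convolutions \<open>(\<mu>\<cdot>a\<^sub>i)(\<nu>\<cdot>b\<^sub>i)\<close>, and one of \<open>\<mu>\<cdot>a\<^sub>i\<close> and \<open>\<nu>\<cdot>b\<^sub>i\<close> vanishes on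
  a smaller power than \<open>\<mu>\<close> or \<open>\<nu>\<close> does.\<close>

lemma vanishes_conv:
  assumes "\<mu> \<in> functionals" "\<nu> \<in> functionals" "vanishes n \<mu>" "vanishes m \<nu>"
  shows "vanishes (n + m) (conv \<mu> \<nu>)"
  using assms
proof (induction "n + m" arbitrary: n m \<mu> \<nu>)
  case 0
  then have "vanishes 0 \<mu>" by simp
  then have "vanishes 0 (conv \<mu> \<nu>)"
    using slice_regular[OF 0(3)] by (simp add: vanishes_0 conv_apply)
  then show "vanishes (n + m) (conv \<mu> \<nu>)" using 0(1) by simp
next
  case (Suc k)
  note \<mu> = Suc.prems(1) and \<nu> = Suc.prems(2)
  consider "n = 0" | "m = 0" | n' m' where "n = Suc n'" "m = Suc m'"
    by (meson not0_implies_Suc)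
  then show "vanishes (n + m) (conv \<mu> \<nu>)"
  proof cases
    case 1
    then have "conv \<mu> \<nu> f = 0" if "f \<in> regular G" for f
      using Suc.prems(3) slice_regular[OF \<nu> that] that by (simp add: vanishes_0 conv_apply)
    then show ?thesis using augmentation_pow_regular unfolding vanishes_def by blast
  next
    case 2
    have "conv \<mu> \<nu> f = 0" if f: "f \<in> regular G" for f
    proof -
      have "slice \<nu> f = (\<lambda>x\<in>carrier G. 0)"
        using 2 Suc.prems(4) regular_left_translate[OF f]
        by (simp add: vanishes_0 slice_def cong: restrict_cong)
      then show ?thesis using functional_zero[OF \<mu>] f by (simp add: conv_apply)
    qed
    then show ?thesis using augmentation_pow_regular unfolding vanishes_def by blast
  next
    case 3
    have k: "k = n' + m" "k = n + m'" using Suc.hyps(2) 3 by auto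
    have "vanishes k (dot (conv \<mu> \<nu>) g)" if g: "g \<in> augmentation_ideal G" for g
      unfolding vanishes_def
    proof
      fix f assume f: "f \<in> augmentation_ideal G [^]\<^bsub>ideals_set (coord_ring G)\<^esub> k"
      have fR: "f \<in> regular G" using f augmentation_pow_regular by blast
      obtain N :: nat and a b where aux: "\<forall>i<N. a i \<in> regular G \<and> b i \<in> regular G \<and>
          (a i \<in> augmentation_ideal G \<or> b i \<in> augmentation_ideal G)"
        "\<forall>x\<in>carrier G. \<forall>y\<in>carrier G. g (x \<otimes> y) = (\<Sum>i<N. a i x * b i y)"
        using comult_augmentation[OF g] by blast
      then have R: "\<And>i. i < N \<Longrightarrow> a i \<in> regular G" "\<And>i. i < N \<Longrightarrow> b i \<in> regular G"
        and aug: "\<And>i. i < N \<Longrightarrow> a i \<in> augmentation_ideal G \<or> b i \<in> augmentation_ideal G"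
        and ab: "\<And>x y. x \<in> carrier G \<Longrightarrow> y \<in> carrier G \<Longrightarrow> g (x \<otimes> y) = (\<Sum>i<N. a i x * b i y)"
        by blast+
      have "conv (dot \<mu> (a i)) (dot \<nu> (b i)) f = 0" if i: "i < N" for i
      proof -
        have F: "dot \<mu> (a i) \<in> functionals" "dot \<nu> (b i) \<in> functionals"
          using dot_functional \<mu> \<nu> R i by blast+
        have V: "vanishes n (dot \<mu> (a i))" "vanishes m (dot \<nu> (b i))"
          using vanishes_dot Suc.prems R i by blast+
        have "vanishes k (conv (dot \<mu> (a i)) (dot \<nu> (b i)))"
          using aug[OF i]
        proof
          assume "a i \<in> augmentation_ideal G"
          then have "vanishes n' (dot \<mu> (a i))" using Suc.prems(3) 3 vanishes_Suc[OF \<mu>] by blast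
          then show ?thesis using Suc.hyps(1)[OF k(1) F _ V(2)] k(1) by blast
        next
          assume "b i \<in> augmentation_ideal G"
          then have "vanishes m' (dot \<nu> (b i))" using Suc.prems(4) 3 vanishes_Suc[OF \<nu>] by blast
          then show ?thesis using Suc.hyps(1)[OF k(2) F V(1)] k(2) by blast
        qed
        then show ?thesis using f unfolding vanishes_def by blast
      qed
      then show "dot (conv \<mu> \<nu>) g f = 0"
        using dot_conv[OF \<mu> \<nu> augmentation_regular[OF g] fR R ab] by simp
    qed
    then have "vanishes (Suc k) (conv \<mu> \<nu>)"
      using vanishes_Suc[OF conv_functional[OF \<mu> \<nu>]] by blast
    then show ?thesis using Suc.hyps(2) by simp
  qed
qed

section \<open>Frobenius kernels\<close>

definition kills_frobenius :: "nat \<Rightarrow> (('g \<Rightarrow> 'k) \<Rightarrow> 'k) \<Rightarrow> bool" where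
  "kills_frobenius q \<mu> \<longleftrightarrow>
    (\<forall>g\<in>augmentation_ideal G. \<forall>h\<in>regular G. \<mu> (\<lambda>x\<in>carrier G. g x ^ q * h x) = 0)"

lemma kills_frobenius_iff_dot:
  "kills_frobenius q \<mu> \<longleftrightarrow> (\<forall>g\<in>augmentation_ideal G. dot \<mu> (\<lambda>x\<in>carrier G. g x ^ q) = 0)"
proof -
  have "(\<lambda>x\<in>carrier G. (\<lambda>x\<in>carrier G. g x ^ q) x * h x) = (\<lambda>x\<in>carrier G. g x ^ q * h x)"
    for g h :: "'g \<Rightarrow> 'k" by (rule restrict_ext) simp
  then have "dot \<mu> (\<lambda>x\<in>carrier G. g x ^ q) =
      (\<lambda>h. if h \<in> regular G then \<mu> (\<lambda>x\<in>carrier G. g x ^ q * h x) else 0)" for g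
    unfolding dot_def by presburger
  then show ?thesis unfolding kills_frobenius_def zero_fun_def by (simp only: fun_eq_iff) metis
qed

text \<open>Raising to the power \<open>q\<close> is additive, so \<open>\<Delta>(g\<^sup>q) = \<Sum>a\<^sub>i\<^sup>q \<otimes> b\<^sub>i\<^sup>q\<close> where \<open>a\<^sub>i\<close> or \<open>b\<^sub>i\<close> is in the augmentation ideal,
  and every summand of \<open>(\<mu>\<nu>)\<cdot>g\<^sup>q\<close> is zero.\<close>

lemma kills_frobenius_conv:
  assumes \<mu>: "\<mu> \<in> functionals" "kills_frobenius q \<mu>" and \<nu>: "\<nu> \<in> functionals" "kills_frobenius q \<nu>"
    and char: "CHAR('k) > 0" and q: "q = CHAR('k) ^ r"
  shows "kills_frobenius q (conv \<mu> \<nu>)"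
  unfolding kills_frobenius_iff_dot
proof
  fix g assume g: "g \<in> augmentation_ideal G"
  have p: "prime CHAR('k)" using char by (rule prime_CHAR_semidom)
  let ?pw = "\<lambda>f::'g \<Rightarrow> 'k. \<lambda>x\<in>carrier G. f x ^ q"
  obtain n :: nat and a b where aux: "\<forall>i<n. a i \<in> regular G \<and> b i \<in> regular G \<and>
      (a i \<in> augmentation_ideal G \<or> b i \<in> augmentation_ideal G)"
    "\<forall>x\<in>carrier G. \<forall>y\<in>carrier G. g (x \<otimes> y) = (\<Sum>i<n. a i x * b i y)"
    using comult_augmentation[OF g] by blast
  then have R: "\<And>i. i < n \<Longrightarrow> a i \<in> regular G" "\<And>i. i < n \<Longrightarrow> b i \<in> regular G"
    and aug: "\<And>i. i < n \<Longrightarrow> a i \<in> augmentation_ideal G \<or> b i \<in> augmentation_ideal G"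
    and ab: "\<And>x y. x \<in> carrier G \<Longrightarrow> y \<in> carrier G \<Longrightarrow> g (x \<otimes> y) = (\<Sum>i<n. a i x * b i y)"
    by blast+
  show "dot (conv \<mu> \<nu>) (?pw g) = 0"
  proof
    fix h
    show "dot (conv \<mu> \<nu>) (?pw g) h = 0 h"
    proof (cases "h \<in> regular G")
      case True
      have "dot (conv \<mu> \<nu>) (?pw g) h = (\<Sum>i<n. conv (dot \<mu> (?pw (a i))) (dot \<nu> (?pw (b i))) h)"
      proof (rule dot_conv[OF \<mu>(1) \<nu>(1) regular_power[OF augmentation_regular[OF g]] True])
        fix x y assume xy: "x \<in> carrier G" "y \<in> carrier G"
        have "(\<Sum>i<n. a i x * b i y) ^ q = (\<Sum>i<n. (a i x * b i y) ^ q)"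
          by (rule freshmans_dream_sum'[OF p q])
        then show "?pw g (x \<otimes> y) = (\<Sum>i<n. ?pw (a i) x * ?pw (b i) y)"
          using xy ab[OF xy] by (simp add: power_mult_distrib)
      qed (simp_all add: R regular_power)
      also have "\<dots> = 0"
      proof (rule sum.neutral, intro ballI)
        fix i assume "i \<in> {..<n}"
        then have i: "i < n" by simp
        have F: "dot \<mu> (?pw (a i)) \<in> functionals"
          using dot_functional \<mu>(1) R(1)[OF i] regular_power by blast
        have "dot \<mu> (?pw (a i)) = 0 \<or> dot \<nu> (?pw (b i)) = 0"
          using aug[OF i] \<mu>(2) \<nu>(2) unfolding kills_frobenius_iff_dot by blast
        then have "conv (dot \<mu> (?pw (a i))) (dot \<nu> (?pw (b i))) = 0"
          using conv_zero_left conv_zero_right[OF F] by metis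
        then show "conv (dot \<mu> (?pw (a i))) (dot \<nu> (?pw (b i))) h = 0" by simp
      qed
      finally show ?thesis by simp
    qed (simp add: dot_def)
  qed
qed

lemma ring_coord_ring: "ring (coord_ring G)"
proof (rule ringI)
  show "abelian_group (coord_ring G)"
  proof (rule abelian_groupI)
    fix f g h assume f: "f \<in> carrier (coord_ring G)" and g: "g \<in> carrier (coord_ring G)"
      and h: "h \<in> carrier (coord_ring G)"
    show "f \<oplus>\<^bsub>coord_ring G\<^esub> g \<in> carrier (coord_ring G)" using f g regular_add by simp
    show "f \<oplus>\<^bsub>coord_ring G\<^esub> g \<oplus>\<^bsub>coord_ring G\<^esub> h = f \<oplus>\<^bsub>coord_ring G\<^esub> (g \<oplus>\<^bsub>coord_ring G\<^esub> h)"
      by (simp add: add.assoc cong: restrict_cong)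
    show "f \<oplus>\<^bsub>coord_ring G\<^esub> g = g \<oplus>\<^bsub>coord_ring G\<^esub> f" by (simp add: add.commute)
    show "\<zero>\<^bsub>coord_ring G\<^esub> \<oplus>\<^bsub>coord_ring G\<^esub> f = f" using f by (simp cong: restrict_cong)
    have "(\<lambda>x\<in>carrier G. - 1 * f x) \<in> regular G" using f regular_scale[of f "- 1"] by simp
    moreover have "(\<lambda>x\<in>carrier G. - 1 * f x) \<oplus>\<^bsub>coord_ring G\<^esub> f = \<zero>\<^bsub>coord_ring G\<^esub>"
      by (simp cong: restrict_cong)
    ultimately show "\<exists>y\<in>carrier (coord_ring G). y \<oplus>\<^bsub>coord_ring G\<^esub> f = \<zero>\<^bsub>coord_ring G\<^esub>"
      by (metis coord_ring_simps(1))
  next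
    show "\<zero>\<^bsub>coord_ring G\<^esub> \<in> carrier (coord_ring G)" using regular_const by simp
  qed
  show "monoid (coord_ring G)"
  proof (rule monoidI)
    fix f g h assume f: "f \<in> carrier (coord_ring G)" and g: "g \<in> carrier (coord_ring G)"
    show "f \<otimes>\<^bsub>coord_ring G\<^esub> g \<in> carrier (coord_ring G)" using f g regular_mult by simp
    show "f \<otimes>\<^bsub>coord_ring G\<^esub> g \<otimes>\<^bsub>coord_ring G\<^esub> h = f \<otimes>\<^bsub>coord_ring G\<^esub> (g \<otimes>\<^bsub>coord_ring G\<^esub> h)"
      by (simp add: mult.assoc cong: restrict_cong)
    show "\<one>\<^bsub>coord_ring G\<^esub> \<otimes>\<^bsub>coord_ring G\<^esub> f = f" using f by (simp cong: restrict_cong)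
    show "f \<otimes>\<^bsub>coord_ring G\<^esub> \<one>\<^bsub>coord_ring G\<^esub> = f" using f by (simp cong: restrict_cong)
  next
    show "\<one>\<^bsub>coord_ring G\<^esub> \<in> carrier (coord_ring G)" using regular_const by simp
  qed
qed (simp_all add: algebra_simps cong: restrict_cong)

lemma frobenius_twist_iterate:
  "carrier ((frobenius_twist ^^ r) G) = carrier G" (is ?A)
  "one ((frobenius_twist ^^ r) G) = \<one>" (is ?B)
  "regular ((frobenius_twist ^^ r) G) = (\<lambda>f. \<lambda>x\<in>carrier G. f x ^ (CHAR('k) ^ r)) ` regular G" (is ?C)
proof -
  have twist: "carrier (frobenius_twist H) = carrier H" "one (frobenius_twist H) = one H"
    "regular (frobenius_twist H) = (\<lambda>f. \<lambda>x\<in>carrier H. f x ^ CHAR('k)) ` regular H"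
    for H :: "('g, 'k) alg_group"
    by (simp_all add: frobenius_twist_def)
  have "?A \<and> ?B \<and> ?C"
  proof (induct r)
    case 0
    have "(\<lambda>f. \<lambda>x\<in>carrier G. f x) ` regular G = (\<lambda>f. f) ` regular G"
      by (rule image_cong) simp_all
    then show ?case by simp
  next
    case (Suc r)
    then have IH: "carrier ((frobenius_twist ^^ r) G) = carrier G"
      "one ((frobenius_twist ^^ r) G) = \<one>"
      "regular ((frobenius_twist ^^ r) G) = (\<lambda>f. \<lambda>x\<in>carrier G. f x ^ (CHAR('k) ^ r)) ` regular G"
      by blast+
    have "(\<lambda>f. \<lambda>x\<in>carrier G. f x ^ CHAR('k)) ` (\<lambda>f. \<lambda>x\<in>carrier G. f x ^ (CHAR('k) ^ r)) ` regular G =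
      (\<lambda>f. \<lambda>x\<in>carrier G. f x ^ (CHAR('k) ^ Suc r)) ` regular G"
      unfolding image_image by (intro image_cong refl restrict_ext) (simp add: mult.commute flip: power_mult)
    then show "carrier ((frobenius_twist ^^ Suc r) G) = carrier G \<and>
      one ((frobenius_twist ^^ Suc r) G) = \<one> \<and>
      regular ((frobenius_twist ^^ Suc r) G) = (\<lambda>f. \<lambda>x\<in>carrier G. f x ^ (CHAR('k) ^ Suc r)) ` regular G"
      by (simp only: funpow.simps comp_apply twist IH simp_thms)
  qed
  then show ?A ?B ?C by blast+
qed

lemma frobenius_kernel_eq:
  assumes "CHAR('k) > 0"
  shows "frobenius_kernel G r =
    Idl\<^bsub>coord_ring G\<^esub> ((\<lambda>g. \<lambda>x\<in>carrier G. g x ^ (CHAR('k) ^ r)) ` augmentation_ideal G)"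
proof -
  let ?q = "CHAR('k) ^ r"
  have q: "?q > 0" using assms by simp
  have "augmentation_ideal ((frobenius_twist ^^ r) G) =
      (\<lambda>g. \<lambda>x\<in>carrier G. g x ^ ?q) ` augmentation_ideal G"
    using q by (auto simp: augmentation_ideal_def frobenius_twist_iterate)
  moreover have "compose (carrier G) (\<lambda>x\<in>carrier G. g x ^ ?q) (\<lambda>x. x) = (\<lambda>x\<in>carrier G. g x ^ ?q)" for g :: "'g \<Rightarrow> 'k"
    by (simp add: compose_def cong: restrict_cong)
  ultimately show ?thesis
    by (simp add: frobenius_kernel_def kernel_ideal_def image_image)
qed

lemma vanishes_on_frobenius_kernel_iff:
  assumes \<mu>: "\<mu> \<in> functionals" and char: "CHAR('k) > 0"
  shows "(\<forall>f\<in>frobenius_kernel G r. \<mu> f = 0) \<longleftrightarrow> kills_frobenius (CHAR('k) ^ r) \<mu>"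
proof -
  let ?q = "CHAR('k) ^ r"
  let ?S = "(\<lambda>g. \<lambda>x\<in>carrier G. g x ^ ?q) ` augmentation_ideal G"
  interpret R: ring "coord_ring G" by (rule ring_coord_ring)
  have S: "?S \<subseteq> carrier (coord_ring G)" using regular_power augmentation_regular by auto
  have pull: "(\<lambda>x\<in>carrier G. (\<lambda>x\<in>carrier G. g x ^ ?q) x * h x) = (\<lambda>x\<in>carrier G. g x ^ ?q * h x)"
    for g h :: "'g \<Rightarrow> 'k" by (rule restrict_ext) simp
  show ?thesis
    unfolding frobenius_kernel_eq[OF char]
  proof
    assume v: "\<forall>f\<in>Idl\<^bsub>coord_ring G\<^esub> ?S. \<mu> f = 0"
    show "kills_frobenius ?q \<mu>"
      unfolding kills_frobenius_def
    proof (intro ballI)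
      fix g h assume g: "g \<in> augmentation_ideal G" and h: "h \<in> regular G"
      have "(\<lambda>x\<in>carrier G. g x ^ ?q) \<in> Idl\<^bsub>coord_ring G\<^esub> ?S"
        using R.genideal_self[OF S] g by blast
      then have "(\<lambda>x\<in>carrier G. g x ^ ?q) \<otimes>\<^bsub>coord_ring G\<^esub> h \<in> Idl\<^bsub>coord_ring G\<^esub> ?S"
        by (rule ideal.I_r_closed[OF R.genideal_ideal[OF S]]) (simp add: h)
      then show "\<mu> (\<lambda>x\<in>carrier G. g x ^ ?q * h x) = 0" using v by (simp only: coord_ring_simps pull)
    qed
  next
    assume k: "kills_frobenius ?q \<mu>"
    \<comment> \<open>The largest ideal contained in the kernel of \<open>\<mu>\<close>.\<close>
    define K where "K = {f \<in> regular G. \<forall>h\<in>regular G. \<mu> (\<lambda>x\<in>carrier G. f x * h x) = 0}"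
    have "ideal K (coord_ring G)"
    proof (rule idealI[OF ring_coord_ring])
      show "subgroup K (add_monoid (coord_ring G))"
      proof
        show "K \<subseteq> carrier (add_monoid (coord_ring G))" by (auto simp: K_def)
        fix f g assume f: "f \<in> K" and g: "g \<in> K"
        show "f \<otimes>\<^bsub>add_monoid (coord_ring G)\<^esub> g \<in> K"
        proof -
          have "\<mu> (\<lambda>x\<in>carrier G. (\<lambda>x\<in>carrier G. f x + g x) x * h x) = 0" if h: "h \<in> regular G" for h
            using functional_add[OF \<mu> regular_mult[of f h] regular_mult[of g h]] f g h
            by (simp add: K_def distrib_right cong: restrict_cong)
          then show ?thesis using f g regular_add by (simp add: K_def)
        qed
      next
        show "\<one>\<^bsub>add_monoid (coord_ring G)\<^esub> \<in> K"
          using functional_zero[OF \<mu>] regular_const by (simp add: K_def cong: restrict_cong)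
      next
        fix f assume f: "f \<in> K"
        have m: "(\<lambda>x\<in>carrier G. - 1 * f x) \<in> regular G" using f regular_scale[of f "- 1"] by (simp add: K_def)
        have "(\<lambda>x\<in>carrier G. - 1 * f x) \<oplus>\<^bsub>coord_ring G\<^esub> f = \<zero>\<^bsub>coord_ring G\<^esub>"
          by (simp cong: restrict_cong)
        then have "inv\<^bsub>add_monoid (coord_ring G)\<^esub> f = (\<lambda>x\<in>carrier G. - 1 * f x)"
          using R.minus_equality[of "(\<lambda>x\<in>carrier G. - 1 * f x)" f] m f by (simp add: K_def a_inv_def)
        moreover have "\<mu> (\<lambda>x\<in>carrier G. (\<lambda>x\<in>carrier G. - 1 * f x) x * h x) = 0" if "h \<in> regular G" for h
          using functional_scale[OF \<mu> regular_mult[of f h], of "- 1"] f that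
          by (simp add: K_def cong: restrict_cong)
        ultimately show "inv\<^bsub>add_monoid (coord_ring G)\<^esub> f \<in> K" using m by (simp add: K_def)
      qed
      fix f h assume f: "f \<in> K" and h: "h \<in> carrier (coord_ring G)"
      have fR: "f \<in> regular G" using f by (simp add: K_def)
      have "\<mu> (\<lambda>x\<in>carrier G. (\<lambda>x\<in>carrier G. h x * f x) x * h' x) = 0" if h': "h' \<in> regular G" for h'
      proof -
        have "(\<lambda>x\<in>carrier G. (\<lambda>x\<in>carrier G. h x * f x) x * h' x) =
          (\<lambda>x\<in>carrier G. f x * (\<lambda>x\<in>carrier G. h x * h' x) x)"
          by (rule restrict_ext) simp
        moreover have "(\<lambda>x\<in>carrier G. h x * h' x) \<in> regular G" using regular_mult h h' by simp
        then have "\<mu> (\<lambda>x\<in>carrier G. f x * (\<lambda>x\<in>carrier G. h x * h' x) x) = 0"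
          using f unfolding K_def by blast
        ultimately show ?thesis by (simp only:)
      qed
      then show *: "h \<otimes>\<^bsub>coord_ring G\<^esub> f \<in> K" using fR h regular_mult by (simp add: K_def)
      have "f \<otimes>\<^bsub>coord_ring G\<^esub> h = h \<otimes>\<^bsub>coord_ring G\<^esub> f" by (simp add: mult.commute)
      then show "f \<otimes>\<^bsub>coord_ring G\<^esub> h \<in> K" using * by simp
    qed
    moreover have "?S \<subseteq> K"
    proof
      fix f assume "f \<in> ?S"
      then obtain g where g: "g \<in> augmentation_ideal G" "f = (\<lambda>x\<in>carrier G. g x ^ ?q)" by blast
      have "\<mu> (\<lambda>x\<in>carrier G. f x * h x) = 0" if "h \<in> regular G" for h
        unfolding g(2) pull using k g(1) that unfolding kills_frobenius_def by blast
      then show "f \<in> K" using g regular_power augmentation_regular unfolding K_def by blast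
    qed
    ultimately have "Idl\<^bsub>coord_ring G\<^esub> ?S \<subseteq> K" by (rule R.genideal_minimal)
    moreover have "\<mu> f = 0" if "f \<in> K" for f
    proof -
      have "\<mu> (\<lambda>x\<in>carrier G. f x * (\<lambda>x\<in>carrier G. 1) x) = 0"
        using that regular_const[of 1] unfolding K_def by blast
      moreover have "(\<lambda>x\<in>carrier G. f x * (\<lambda>x\<in>carrier G. 1) x) = f"
        using that by (simp add: K_def cong: restrict_cong)
      ultimately show ?thesis by simp
    qed
    ultimately show "\<forall>f\<in>Idl\<^bsub>coord_ring G\<^esub> ?S. \<mu> f = 0" by blast
  qed
qed

section \<open>Finite dimension of the distribution algebra\<close>

text \<open>The distributions on the \<open>r\<close>-th Frobenius kernel, as functionals that are \<open>0\<close> outside \<open>k[G]\<close>; see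
  \<open>distributions_eq\<close>.\<close>

definition dist_space :: "nat \<Rightarrow> (('g \<Rightarrow> 'k) \<Rightarrow> 'k) set" where
  "dist_space r = {\<mu> \<in> functionals. kills_frobenius (CHAR('k) ^ r) \<mu> \<and> (\<exists>n. vanishes n \<mu>)}"

lemma dist_space_functionals: "dist_space r \<subseteq> functionals"
  by (auto simp: dist_space_def)

lemma subspace_dist_space: "fun_space.subspace (dist_space r)"
proof (rule fun_space.subspaceI)
  show "0 \<in> dist_space r"
    using fun_space.subspace_0[OF subspace_functionals]
    by (auto simp: dist_space_def kills_frobenius_def vanishes_def)
  fix \<mu> \<nu> assume \<mu>: "\<mu> \<in> dist_space r" and \<nu>: "\<nu> \<in> dist_space r"
  obtain n m where v: "vanishes n \<mu>" "vanishes m \<nu>" using \<mu> \<nu> by (auto simp: dist_space_def)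
  have "vanishes (max n m) \<mu>" "vanishes (max n m) \<nu>"
    using vanishes_mono[OF _ v(1), of "max n m"] vanishes_mono[OF _ v(2), of "max n m"] \<mu> \<nu>
    by (auto simp: dist_space_def)
  then have "vanishes (max n m) (\<mu> + \<nu>)" by (simp add: vanishes_def)
  then show "\<mu> + \<nu> \<in> dist_space r"
    using \<mu> \<nu> fun_space.subspace_add[OF subspace_functionals]
    by (auto simp: dist_space_def kills_frobenius_def)
next
  fix c \<mu> assume \<mu>: "\<mu> \<in> dist_space r"
  then obtain n where "vanishes n \<mu>" by (auto simp: dist_space_def)
  then have "vanishes n (fscale c \<mu>)" by (simp add: vanishes_def)
  then show "fscale c \<mu> \<in> dist_space r"
    using \<mu> fun_space.subspace_scale[OF subspace_functionals]
    by (auto simp: dist_space_def kills_frobenius_def)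
qed

definition monomial :: "('g \<Rightarrow> 'k) set \<Rightarrow> (('g \<Rightarrow> 'k) \<Rightarrow> nat) \<Rightarrow> 'g \<Rightarrow> 'k" where
  "monomial S \<alpha> = (\<lambda>x\<in>carrier G. \<Prod>s\<in>S. s x ^ \<alpha> s)"

lemma monomial_regular:
  assumes "finite S" "S \<subseteq> regular G"
  shows "monomial S \<alpha> \<in> regular G"
  using assms
proof (induct S rule: finite_induct)
  case empty
  show "monomial {} \<alpha> \<in> regular G" using regular_const[of 1] by (simp add: monomial_def)
next
  case (insert s S)
  have "monomial (insert s S) \<alpha> =
      (\<lambda>x\<in>carrier G. (\<lambda>x\<in>carrier G. s x ^ \<alpha> s) x * monomial S \<alpha> x)"
    unfolding monomial_def using insert(1,2) by (intro restrict_ext) simp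
  moreover have "monomial S \<alpha> \<in> regular G" by (rule insert(3)) (use insert(4) in blast)
  moreover have "(\<lambda>x\<in>carrier G. s x ^ \<alpha> s) \<in> regular G"
    by (rule regular_power) (use insert(4) in blast)
  ultimately show "monomial (insert s S) \<alpha> \<in> regular G" using regular_mult by (simp only:)
qed

lemma monomial_generator:
  assumes S: "finite S" "s \<in> S"
  shows "(\<lambda>x\<in>carrier G. s x ^ q * monomial S \<alpha> x) = monomial S (\<alpha>(s := q + \<alpha> s))"
  unfolding monomial_def
proof (rule restrict_ext)
  fix x assume x: "x \<in> carrier G"
  have "(\<Prod>t\<in>S. t x ^ (\<alpha>(s := q + \<alpha> s)) t) = s x ^ (q + \<alpha> s) * (\<Prod>t\<in>S - {s}. t x ^ \<alpha> t)"
  proof (subst prod.remove[OF S])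
    have "(\<Prod>t\<in>S - {s}. t x ^ (\<alpha>(s := q + \<alpha> s)) t) = (\<Prod>t\<in>S - {s}. t x ^ \<alpha> t)"
      by (rule prod.cong) auto
    then show "s x ^ (\<alpha>(s := q + \<alpha> s)) s * (\<Prod>t\<in>S - {s}. t x ^ (\<alpha>(s := q + \<alpha> s)) t) =
        s x ^ (q + \<alpha> s) * (\<Prod>t\<in>S - {s}. t x ^ \<alpha> t)" by simp
  qed
  moreover have "(\<Prod>t\<in>S. t x ^ \<alpha> t) = s x ^ \<alpha> s * (\<Prod>t\<in>S - {s}. t x ^ \<alpha> t)"
    by (rule prod.remove[OF S])
  ultimately show "s x ^ q * (\<lambda>x\<in>carrier G. \<Prod>s\<in>S. s x ^ \<alpha> s) x = (\<Prod>t\<in>S. t x ^ (\<alpha>(s := q + \<alpha> s)) t)"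
    using x by (simp add: power_add mult.assoc)
qed

lemma dot_mult:
  assumes "f \<in> regular G" "g \<in> regular G"
  shows "dot \<mu> (\<lambda>x\<in>carrier G. f x * g x) = dot (dot \<mu> f) g"
proof
  fix h
  have "(\<lambda>x\<in>carrier G. (\<lambda>x\<in>carrier G. f x * g x) x * h x) =
    (\<lambda>x\<in>carrier G. f x * (\<lambda>x\<in>carrier G. g x * h x) x)"
    by (rule restrict_ext) (simp add: mult.assoc)
  then show "dot \<mu> (\<lambda>x\<in>carrier G. f x * g x) h = dot (dot \<mu> f) g h"
    unfolding dot_def using regular_mult[OF assms(2), of h] by presburger
qed

text \<open>Consider the functions \<open>f\<close> such that \<open>\<mu>\<cdot>f\<close> kills all monomials whenever \<open>\<mu>\<close> does. Quantifying over all \<open>\<mu>\<close>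
  makes them closed under products, as \<open>\<mu>\<cdot>(f g) = (\<mu>\<cdot>f)\<cdot>g\<close>. The monomial \<open>1\<close> then gives \<open>\<mu> f = 0\<close>.\<close>

lemma functional_zero_if_monomials_zero:
  assumes S: "finite S" "S \<subseteq> regular G" "regular G = generated_functions (carrier G) S"
    and \<mu>: "\<mu> \<in> functionals" and zero: "\<And>\<alpha>. \<mu> (monomial S \<alpha>) = 0"
  shows "\<mu> = 0"
proof -
  have key: "\<forall>\<mu>\<in>functionals. (\<forall>\<alpha>. \<mu> (monomial S \<alpha>) = 0) \<longrightarrow> (\<forall>\<alpha>. dot \<mu> f (monomial S \<alpha>) = 0)"
    if "f \<in> generated_functions (carrier G) S" for f
    using that
  proof (induct rule: generated_functions.induct)
    case (const c)
    have "dot \<mu> (\<lambda>x\<in>carrier G. c) (monomial S \<alpha>) = c * \<mu> (monomial S \<alpha>)" if "\<mu> \<in> functionals" for \<mu> \<alpha>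
      using functional_scale[OF that monomial_regular[OF S(1,2)], of c \<alpha>] monomial_regular[OF S(1,2)]
      by (simp add: dot_def cong: restrict_cong)
    then show "\<forall>\<mu>\<in>functionals. (\<forall>\<alpha>. \<mu> (monomial S \<alpha>) = 0) \<longrightarrow>
        (\<forall>\<alpha>. dot \<mu> (\<lambda>x\<in>carrier G. c) (monomial S \<alpha>) = 0)"
      by simp
  next
    case (gen s)
    have "(\<lambda>x\<in>carrier G. s x * monomial S \<alpha> x) = monomial S (\<alpha>(s := 1 + \<alpha> s))" for \<alpha>
      using monomial_generator[OF S(1) gen, of 1 \<alpha>] by simp
    then show "\<forall>\<mu>\<in>functionals. (\<forall>\<alpha>. \<mu> (monomial S \<alpha>) = 0) \<longrightarrow> (\<forall>\<alpha>. dot \<mu> s (monomial S \<alpha>) = 0)"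
      by (simp add: dot_def)
  next
    case (add f g)
    have fg: "f \<in> regular G" "g \<in> regular G" using add S by auto
    have "dot \<mu> (\<lambda>x\<in>carrier G. f x + g x) h = dot \<mu> f h + dot \<mu> g h"
      if "\<mu> \<in> functionals" "h \<in> regular G" for \<mu> h
      using functional_add[OF that(1) regular_mult[OF fg(1) that(2)] regular_mult[OF fg(2) that(2)]] that
      by (simp add: dot_def distrib_right cong: restrict_cong)
    then show "\<forall>\<mu>\<in>functionals. (\<forall>\<alpha>. \<mu> (monomial S \<alpha>) = 0) \<longrightarrow>
        (\<forall>\<alpha>. dot \<mu> (\<lambda>x\<in>carrier G. f x + g x) (monomial S \<alpha>) = 0)"
      using add(2,4) monomial_regular[OF S(1,2)] by simp
  next
    case (mult f g)
    have fg: "f \<in> regular G" "g \<in> regular G" using mult S by auto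
    show "\<forall>\<mu>\<in>functionals. (\<forall>\<alpha>. \<mu> (monomial S \<alpha>) = 0) \<longrightarrow>
        (\<forall>\<alpha>. dot \<mu> (\<lambda>x\<in>carrier G. f x * g x) (monomial S \<alpha>) = 0)"
      unfolding dot_mult[OF fg] using mult(2,4) dot_functional[OF _ fg(1)] by blast
  qed
  have one: "monomial S (\<lambda>_. 0) = (\<lambda>x\<in>carrier G. 1)" by (simp add: monomial_def)
  have "\<mu> f = 0 f" if f: "f \<in> regular G" for f
  proof -
    have "dot \<mu> f (monomial S (\<lambda>_. 0)) = 0" using key f S(3) \<mu> zero by blast
    then show ?thesis using f regular_const[of 1] by (simp add: one dot_def cong: restrict_cong)
  qed
  then show ?thesis
    by (rule functional_eqI[OF \<mu> fun_space.subspace_0[OF subspace_functionals]])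
qed

text \<open>\<open>s\<^sup>q - s(1)\<^sup>q = (s - s(1))\<^sup>q\<close> lies in the ideal of the Frobenius kernel.\<close>

lemma kills_frobenius_reduce:
  assumes \<mu>: "\<mu> \<in> functionals" "kills_frobenius q \<mu>" and char: "CHAR('k) > 0" and q: "q = CHAR('k) ^ r"
    and s: "s \<in> regular G" and h: "h \<in> regular G"
  shows "\<mu> (\<lambda>x\<in>carrier G. s x ^ q * h x) = s \<one> ^ q * \<mu> h"
proof -
  have p: "prime CHAR('k)" using char by (rule prime_CHAR_semidom)
  define g where "g = (\<lambda>x\<in>carrier G. s x - s \<one>)"
  have g: "g \<in> augmentation_ideal G"
    unfolding g_def using regular_diff_const[OF s] by (simp add: augmentation_ideal_def)
  have pw: "s x ^ q = (s x - s \<one>) ^ q + s \<one> ^ q" for x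
    using freshmans_dream'[OF p q, of "s x - s \<one>" "s \<one>"] by simp
  have "(\<lambda>x\<in>carrier G. s x ^ q * h x) = (\<lambda>x\<in>carrier G.
      (\<lambda>x\<in>carrier G. g x ^ q * h x) x + (\<lambda>x\<in>carrier G. s \<one> ^ q * h x) x)"
  proof (rule restrict_ext)
    fix x assume x: "x \<in> carrier G"
    have "s x ^ q * h x = (s x - s \<one>) ^ q * h x + s \<one> ^ q * h x"
      by (subst pw) (rule distrib_right)
    then show "s x ^ q * h x =
        (\<lambda>x\<in>carrier G. g x ^ q * h x) x + (\<lambda>x\<in>carrier G. s \<one> ^ q * h x) x"
      using x by (simp add: g_def)
  qed
  moreover have "(\<lambda>x\<in>carrier G. g x ^ q * h x) \<in> regular G"
    using regular_mult[OF regular_power[OF augmentation_regular[OF g], of q] h]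
    by (simp cong: restrict_cong)
  ultimately have "\<mu> (\<lambda>x\<in>carrier G. s x ^ q * h x) =
      \<mu> (\<lambda>x\<in>carrier G. g x ^ q * h x) + \<mu> (\<lambda>x\<in>carrier G. s \<one> ^ q * h x)"
    using functional_add[OF \<mu>(1) _ regular_scale[OF h]] by (simp only:)
  then show ?thesis using \<mu>(2) g h functional_scale[OF \<mu>(1) h] by (simp add: kills_frobenius_def)
qed

text \<open>Exponents can be reduced below \<open>q\<close> by \<open>kills_frobenius_reduce\<close>, so the finitely many monomials with
  exponents less than \<open>q\<close> separate the functionals in \<open>dist_space r\<close>.\<close>

lemma finite_dim_dist_space:
  assumes char: "CHAR('k) > 0"
  shows "\<exists>F. finite F \<and> dist_space r \<subseteq> fun_space.span F"
proof -
  obtain S where S: "finite S" "regular G = generated_functions (carrier G) S"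
    using finitely_generated by blast
  have SR: "S \<subseteq> regular G" using S(2) generated_functions.gen by blast
  define q where "q = CHAR('k) ^ r"
  have q: "q > 0" using char by (simp add: q_def)
  define X where "X = monomial S ` (S \<rightarrow>\<^sub>E {..<q})"
  show ?thesis
  proof (rule finite_dim_of_finite_separating_set)
    show "finite X" unfolding X_def using S(1) by (intro finite_imageI finite_PiE) auto
    show "fun_space.subspace (dist_space r)" by (rule subspace_dist_space)
    fix \<mu> assume \<mu>: "\<mu> \<in> dist_space r" and zero: "\<forall>f\<in>X. \<mu> f = 0"
    have \<mu>': "\<mu> \<in> functionals" "kills_frobenius q \<mu>" using \<mu> by (auto simp: dist_space_def q_def)
    have "\<mu> (monomial S \<alpha>) = 0" for \<alpha>
    proof (induct "\<Sum>s\<in>S. \<alpha> s" arbitrary: \<alpha> rule: less_induct)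
      case less
      show "\<mu> (monomial S \<alpha>) = 0"
      proof (cases "\<forall>s\<in>S. \<alpha> s < q")
        case True
        have "monomial S (restrict \<alpha> S) = monomial S \<alpha>"
          unfolding monomial_def by (intro restrict_ext prod.cong) auto
        moreover have "restrict \<alpha> S \<in> S \<rightarrow>\<^sub>E {..<q}" using True by auto
        ultimately show ?thesis using zero unfolding X_def by (metis imageI)
      next
        case False
        then obtain s where s: "s \<in> S" "q \<le> \<alpha> s" by force
        define \<beta> where "\<beta> = \<alpha>(s := \<alpha> s - q)"
        have "(\<Sum>s\<in>S. \<beta> s) < (\<Sum>s\<in>S. \<alpha> s)"
          using s q by (intro sum_strict_mono_ex1[OF S(1)]) (auto simp: \<beta>_def)
        then have "\<mu> (monomial S \<beta>) = 0" by (rule less)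
        moreover have "\<alpha> = \<beta>(s := q + \<beta> s)" using s by (auto simp: \<beta>_def)
        then have "monomial S \<alpha> = (\<lambda>x\<in>carrier G. s x ^ q * monomial S \<beta> x)"
          using monomial_generator[OF S(1) s(1), of q \<beta>] by simp
        ultimately show ?thesis
          using kills_frobenius_reduce[OF \<mu>' char q_def, of s "monomial S \<beta>"]
            monomial_regular[OF S(1) SR] SR s(1) by auto
      qed
    qed
    then show "\<mu> = 0" by (rule functional_zero_if_monomials_zero[OF S(1) SR S(2) \<mu>'(1)])
  qed
qed

lemma conv_dist_space:
  assumes char: "CHAR('k) > 0" and "\<mu> \<in> dist_space r" "\<nu> \<in> dist_space r"
  shows "conv \<mu> \<nu> \<in> dist_space r"
  using assms(2,3) conv_functional[of \<mu> \<nu>] kills_frobenius_conv[OF _ _ _ _ char refl, of \<mu> r \<nu>]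
    vanishes_conv[of \<mu> \<nu>] unfolding dist_space_def by blast

lemma counit_dist_space:
  assumes char: "CHAR('k) > 0"
  shows "counit \<in> dist_space r"
proof -
  have q: "CHAR('k) ^ r > 0" using char by simp
  have "kills_frobenius (CHAR('k) ^ r) counit"
    using q by (auto simp: kills_frobenius_def counit_def augmentation_ideal_def)
  moreover have "vanishes (Suc 0) counit"
    unfolding vanishes_Suc[OF counit_functional] vanishes_0
    by (auto simp: dot_def counit_def augmentation_ideal_def)
  ultimately show ?thesis using counit_functional by (auto simp: dist_space_def)
qed

section \<open>The adjoint action\<close>

definition conjugate :: "'g \<Rightarrow> ('g \<Rightarrow> 'k) \<Rightarrow> 'g \<Rightarrow> 'k" where
  "conjugate t f = (\<lambda>x\<in>carrier G. f (t \<otimes> x \<otimes> inv t))"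

text \<open>The adjoint action in the normalisation of \<open>functionals\<close>; see \<open>Ad_dist_of\<close>.\<close>

definition adj :: "'g \<Rightarrow> (('g \<Rightarrow> 'k) \<Rightarrow> 'k) \<Rightarrow> ('g \<Rightarrow> 'k) \<Rightarrow> 'k" where
  "adj t \<mu> = (\<lambda>f. if f \<in> regular G then \<mu> (conjugate t f) else 0)"

lemma conjugate_regular:
  assumes f: "f \<in> regular G" and t: "t \<in> carrier G"
  shows "conjugate t f \<in> regular G"
proof -
  have "conjugate t f = (\<lambda>x\<in>carrier G. (\<lambda>y\<in>carrier G. f (t \<otimes> y)) (x \<otimes> inv t))"
    unfolding conjugate_def using t by (intro restrict_ext) (simp add: m_assoc)
  then show ?thesis
    using regular_right_translate[OF regular_left_translate[OF f t] inv_closed[OF t]] by simp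
qed

lemma conjugate_apply: "x \<in> carrier G \<Longrightarrow> conjugate t f x = f (t \<otimes> x \<otimes> inv t)"
  by (simp add: conjugate_def)

lemma conjugate_augmentation:
  "g \<in> augmentation_ideal G \<Longrightarrow> t \<in> carrier G \<Longrightarrow> conjugate t g \<in> augmentation_ideal G"
  by (simp add: augmentation_ideal_def conjugate_regular conjugate_apply)

lemma conjugate_pointwise:
  assumes "t \<in> carrier G"
  shows "conjugate t (\<lambda>x\<in>carrier G. F (f x) (g x)) = (\<lambda>x\<in>carrier G. F (conjugate t f x) (conjugate t g x))"
  using assms unfolding conjugate_def by (intro restrict_ext) simp

lemma conjugate_conjugate:
  assumes "s \<in> carrier G" "t \<in> carrier G"
  shows "conjugate s (conjugate t f) = conjugate (t \<otimes> s) f"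
  unfolding conjugate_def
proof (rule restrict_ext)
  fix x assume x: "x \<in> carrier G"
  have "t \<otimes> (s \<otimes> x \<otimes> inv s) \<otimes> inv t = t \<otimes> s \<otimes> x \<otimes> inv (t \<otimes> s)"
    using assms x by (simp add: inv_mult_group m_assoc)
  then show "(\<lambda>x\<in>carrier G. f (t \<otimes> x \<otimes> inv t)) (s \<otimes> x \<otimes> inv s) = f (t \<otimes> s \<otimes> x \<otimes> inv (t \<otimes> s))"
    using assms x by simp
qed

lemma adj_functional:
  assumes \<mu>: "\<mu> \<in> functionals" and t: "t \<in> carrier G"
  shows "adj t \<mu> \<in> functionals"
proof (rule functionalsI)
  fix f g assume fg: "f \<in> regular G" "g \<in> regular G"
  show "adj t \<mu> (\<lambda>x\<in>carrier G. f x + g x) = adj t \<mu> f + adj t \<mu> g"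
    using conjugate_pointwise[OF t, of "(+)" f g] fg t
    by (simp add: adj_def regular_add functional_add[OF \<mu>] conjugate_regular)
next
  fix c f assume f: "f \<in> regular G"
  show "adj t \<mu> (\<lambda>x\<in>carrier G. c * f x) = c * adj t \<mu> f"
    using conjugate_pointwise[OF t, of "\<lambda>a b. c * a" f f] f t
    by (simp add: adj_def regular_scale functional_scale[OF \<mu>] conjugate_regular)
qed (simp add: adj_def)

lemma dot_adj:
  assumes t: "t \<in> carrier G" and g: "g \<in> regular G"
  shows "dot (adj t \<mu>) g = adj t (dot \<mu> (conjugate t g))"
proof
  fix h
  show "dot (adj t \<mu>) g h = adj t (dot \<mu> (conjugate t g)) h"
    using conjugate_pointwise[OF t, of "(*)" g h] regular_mult[OF g] conjugate_regular t
    by (simp add: dot_def adj_def)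
qed

lemma vanishes_adj:
  assumes "\<mu> \<in> functionals" "vanishes n \<mu>" and t: "t \<in> carrier G"
  shows "vanishes n (adj t \<mu>)"
  using assms(1,2)
proof (induct n arbitrary: \<mu>)
  case 0
  show "vanishes 0 (adj t \<mu>)" using 0 conjugate_regular t by (simp add: vanishes_0 adj_def)
next
  case (Suc n)
  have "vanishes n (dot (adj t \<mu>) g)" if g: "g \<in> augmentation_ideal G" for g
  proof -
    have g': "conjugate t g \<in> augmentation_ideal G" by (rule conjugate_augmentation[OF g t])
    have "vanishes n (dot \<mu> (conjugate t g))" using Suc(3) g' vanishes_Suc[OF Suc(2)] by blast
    then have "vanishes n (adj t (dot \<mu> (conjugate t g)))"
      by (rule Suc(1)[OF dot_functional[OF Suc(2) augmentation_regular[OF g']]])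
    then show ?thesis by (simp only: dot_adj[OF t augmentation_regular[OF g]])
  qed
  then show "vanishes (Suc n) (adj t \<mu>)"
    using vanishes_Suc[OF adj_functional[OF Suc(2) t]] by blast
qed

lemma adj_dist_space:
  assumes \<mu>: "\<mu> \<in> dist_space r" and t: "t \<in> carrier G"
  shows "adj t \<mu> \<in> dist_space r"
proof -
  let ?q = "CHAR('k) ^ r"
  have F: "\<mu> \<in> functionals" using \<mu> dist_space_functionals by blast
  have "adj t \<mu> (\<lambda>x\<in>carrier G. g x ^ ?q * h x) = 0"
    if g: "g \<in> augmentation_ideal G" and h: "h \<in> regular G" for g h
  proof -
    have "\<mu> (\<lambda>x\<in>carrier G. conjugate t g x ^ ?q * conjugate t h x) = 0"
      using \<mu> conjugate_augmentation[OF g t] conjugate_regular[OF h t]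
      by (simp add: dist_space_def kills_frobenius_def)
    then show ?thesis
      using conjugate_pointwise[OF t, of "\<lambda>a b. a ^ ?q * b" g h] by (simp add: adj_def)
  qed
  then have "kills_frobenius ?q (adj t \<mu>)" by (simp add: kills_frobenius_def)
  moreover have "\<exists>n. vanishes n (adj t \<mu>)"
    using \<mu> vanishes_adj[OF F _ t] by (auto simp: dist_space_def)
  ultimately show ?thesis using adj_functional[OF F t] by (simp add: dist_space_def)
qed

text \<open>Both sides integrate \<open>f (t x y t\<^sup>-\<^sup>1) = f (t x t\<^sup>-\<^sup>1 t y t\<^sup>-\<^sup>1)\<close> against \<open>\<mu>\<close> in \<open>x\<close> and \<open>\<nu>\<close> in \<open>y\<close>.\<close>

lemma adj_conv:
  assumes \<mu>: "\<mu> \<in> functionals" and \<nu>: "\<nu> \<in> functionals" and t: "t \<in> carrier G"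
  shows "adj t (conv \<mu> \<nu>) = conv (adj t \<mu>) (adj t \<nu>)"
proof (rule functional_eqI)
  show "adj t (conv \<mu> \<nu>) \<in> functionals" "conv (adj t \<mu>) (adj t \<nu>) \<in> functionals"
    using adj_functional conv_functional \<mu> \<nu> t by blast+
  fix f assume f: "f \<in> regular G"
  have "slice \<nu> (conjugate t f) x = conjugate t (slice (adj t \<nu>) f) x" if x: "x \<in> carrier G" for x
  proof -
    have tx: "t \<otimes> x \<otimes> inv t \<in> carrier G" using t x by simp
    have "conjugate t (\<lambda>y\<in>carrier G. f (t \<otimes> x \<otimes> inv t \<otimes> y)) = (\<lambda>y\<in>carrier G. conjugate t f (x \<otimes> y))"
      unfolding conjugate_def
    proof (rule restrict_ext)
      fix y assume y: "y \<in> carrier G"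
      have "inv t \<otimes> (t \<otimes> (y \<otimes> inv t)) = y \<otimes> inv t" using t y by (simp flip: m_assoc)
      then have "t \<otimes> x \<otimes> inv t \<otimes> (t \<otimes> y \<otimes> inv t) = t \<otimes> (x \<otimes> y) \<otimes> inv t"
        using t x y by (simp add: m_assoc)
      then show "(\<lambda>y\<in>carrier G. f (t \<otimes> x \<otimes> inv t \<otimes> y)) (t \<otimes> y \<otimes> inv t) =
          (\<lambda>x\<in>carrier G. f (t \<otimes> x \<otimes> inv t)) (x \<otimes> y)"
        using t x y by simp
    qed
    then show ?thesis
      using x tx regular_left_translate[OF f tx] by (simp add: slice_apply conjugate_apply adj_def)
  qed
  moreover have "slice \<nu> (conjugate t f) = (\<lambda>x\<in>carrier G. slice \<nu> (conjugate t f) x)"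
    "conjugate t (slice (adj t \<nu>) f) = (\<lambda>x\<in>carrier G. conjugate t (slice (adj t \<nu>) f) x)"
    by (simp_all add: slice_def conjugate_def cong: restrict_cong)
  ultimately have "slice \<nu> (conjugate t f) = conjugate t (slice (adj t \<nu>) f)"
    by (metis (no_types, lifting) restrict_ext)
  moreover have "slice (adj t \<nu>) f \<in> regular G" using slice_regular[OF adj_functional[OF \<nu> t] f] .
  ultimately show "adj t (conv \<mu> \<nu>) f = conv (adj t \<mu>) (adj t \<nu>) f"
    using f conjugate_regular[OF f t] by (simp add: adj_def[of t "conv \<mu> \<nu>"] adj_def[of t \<mu>] conv_apply)
qed

lemma adj_counit:
  assumes t: "t \<in> carrier G"
  shows "adj t counit = counit"
  using conjugate_regular t by (auto simp: fun_eq_iff adj_def counit_def conjugate_apply)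

lemma adj_adj:
  assumes s: "s \<in> carrier G" and t: "t \<in> carrier G"
  shows "adj s (adj t \<mu>) = adj (s \<otimes> t) \<mu>"
proof
  fix f
  show "adj s (adj t \<mu>) f = adj (s \<otimes> t) \<mu> f"
    using conjugate_regular[of f s] conjugate_conjugate[OF t s, of f] s by (simp add: adj_def)
qed

lemma adj_one:
  assumes \<mu>: "\<mu> \<in> functionals"
  shows "adj \<one> \<mu> = \<mu>"
proof (rule functional_eqI[OF adj_functional[OF \<mu> one_closed] \<mu>])
  fix f assume f: "f \<in> regular G"
  have "conjugate \<one> f = f" using f by (simp add: conjugate_def cong: restrict_cong)
  then show "adj \<one> \<mu> f = \<mu> f" using f by (simp add: adj_def)
qed

lemma adj_funpow:
  assumes s: "s \<in> carrier G" and \<mu>: "\<mu> \<in> functionals"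
  shows "(adj s ^^ n) \<mu> = adj (s [^] n) \<mu>"
proof (induct n)
  case 0
  show "(adj s ^^ 0) \<mu> = adj (s [^] (0::nat)) \<mu>" using adj_one[OF \<mu>] by simp
next
  case (Suc n)
  have "(adj s ^^ Suc n) \<mu> = adj s (adj (s [^] n) \<mu>)" using Suc by (simp only: funpow.simps comp_apply)
  also have "\<dots> = adj (s \<otimes> s [^] n) \<mu>" using s by (intro adj_adj) auto
  also have "s \<otimes> s [^] n = s [^] Suc n" using s by (simp only: nat_pow_Suc2)
  finally show "(adj s ^^ Suc n) \<mu> = adj (s [^] Suc n) \<mu>" .
qed

lemma adj_inj:
  assumes \<mu>: "\<mu> \<in> functionals" and t: "t \<in> carrier G" and z: "adj t \<mu> = 0"
  shows "\<mu> = 0"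
proof -
  have "\<mu> = adj (inv t) (adj t \<mu>)" using \<mu> t by (simp add: adj_adj adj_one)
  also have "\<dots> = 0" unfolding z by (auto simp: adj_def fun_eq_iff)
  finally show ?thesis .
qed

section \<open>Tori\<close>

text \<open>Both properties hold for a power of \<open>k\<^sup>*\<close>, where \<open>n\<close>-th roots exist because \<open>k\<close> is algebraically closed, and
  are transported along the isomorphism with the standard torus.\<close>

lemma torus_commutative_divisible:
  assumes T: "torus_in T G"
  shows "subgroup T G"
    and "\<And>s t. s \<in> T \<Longrightarrow> t \<in> T \<Longrightarrow> s \<otimes> t = t \<otimes> s"
    and "\<And>t n. t \<in> T \<Longrightarrow> n > 0 \<Longrightarrow> \<exists>s\<in>T. s [^] (n::nat) = t"
proof -
  show sub: "subgroup T G" using T by (simp add: torus_in_def closed_subgroup_def)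
  obtain m \<phi> where iso: "alg_group_iso (restrict_group G T) (standard_torus m :: (nat \<Rightarrow> 'k, 'k) alg_group) \<phi>"
    using T by (auto simp: torus_in_def)
  let ?X = "{..<m} \<rightarrow>\<^sub>E (- {0 :: 'k})"
  have bij: "bij_betw \<phi> T ?X"
    using iso by (simp add: alg_group_iso_def restrict_group_def standard_torus_def Let_def)
  have hom: "\<phi> (s \<otimes> t) = (\<lambda>i\<in>{..<m}. \<phi> s i * \<phi> t i)" if "s \<in> T" "t \<in> T" for s t
    using iso that by (auto simp: alg_group_iso_def alg_group_hom_def hom_def restrict_group_def
        standard_torus_def Let_def)
  have inj: "s = t" if "s \<in> T" "t \<in> T" "\<phi> s = \<phi> t" for s t
    using bij that by (auto simp: bij_betw_def inj_on_def)
  have mult: "s \<otimes> t \<in> T" if "s \<in> T" "t \<in> T" for s t using subgroup.m_closed[OF sub that] .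
  show "s \<otimes> t = t \<otimes> s" if "s \<in> T" "t \<in> T" for s t
    using that by (intro inj mult) (simp_all add: hom mult.commute)
  fix t and n :: nat assume t: "t \<in> T" and n: "n > 0"
  have \<phi>t: "\<phi> t \<in> ?X" using bij t by (auto simp: bij_betw_def)
  have "\<exists>y. y ^ n = \<phi> t i" for i using nth_root_exists[OF n] by blast
  then obtain y where y: "\<And>i. y i ^ n = \<phi> t i" by metis
  have "(\<lambda>i\<in>{..<m}. y i) \<in> ?X"
  proof (intro restrict_PiE_iff[THEN iffD2] ballI)
    fix i assume "i \<in> {..<m}"
    then have "\<phi> t i \<noteq> 0" using \<phi>t by (auto simp: PiE_iff)
    then show "y i \<in> - {0}" using y[of i] n by (auto simp: zero_power)
  qed
  then obtain s where s: "s \<in> T" "\<phi> s = (\<lambda>i\<in>{..<m}. y i)" using bij by (metis bij_betw_def imageE)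
  \<comment> \<open>The induction starts at the first power, so that multiplicativity of \<open>\<phi>\<close> suffices.\<close>
  have pow: "s [^] Suc k \<in> T \<and> \<phi> (s [^] Suc k) = (\<lambda>i\<in>{..<m}. y i ^ Suc k)" for k
  proof (induct k)
    case 0
    have "s [^] Suc 0 = s" using s subgroup.mem_carrier[OF sub] by simp
    then show "s [^] Suc 0 \<in> T \<and> \<phi> (s [^] Suc 0) = (\<lambda>i\<in>{..<m}. y i ^ Suc 0)" using s by simp
  next
    case (Suc k)
    then have IH: "s [^] Suc k \<in> T" "\<phi> (s [^] Suc k) = (\<lambda>i\<in>{..<m}. y i ^ Suc k)" by blast+
    have e: "s [^] Suc (Suc k) = s [^] Suc k \<otimes> s" by (rule nat_pow_Suc)
    have "\<phi> (s [^] Suc (Suc k)) = (\<lambda>i\<in>{..<m}. y i ^ Suc (Suc k))"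
      unfolding e hom[OF IH(1) s(1)] IH(2) s(2) by (rule restrict_ext) simp
    then show "s [^] Suc (Suc k) \<in> T \<and> \<phi> (s [^] Suc (Suc k)) = (\<lambda>i\<in>{..<m}. y i ^ Suc (Suc k))"
      using mult[OF IH(1) s(1)] e by simp
  qed
  obtain k where k: "n = Suc k" using n gr0_implies_Suc by blast
  have "(\<lambda>i\<in>{..<m}. y i ^ n) = \<phi> t"
  proof (rule extensionalityI[of _ "{..<m}"])
    show "\<phi> t \<in> extensional {..<m}" using \<phi>t by (auto simp: PiE_def)
  qed (auto simp: y)
  then have "s [^] n = t" using pow[of k] t by (intro inj) (simp_all only: k)
  then show "\<exists>s\<in>T. s [^] n = t" using s(1) by blast
qed

text \<open>Elements outside \<open>T\<close> are sent to \<open>1 \<in> T\<close>, so that the whole type of \<open>G\<close> can serve as the index type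
  without enlarging the group that acts.\<close>

lemma divisible_action_dist_space:
  assumes char: "CHAR('k) > 0" and T: "torus_in T G"
  shows "divisible_action fscale (dist_space r) conv counit (\<lambda>t. adj (if t \<in> T then t else \<one>))"
proof -
  note tor = torus_commutative_divisible[OF T]
  have TG: "(if t \<in> T then t else \<one>) \<in> T" for t using subgroup.one_closed[OF tor(1)] by simp
  have C: "(if t \<in> T then t else \<one>) \<in> carrier G" for t using subgroup.mem_carrier[OF tor(1) TG] .
  note F = subsetD[OF dist_space_functionals]
  show ?thesis
  proof unfold_locales
    show "fun_space.subspace (dist_space r)" by (rule subspace_dist_space)
    show "\<exists>F. finite F \<and> dist_space r \<subseteq> fun_space.span F" by (rule finite_dim_dist_space[OF char])
    show "counit \<in> dist_space r" by (rule counit_dist_space[OF char])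
    show "0 < CHAR('k)" by (rule char)
    fix a b c x assume a: "a \<in> dist_space r" and b: "b \<in> dist_space r"
    show "conv a b \<in> dist_space r" by (rule conv_dist_space[OF char a b])
    show "conv counit a = a" "conv a counit = a"
      using F[OF a] conv_counit_left conv_counit_right by blast+
    show "conv (fscale x a) b = fscale x (conv a b)" by (rule conv_scale_left)
    show "conv a (fscale x b) = fscale x (conv a b)" by (rule conv_scale_right[OF F[OF a] F[OF b]])
    assume c: "c \<in> dist_space r"
    show "conv (conv a b) c = conv a (conv b c)" by (rule conv_assoc[OF F[OF a] F[OF b] F[OF c]])
    show "conv (a + b) c = conv a c + conv b c" by (rule conv_add_left)
    show "conv a (b + c) = conv a b + conv a c" by (rule conv_add_right[OF F[OF a] F[OF b] F[OF c]])
  next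
    fix a b x t assume a: "a \<in> dist_space r"
    show "adj (if t \<in> T then t else \<one>) a \<in> dist_space r" by (rule adj_dist_space[OF a C])
    show "adj (if t \<in> T then t else \<one>) (a + b) =
        adj (if t \<in> T then t else \<one>) a + adj (if t \<in> T then t else \<one>) b"
      by (rule ext) (simp only: adj_def plus_fun_apply, simp)
    show "adj (if t \<in> T then t else \<one>) (fscale x a) = fscale x (adj (if t \<in> T then t else \<one>) a)"
      by (rule ext) (simp only: adj_def fscale_apply, simp)
    show "adj (if t \<in> T then t else \<one>) a = 0 \<Longrightarrow> a = 0" by (rule adj_inj[OF F[OF a] C])
    show "adj (if s \<in> T then s else \<one>) (adj (if t \<in> T then t else \<one>) a) =
        adj (if t \<in> T then t else \<one>) (adj (if s \<in> T then s else \<one>) a)" for s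
      unfolding adj_adj[OF C C] by (subst tor(2)[OF TG TG]) (rule refl)
    assume b: "b \<in> dist_space r"
    show "adj (if t \<in> T then t else \<one>) (conv a b) =
        conv (adj (if t \<in> T then t else \<one>) a) (adj (if t \<in> T then t else \<one>) b)"
      by (rule adj_conv[OF F[OF a] F[OF b] C])
  next
    show "adj (if t \<in> T then t else \<one>) counit = counit" for t by (rule adj_counit[OF C])
    fix n :: nat and t assume n: "0 < n"
    obtain s where s: "s \<in> T" "s [^] n = (if t \<in> T then t else \<one>)" using tor(3)[OF TG n] by blast
    have "adj (if t \<in> T then t else \<one>) a = (adj s ^^ n) a" if "a \<in> dist_space r" for a
      using adj_funpow[OF subgroup.mem_carrier[OF tor(1) s(1)] F[OF that]] s(2) by simp
    then show "\<exists>s. \<forall>a\<in>dist_space r. adj (if t \<in> T then t else \<one>) a =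
        (adj (if s \<in> T then s else \<one>) ^^ n) a"
      using s(1) by (intro exI[of _ s]) simp
  qed
qed

section \<open>Idempotents of the algebra of distributions\<close>

text \<open>The passage from functionals that are \<open>0\<close> outside \<open>k[G]\<close> to extensional ones; an isomorphism from
  \<open>dist_space r\<close> onto \<open>Dist(G\<^sub>r)\<close>.\<close>

definition dist_of :: "(('g \<Rightarrow> 'k) \<Rightarrow> 'k) \<Rightarrow> ('g \<Rightarrow> 'k) \<Rightarrow> 'k" where
  "dist_of \<mu> = restrict \<mu> (regular G)"

lemma dist_of_apply: "f \<in> regular G \<Longrightarrow> dist_of \<mu> f = \<mu> f"
  by (simp add: dist_of_def)

lemma dist_of_inj: "\<mu> \<in> functionals \<Longrightarrow> \<nu> \<in> functionals \<Longrightarrow> dist_of \<mu> = dist_of \<nu> \<Longrightarrow> \<mu> = \<nu>"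
  by (rule functional_eqI) (metis dist_of_apply)+

lemma linear_functional_cong:
  assumes "\<And>f. f \<in> regular G \<Longrightarrow> \<mu> f = \<nu> f"
  shows "linear_functional G \<mu> \<longleftrightarrow> linear_functional G \<nu>"
proof -
  have "f \<oplus>\<^bsub>coord_ring G\<^esub> g \<in> regular G" "c \<odot>\<^bsub>coord_ring G\<^esub> f \<in> regular G"
    if "f \<in> regular G" "g \<in> regular G" for f g c
    using that regular_add regular_scale by (simp_all add: coord_ring_def)
  then show ?thesis using assms unfolding linear_functional_def by (metis (no_types, lifting))
qed

lemma frobenius_kernel_regular:
  assumes "CHAR('k) > 0"
  shows "frobenius_kernel G r \<subseteq> regular G"
proof -
  interpret R: ring "coord_ring G" by (rule ring_coord_ring)
  have "(\<lambda>g. \<lambda>x\<in>carrier G. g x ^ (CHAR('k) ^ r)) ` augmentation_ideal G \<subseteq> carrier (coord_ring G)"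
    using regular_power augmentation_regular by auto
  from R.genideal_ideal[OF this] show ?thesis
    unfolding frobenius_kernel_eq[OF assms] using ideal.Icarr by fastforce
qed

lemma dist_of_in_distributions:
  assumes char: "CHAR('k) > 0" and \<mu>: "\<mu> \<in> functionals"
  shows "dist_of \<mu> \<in> distributions G (frobenius_kernel G r) \<longleftrightarrow> \<mu> \<in> dist_space r"
proof -
  have "linear_functional G (dist_of \<mu>)"
    using linear_functional_cong[of "dist_of \<mu>" \<mu>] \<mu> dist_of_apply by (simp add: functionals_def)
  moreover have "(\<forall>f\<in>frobenius_kernel G r. dist_of \<mu> f = 0) \<longleftrightarrow> kills_frobenius (CHAR('k) ^ r) \<mu>"
    using vanishes_on_frobenius_kernel_iff[OF \<mu> char] frobenius_kernel_regular[OF char] dist_of_apply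
    by (metis subsetD)
  moreover have "(\<forall>f\<in>augmentation_ideal G [^]\<^bsub>ideals_set (coord_ring G)\<^esub> n. dist_of \<mu> f = 0) \<longleftrightarrow>
      vanishes n \<mu>" for n :: nat
    unfolding vanishes_def
  proof (rule ball_cong[OF refl])
    fix f assume "f \<in> augmentation_ideal G [^]\<^bsub>ideals_set (coord_ring G)\<^esub> n"
    then have "f \<in> regular G" using augmentation_pow_regular by blast
    then show "dist_of \<mu> f = 0 \<longleftrightarrow> \<mu> f = 0" by (simp add: dist_of_apply)
  qed
  moreover have "dist_of \<mu> \<in> extensional (regular G)" by (simp add: dist_of_def)
  ultimately show ?thesis using \<mu> by (simp add: distributions_def dist_space_def)
qed

lemma distributions_eq:
  assumes char: "CHAR('k) > 0"
  shows "distributions G (frobenius_kernel G r) = dist_of ` dist_space r"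
proof
  show "dist_of ` dist_space r \<subseteq> distributions G (frobenius_kernel G r)"
    using dist_of_in_distributions[OF char] dist_space_functionals by blast
  show "distributions G (frobenius_kernel G r) \<subseteq> dist_of ` dist_space r"
  proof
    fix d assume d: "d \<in> distributions G (frobenius_kernel G r)"
    define \<mu> where "\<mu> f = (if f \<in> regular G then d f else 0)" for f
    have "linear_functional G d" "d \<in> extensional (regular G)" using d by (auto simp: distributions_def)
    then have "\<mu> \<in> functionals" "dist_of \<mu> = d"
      using linear_functional_cong[of \<mu> d]
      by (auto simp: functionals_def \<mu>_def dist_of_def fun_eq_iff extensional_def)
    then show "d \<in> dist_of ` dist_space r" using dist_of_in_distributions[OF char] d by blast
  qed
qed

lemma Dist_simps:
  "carrier (Dist G J) = distributions G J"
  "f \<in> regular G \<Longrightarrow> (d \<otimes>\<^bsub>Dist G J\<^esub> d') f = d (\<lambda>x\<in>carrier G. d' (\<lambda>y\<in>carrier G. f (x \<otimes> y)))"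
  "\<zero>\<^bsub>Dist G J\<^esub> = dist_of 0"
  "\<one>\<^bsub>Dist G J\<^esub> = dist_of counit"
  "dist_of \<mu> \<oplus>\<^bsub>Dist G J\<^esub> dist_of \<nu> = dist_of (\<mu> + \<nu>)"
  by (auto simp: Dist_def dist_of_def counit_def fun_eq_iff restrict_def)

lemma Dist_mult:
  assumes \<nu>: "\<nu> \<in> functionals"
  shows "dist_of \<mu> \<otimes>\<^bsub>Dist G J\<^esub> dist_of \<nu> = dist_of (conv \<mu> \<nu>)"
proof -
  have "(dist_of \<mu> \<otimes>\<^bsub>Dist G J\<^esub> dist_of \<nu>) f = dist_of (conv \<mu> \<nu>) f" for f
  proof (cases "f \<in> regular G")
    case f: True
    have "(\<lambda>x\<in>carrier G. dist_of \<nu> (\<lambda>y\<in>carrier G. f (x \<otimes> y))) = slice \<nu> f"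
      unfolding slice_def using regular_left_translate[OF f] by (intro restrict_ext dist_of_apply)
    then show ?thesis using f slice_regular[OF \<nu> f] by (simp add: Dist_simps dist_of_apply conv_apply)
  qed (simp add: Dist_def dist_of_def)
  then show ?thesis by blast
qed

lemma Ad_dist_of:
  assumes t: "t \<in> carrier G"
  shows "Ad G t (dist_of \<mu>) = dist_of (adj t \<mu>)"
proof -
  have "conjugate t f = (\<lambda>x\<in>carrier G. f (t \<otimes> x \<otimes> inv t))" for f by (rule conjugate_def)
  then have "Ad G t (dist_of \<mu>) f = dist_of (adj t \<mu>) f" for f
    using conjugate_regular[OF _ t, of f] by (simp add: Ad_def dist_of_def adj_def)
  then show ?thesis by blast
qed

lemma abelian_monoid_Dist:
  assumes char: "CHAR('k) > 0"
  shows "abelian_monoid (Dist G (frobenius_kernel G r))"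
proof (rule abelian_monoidI)
  note [simp] = Dist_simps(1,3,5) distributions_eq[OF char]
  let ?D = "Dist G (frobenius_kernel G r)"
  show "\<zero>\<^bsub>?D\<^esub> \<in> carrier ?D" using fun_space.subspace_0[OF subspace_dist_space] by simp
  fix a b c assume "a \<in> carrier ?D" "b \<in> carrier ?D" "c \<in> carrier ?D"
  then obtain \<mu> \<nu> \<rho> where "a = dist_of \<mu>" "b = dist_of \<nu>" "c = dist_of \<rho>"
    "\<mu> \<in> dist_space r" "\<nu> \<in> dist_space r" "\<rho> \<in> dist_space r" by auto
  then show "a \<oplus>\<^bsub>?D\<^esub> b \<in> carrier ?D" "a \<oplus>\<^bsub>?D\<^esub> b \<oplus>\<^bsub>?D\<^esub> c = a \<oplus>\<^bsub>?D\<^esub> (b \<oplus>\<^bsub>?D\<^esub> c)"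
    "a \<oplus>\<^bsub>?D\<^esub> b = b \<oplus>\<^bsub>?D\<^esub> a" "\<zero>\<^bsub>?D\<^esub> \<oplus>\<^bsub>?D\<^esub> a = a"
    using fun_space.subspace_add[OF subspace_dist_space] by (simp_all add: add.assoc add.commute add.left_commute)
qed

lemma finsum_Dist:
  assumes char: "CHAR('k) > 0"
  shows "finite I \<Longrightarrow> (\<And>i. i \<in> I \<Longrightarrow> h i \<in> dist_space r) \<Longrightarrow>
    (\<Oplus>\<^bsub>Dist G (frobenius_kernel G r)\<^esub> i\<in>I. dist_of (h i)) = dist_of (\<Sum>i\<in>I. h i)"
proof (induct I rule: finite_induct)
  case empty
  interpret D: abelian_monoid "Dist G (frobenius_kernel G r)" by (rule abelian_monoid_Dist[OF char])
  show "(\<Oplus>\<^bsub>Dist G (frobenius_kernel G r)\<^esub> i\<in>{}. dist_of (h i)) = dist_of (\<Sum>i\<in>{}. h i)"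
    by (simp only: D.finsum_empty sum.empty Dist_simps(3))
next
  case (insert j I)
  interpret D: abelian_monoid "Dist G (frobenius_kernel G r)" by (rule abelian_monoid_Dist[OF char])
  have IH: "(\<Oplus>\<^bsub>Dist G (frobenius_kernel G r)\<^esub> i\<in>I. dist_of (h i)) = dist_of (\<Sum>i\<in>I. h i)"
    by (rule insert(3)) (rule insert(4), blast)
  have "dist_of (h i) \<in> carrier (Dist G (frobenius_kernel G r))" if "i \<in> insert j I" for i
    using insert(4)[OF that] by (simp only: Dist_simps(1) distributions_eq[OF char] imageI)
  then show "(\<Oplus>\<^bsub>Dist G (frobenius_kernel G r)\<^esub> i\<in>insert j I. dist_of (h i)) =
      dist_of (\<Sum>i\<in>insert j I. h i)"
    using insert(1,2) by (subst D.finsum_insert) (auto simp: IH Dist_simps(5))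
qed

theorem torus_fixed_primitive_decomposition:
  fixes r :: nat
  assumes char: "CHAR('k) > 0" and T: "torus_in T G"
  defines "D \<equiv> Dist G (frobenius_kernel G r)"
  shows "\<exists>(n::nat) e.
    (\<forall>i\<in>{1..n}. e i \<in> Dist_fixed G (frobenius_kernel G r) T \<and> idempotent_elt D (e i)) \<and>
    (\<forall>i\<in>{1..n}. \<forall>j\<in>{1..n}. i \<noteq> j \<longrightarrow> orthogonal_elts D (e i) (e j)) \<and>
    (\<Oplus>\<^bsub>D\<^esub> i\<in>{1..n}. e i) = \<one>\<^bsub>D\<^esub> \<and>
    (\<forall>i\<in>{1..n}. primitive_idempotent D (e i))"
proof -
  let ?act = "\<lambda>t. adj (if t \<in> T then t else \<one>)"
  interpret A: divisible_action fscale "dist_space r" conv counit ?act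
    by (rule divisible_action_dist_space[OF char T])
  obtain E where E: "finite E" "E \<subseteq> A.fixed" "\<And>x. x \<in> E \<Longrightarrow> A.primitive_in (dist_space r) x"
    "A.orthogonal_family E" "\<Sum>E = counit"
    using A.fixed_primitive_decomposition by blast
  obtain h where h: "bij_betw h {1..card E} E" using ex_bij_betw_nat_finite_1[OF E(1)] by blast
  have hE: "h i \<in> E" if "i \<in> {1..card E}" for i using h that by (auto simp: bij_betw_def)
  have EA: "x \<in> dist_space r" if "x \<in> E" for x using E(2) A.fixed_subset that by blast
  note F = subsetD[OF dist_space_functionals]
  have zero: "(0 :: ('g \<Rightarrow> 'k) \<Rightarrow> 'k) \<in> functionals" by (rule fun_space.subspace_0[OF subspace_functionals])
  have carrier_D: "carrier D = dist_of ` dist_space r"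
    by (simp only: D_def Dist_simps(1) distributions_eq[OF char])
  have idem: "idempotent_elt D (dist_of \<mu>) \<longleftrightarrow> conv \<mu> \<mu> = \<mu>" if \<mu>: "\<mu> \<in> dist_space r" for \<mu>
    using dist_of_inj[OF conv_functional[OF F[OF \<mu>] F[OF \<mu>]] F[OF \<mu>]] \<mu>
    by (auto simp: idempotent_elt_def carrier_D) (simp_all add: D_def Dist_mult[OF F[OF \<mu>]])
  have nonzero: "dist_of \<mu> = \<zero>\<^bsub>D\<^esub> \<longleftrightarrow> \<mu> = 0" if \<mu>: "\<mu> \<in> dist_space r" for \<mu>
    using dist_of_inj[OF F[OF \<mu>] zero] by (auto simp: D_def Dist_simps(3))
  have prod_zero: "dist_of \<mu> \<otimes>\<^bsub>D\<^esub> dist_of \<nu> = \<zero>\<^bsub>D\<^esub> \<longleftrightarrow> conv \<mu> \<nu> = 0"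
    if \<mu>: "\<mu> \<in> dist_space r" and \<nu>: "\<nu> \<in> dist_space r" for \<mu> \<nu>
    using nonzero[OF conv_dist_space[OF char \<mu> \<nu>]] Dist_mult[OF F[OF \<nu>]] by (simp add: D_def)
  have prim: "primitive_idempotent D (dist_of x)" if x: "x \<in> E" for x
    unfolding primitive_idempotent_def
  proof (intro conjI notI)
    have px: "x \<in> dist_space r" "conv x x = x" "x \<noteq> 0"
      using E(3)[OF x] by (auto simp: A.primitive_in_def)
    show "idempotent_elt D (dist_of x)" using idem px by blast
    show "dist_of x = \<zero>\<^bsub>D\<^esub> \<Longrightarrow> False" using nonzero px by blast
    assume "\<exists>f g. idempotent_elt D f \<and> idempotent_elt D g \<and> f \<noteq> \<zero>\<^bsub>D\<^esub> \<and> g \<noteq> \<zero>\<^bsub>D\<^esub> \<and>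
      orthogonal_elts D f g \<and> dist_of x = f \<oplus>\<^bsub>D\<^esub> g"
    then obtain f g where fg: "idempotent_elt D f" "idempotent_elt D g" "f \<noteq> \<zero>\<^bsub>D\<^esub>" "g \<noteq> \<zero>\<^bsub>D\<^esub>"
      "orthogonal_elts D f g" "dist_of x = f \<oplus>\<^bsub>D\<^esub> g" by blast
    have "f \<in> carrier D" "g \<in> carrier D" using fg by (auto simp: idempotent_elt_def)
    then obtain \<mu> \<nu> where \<mu>\<nu>: "f = dist_of \<mu>" "g = dist_of \<nu>" "\<mu> \<in> dist_space r" "\<nu> \<in> dist_space r"
      unfolding carrier_D by blast
    have "conv \<mu> \<mu> = \<mu>" "conv \<nu> \<nu> = \<nu>" using fg \<mu>\<nu> idem by blast+
    moreover have "\<mu> \<noteq> 0" "\<nu> \<noteq> 0" using fg \<mu>\<nu> nonzero by blast+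
    moreover have "conv \<mu> \<nu> = 0" "conv \<nu> \<mu> = 0"
      using fg(5) \<mu>\<nu> prod_zero unfolding orthogonal_elts_def by blast+
    moreover have "x = \<mu> + \<nu>"
    proof (rule dist_of_inj[OF F[OF px(1)]])
      show "\<mu> + \<nu> \<in> functionals" using F A.add_closed \<mu>\<nu> by blast
      show "dist_of x = dist_of (\<mu> + \<nu>)" using fg(6) by (simp only: \<mu>\<nu> D_def Dist_simps(5))
    qed
    ultimately show False using E(3)[OF x] \<mu>\<nu>(3,4) unfolding A.primitive_in_def by blast
  qed
  have fixed: "dist_of x \<in> Dist_fixed G (frobenius_kernel G r) T" if x: "x \<in> E" for x
  proof -
    have "Ad G t (dist_of x) = dist_of x" if t: "t \<in> T" for t
    proof -
      have "?act t x = x" using E(2) x unfolding A.fixed_def by blast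
      moreover have "t \<in> carrier G"
        using subgroup.mem_carrier[OF torus_commutative_divisible(1)[OF T] t] .
      ultimately show ?thesis using t by (simp add: Ad_dist_of)
    qed
    then show ?thesis using carrier_D EA[OF x] by (simp add: Dist_fixed_def D_def)
  qed
  have "(\<Oplus>\<^bsub>D\<^esub> i\<in>{1..card E}. dist_of (h i)) = dist_of (\<Sum>i\<in>{1..card E}. h i)"
    unfolding D_def using hE EA by (intro finsum_Dist[OF char]) auto
  also have "(\<Sum>i\<in>{1..card E}. h i) = counit"
    using sum.reindex_bij_betw[OF h, of "\<lambda>x. x"] E(5) by simp
  finally have sum: "(\<Oplus>\<^bsub>D\<^esub> i\<in>{1..card E}. dist_of (h i)) = \<one>\<^bsub>D\<^esub>" by (simp only: D_def Dist_simps(4))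
  have orth: "orthogonal_elts D (dist_of (h i)) (dist_of (h j))"
    if ij: "i \<in> {1..card E}" "j \<in> {1..card E}" "i \<noteq> j" for i j
  proof -
    have "h i \<noteq> h j" using inj_onD[OF bij_betw_imp_inj_on[OF h]] ij by blast
    then have "conv (h i) (h j) = 0" "conv (h j) (h i) = 0"
      using E(4) hE[OF ij(1)] hE[OF ij(2)] unfolding A.orthogonal_family_def by simp_all
    then show ?thesis
      unfolding orthogonal_elts_def
      using prod_zero[OF EA[OF hE[OF ij(1)]] EA[OF hE[OF ij(2)]]]
        prod_zero[OF EA[OF hE[OF ij(2)]] EA[OF hE[OF ij(1)]]] by simp
  qed
  show ?thesis
  proof (rule exI[of _ "card E"], rule exI[of _ "\<lambda>i. dist_of (h i)"], intro conjI ballI impI)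
    fix i assume i: "i \<in> {1..card E}"
    show "dist_of (h i) \<in> Dist_fixed G (frobenius_kernel G r) T" by (rule fixed[OF hE[OF i]])
    show "primitive_idempotent D (dist_of (h i))" by (rule prim[OF hE[OF i]])
    then show "idempotent_elt D (dist_of (h i))" by (simp add: primitive_idempotent_def)
    show "orthogonal_elts D (dist_of (h i)) (dist_of (h j))" if "j \<in> {1..card E}" "i \<noteq> j" for j
      using orth i that by blast
  qed (rule sum)
qed

end

theorem theorem4p2p5:
  fixes G :: "('g, 'k::alg_closed_field) alg_group" and T :: "'g set" and r p :: nat
  assumes "CHAR('k) = p" and "p > 0"
    and "affine_alg_group G" and "simple_alg_group G" and "simply_connected_group G"
    and "maximal_torus T G"
    and "r \<ge> 1"
  shows "\<exists>(n::nat) e.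
    (\<forall>i\<in>{1..n}. e i \<in> Dist_fixed G (frobenius_kernel G r) T \<and>
       idempotent_elt (Dist G (frobenius_kernel G r)) (e i)) \<and>
    (\<forall>i\<in>{1..n}. \<forall>j\<in>{1..n}. i \<noteq> j \<longrightarrow>
       orthogonal_elts (Dist G (frobenius_kernel G r)) (e i) (e j)) \<and>
    (\<Oplus>\<^bsub>Dist G (frobenius_kernel G r)\<^esub> i\<in>{1..n}. e i) = \<one>\<^bsub>Dist G (frobenius_kernel G r)\<^esub> \<and>
    (\<forall>i\<in>{1..n}. primitive_idempotent (Dist G (frobenius_kernel G r)) (e i))"
proof -
  have "torus_in T G" using assms(6) by (simp add: maximal_torus_def)
  moreover have "CHAR('k) > 0" using assms(1,2) by simp
  ultimately show ?thesis
    using affine_alg_group.torus_fixed_primitive_decomposition[OF assms(3)] by blast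
qed

end
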